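(* Let $k$ be an algebraically closed field, let $a,b\ge 2$, and let $U\subseteq R_{a,b}=H^0(\mathcal{O}_{\mathbb{P}^1\times\mathbb{P}^1}(a,b))$ be a four-dimensional basepoint free vector space with basis $\{p_0,p_1,p_2,p_3\}$. If $I_U=\langle p_0,p_1,p_2,p_3\rangle$ has a linear first syzygy, then the singular locus of $X_U=\phi_U(\mathbb{P}^1\times\mathbb{P}^1)\subseteq\mathbb{P}^3$ contains a line.
   Context: $R=k[s,t,u,v]$ is bigraded with $s,t$ of bidegree $(1,0)$ and $u,v$ of bidegree $(0,1)$; $R_{a,b}$ denotes the bidegree $(a,b)$ graded piece, identified with $H^0(\mathcal{O}_{\mathbb{P}^1\times\mathbb{P}^1}(a,b))$. $U$ is basepoint free if $p_0,\dots,p_3$ have no common zero on $\mathbb{P}^1\times\mathbb{P}^1$; in that case they define a regular map $\phi_U=(p_0:p_1:p_2:p_3):\mathbb{P}^1\times\mathbb{P}^1\to\mathbb{P}^3$, whose image (with its reduced structure) is $X_U$. A first syzygy on $I_U$ is an element $(g_0,g_1,g_2,g_3)\in R^4$ with $\sum_{i=0}^3 g_ip_i=0$; it has bidegree $(c,d)$ if all $g_i$ lie in $R_{c,d}$. A linear first syzygy is a nonzero first syzygy of bidegree $(0,1)$ or $(1,0)$. *)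

theory Defs
  imports "HOL-Analysis.Cartesian_Space" "HOL-Library.Poly_Mapping" "HOL-Library.Extended_Nat"
    "HOL-Computational_Algebra.Polynomial"
begin

text \<open>Polynomials in variables indexed by \<open>'v\<close>: finitely supported maps from monomials (finitely
  supported exponent vectors) to coefficients. Poly_Mapping makes this a commutative ring under
  convolution.\<close>

type_synonym ('v, 'k) mpoly = "('v \<Rightarrow>\<^sub>0 nat) \<Rightarrow>\<^sub>0 'k"

definition mp_scale :: "'k::field \<Rightarrow> ('v, 'k) mpoly \<Rightarrow> ('v, 'k) mpoly" where
  "mp_scale c f = Poly_Mapping.single 0 c * f"

global_interpretation mp: vector_space "mp_scale :: 'k::field \<Rightarrow> ('v, 'k) mpoly \<Rightarrow> ('v, 'k) mpoly"
  defines mp_subspace = mp.subspace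
    and mp_span = mp.span
    and mp_independent = mp.independent
    and mp_dim = mp.dim
  by unfold_locales
    (simp_all add: mp_scale_def distrib_left distrib_right single_add mult_single
      flip: mult.assoc)

definition mp_eval :: "('v, 'k::field) mpoly \<Rightarrow> ('v \<Rightarrow> 'k) \<Rightarrow> 'k" where
  "mp_eval f x = (\<Sum>m\<in>Poly_Mapping.keys f.
     Poly_Mapping.lookup f m * (\<Prod>i\<in>Poly_Mapping.keys m. x i ^ Poly_Mapping.lookup m i))"

text \<open>If the exponent of \<open>i\<close> in \<open>m\<close> is zero, the subtraction of exponents truncates, but the
  coefficient of that term is zero.\<close>

definition mp_deriv :: "'v \<Rightarrow> ('v, 'k::field) mpoly \<Rightarrow> ('v, 'k) mpoly" where
  "mp_deriv i f = (\<Sum>m\<in>Poly_Mapping.keys f.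
     Poly_Mapping.single (m - Poly_Mapping.single i 1)
       (of_nat (Poly_Mapping.lookup m i) * Poly_Mapping.lookup f m))"

definition homogeneous :: "nat \<Rightarrow> ('v::finite, 'k::field) mpoly \<Rightarrow> bool" where
  "homogeneous d f \<longleftrightarrow> (\<forall>m\<in>Poly_Mapping.keys f. (\<Sum>i\<in>UNIV. Poly_Mapping.lookup m i) = d)"

text \<open>The points of the projective space with homogeneous coordinates indexed by \<open>'n\<close> (so of
  dimension \<open>CARD('n) - 1\<close>) are the one-dimensional subspaces of \<open>'k ^ 'n\<close>.\<close>

definition proj_space :: "('k::field ^ 'n) set set" where
  "proj_space = {P. vec.subspace P \<and> vec.dim P = 1}"

definition is_line :: "('k::field ^ 'n) set set \<Rightarrow> bool" where
  "is_line L \<longleftrightarrow> (\<exists>W. vec.subspace W \<and> vec.dim W = 2 \<and> L = {P \<in> proj_space. P \<subseteq> W})"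

definition vanishes_at :: "('n, 'k::field) mpoly \<Rightarrow> ('k ^ 'n) set \<Rightarrow> bool" where
  "vanishes_at F P \<longleftrightarrow> (\<forall>x\<in>P. mp_eval F (($) x) = 0)"

text \<open>\<open>closed_in X Z\<close>: \<open>Z\<close> is closed in the topology induced on \<open>X\<close> by the Zariski topology.\<close>

definition closed_in :: "('k::field ^ 'n) set set \<Rightarrow> ('k ^ 'n) set set \<Rightarrow> bool" where
  "closed_in X Z \<longleftrightarrow> (\<exists>S \<subseteq> {F. \<exists>d. homogeneous d F}.
     Z = {P \<in> X. \<forall>F\<in>S. vanishes_at F P})"

definition irreducible_closed_in :: "('k::field ^ 'n) set set \<Rightarrow> ('k ^ 'n) set set \<Rightarrow> bool" where
  "irreducible_closed_in X Z \<longleftrightarrow> closed_in X Z \<and> Z \<noteq> {} \<and>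
     (\<forall>A B. closed_in X A \<and> closed_in X B \<and> Z = A \<union> B \<longrightarrow> Z = A \<or> Z = B)"

text \<open>The dimension of \<open>X\<close> at \<open>P\<close>, i.e. the Krull dimension of the local ring of \<open>X\<close> at \<open>P\<close>: the
  supremum of the lengths \<open>n\<close> of chains \<open>Z 0 \<subset> \<dots> \<subset> Z n\<close> of irreducible closed subsets of \<open>X\<close>
  through \<open>P\<close>.\<close>

definition dim_at :: "('k::field ^ 'n) set set \<Rightarrow> ('k ^ 'n) set \<Rightarrow> enat" where
  "dim_at X P = Sup {enat n | n. \<exists>Z. (\<forall>i\<le>n. irreducible_closed_in X (Z i) \<and> P \<in> Z i) \<and>
     (\<forall>i<n. Z i \<subset> Z (Suc i))}"

text \<open>The homogeneous polynomials in the radical ideal of \<open>X\<close>; using all of them is what gives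
  \<open>X\<close> its reduced structure.\<close>

definition vanishing_forms :: "('k::field ^ 'n) set set \<Rightarrow> ('n, 'k) mpoly set" where
  "vanishing_forms X = {F. (\<exists>d. homogeneous d F) \<and> (\<forall>P\<in>X. vanishes_at F P)}"

text \<open>The linear subspace of \<open>'k ^ 'n\<close> underlying the projective Zariski tangent space of \<open>X\<close> at
  \<open>P\<close>, that is, the kernel of the Jacobian matrix at \<open>P\<close> of the ideal of \<open>X\<close>. It contains \<open>P\<close>, and
  its quotient by \<open>P\<close> is, up to a twist, the dual of the cotangent space of the local ring of \<open>X\<close>
  at \<open>P\<close>; hence the shift by one in \<open>nonsingular_at\<close>.\<close>

definition embedded_tangent_space ::
  "('k::field ^ 'n) set set \<Rightarrow> ('k ^ 'n) set \<Rightarrow> ('k ^ 'n) set" where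
  "embedded_tangent_space X P = {w. \<forall>F\<in>vanishing_forms X. \<forall>x\<in>P.
     (\<Sum>i\<in>UNIV. mp_eval (mp_deriv i F) (($) x) * w $ i) = 0}"

definition nonsingular_at :: "('k::field ^ 'n) set set \<Rightarrow> ('k ^ 'n) set \<Rightarrow> bool" where
  "nonsingular_at X P \<longleftrightarrow> enat (vec.dim (embedded_tangent_space X P)) = dim_at X P + 1"

definition singular_locus :: "('k::field ^ 'n) set set \<Rightarrow> ('k ^ 'n) set set" where
  "singular_locus X = {P \<in> X. \<not> nonsingular_at X P}"

text \<open>The ring \<open>R = k[s,t,u,v]\<close>: the variables \<open>Inl i\<close> stand for \<open>s, t\<close> and the variables \<open>Inr j\<close>
  for \<open>u, v\<close>.\<close>

type_synonym 'k bipoly = "(2 + 2, 'k) mpoly"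

definition bigraded_piece :: "nat \<Rightarrow> nat \<Rightarrow> 'k::field bipoly set" where
  "bigraded_piece a b = {f. \<forall>m\<in>Poly_Mapping.keys f.
     (\<Sum>i\<in>UNIV. Poly_Mapping.lookup m (Inl i)) = a \<and>
     (\<Sum>j\<in>UNIV. Poly_Mapping.lookup m (Inr j)) = b}"

definition bi_eval :: "'k::field bipoly \<Rightarrow> 'k ^ 2 \<Rightarrow> 'k ^ 2 \<Rightarrow> 'k" where
  "bi_eval f x y = mp_eval f (case_sum (($) x) (($) y))"

definition basepoint_free :: "'k::field bipoly ^ 4 \<Rightarrow> bool" where
  "basepoint_free p \<longleftrightarrow> \<not> (\<exists>P\<in>proj_space. \<exists>Q\<in>proj_space.
     \<forall>i. \<forall>x\<in>P. \<forall>y\<in>Q. bi_eval (p $ i) x y = 0)"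

text \<open>If the \<open>p $ i\<close> are bihomogeneous of the same bidegree, all the vectors spanning
  \<open>phi_map p (P, Q)\<close> are multiples of the one obtained from any nonzero \<open>x \<in> P\<close> and \<open>y \<in> Q\<close>; so
  this is a point of projective space, unless \<open>(P, Q)\<close> is a basepoint.\<close>

definition phi_map :: "'k::field bipoly ^ 4 \<Rightarrow> ('k ^ 2) set \<times> ('k ^ 2) set \<Rightarrow> ('k ^ 4) set" where
  "phi_map p = (\<lambda>(P, Q). vec.span {(\<chi> i. bi_eval (p $ i) x y) | x y. x \<in> P \<and> y \<in> Q})"

definition image_variety :: "'k::field bipoly ^ 4 \<Rightarrow> ('k ^ 4) set set" where
  "image_variety p = phi_map p ` (proj_space \<times> proj_space)"

definition first_syzygy :: "'k::field bipoly ^ 4 \<Rightarrow> 'k bipoly ^ 4 \<Rightarrow> bool" where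
  "first_syzygy p g \<longleftrightarrow> (\<Sum>i\<in>UNIV. g $ i * p $ i) = 0"

definition has_bidegree :: "'k::field bipoly ^ 4 \<Rightarrow> nat \<Rightarrow> nat \<Rightarrow> bool" where
  "has_bidegree g c d \<longleftrightarrow> (\<forall>i. g $ i \<in> bigraded_piece c d)"

definition has_linear_first_syzygy :: "'k::field bipoly ^ 4 \<Rightarrow> bool" where
  "has_linear_first_syzygy p \<longleftrightarrow>
     (\<exists>g. first_syzygy p g \<and> g \<noteq> 0 \<and> (has_bidegree g 0 1 \<or> has_bidegree g 1 0))"

definition is_basis_of :: "'k::field bipoly ^ 4 \<Rightarrow> 'k bipoly set \<Rightarrow> bool" where
  "is_basis_of p U \<longleftrightarrow> inj (($) p) \<and> mp_independent (range (($) p)) \<and>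
     mp_span (range (($) p)) = U"

end

theory Submission
  imports Defs "Jordan_Normal_Form.Determinant"
begin

text \<open>
  By the symmetry of the two factors, let the syzygy have bidegree \<open>(0,1)\<close>; it then reads
  \<open>u A + v B = 0\<close> with linear combinations \<open>A\<close>, \<open>B\<close> of the \<open>p\<^sub>i\<close>, so \<open>A = v q\<close> and \<open>B = - u q\<close> for
  a form \<open>q\<close> of bidegree \<open>(a, b - 1)\<close>. Hence \<open>\<phi> = (v q : - u q : P : Q)\<close> in suitable coordinates of
  \<open>\<bbbP>\<^sup>3\<close>, and the curve \<open>q = 0\<close> is mapped to the line \<open>L\<close> where the first two coordinates vanish. It is
  mapped onto \<open>L\<close>, because it meets every curve \<open>d P = c Q\<close>: forms of sufficiently positive bidegrees
  on \<open>\<bbbP>\<^sup>1 \<times> \<bbbP>\<^sup>1\<close> have a common zero (\<open>biforms_common_zero\<close>, by elimination).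

  \<open>X\<close> is singular along \<open>L\<close> because every form \<open>F\<close> that vanishes on \<open>X\<close> vanishes to second order
  along \<open>L\<close>. Indeed, let \<open>F\<^sub>0\<close>, \<open>F\<^sub>1\<close> be the restrictions to \<open>L\<close> of the derivatives of \<open>F\<close> in the two
  directions normal to \<open>L\<close>. Expanding \<open>F(v q, - u q, P, Q) = 0\<close> to first order in \<open>q\<close> and dividing
  by \<open>q\<close> shows that \<open>v F\<^sub>0(P, Q) = u F\<^sub>1(P, Q)\<close> on the curve \<open>q = 0\<close>. Let \<open>R\<close> be an irreducible
  component of this curve that dominates the second factor; as \<open>\<phi>\<close> has no basepoint, \<open>R\<close> is not
  contracted, so that a common factor of \<open>F\<^sub>0\<close> and \<open>F\<^sub>1\<close> can be cancelled in this relation. Suppose that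
  \<open>F\<^sub>0\<close> and \<open>F\<^sub>1\<close> are coprime of degree \<open>n > 0\<close>. The relation says that \<open>F\<^sub>0(P, Q) = u \<sigma>\<close> and
  \<open>F\<^sub>1(P, Q) = v \<sigma>\<close> on \<open>R\<close> for a form \<open>\<sigma>\<close> of bidegree \<open>(n a, n b - 1)\<close>. This bidegree is positive, as
  \<open>b \<ge> 2\<close>, so \<open>\<sigma>\<close> has a zero on \<open>R\<close>; there \<open>(P : Q)\<close> is a common zero of \<open>F\<^sub>0\<close> and \<open>F\<^sub>1\<close>, which
  is absurd. Degree \<open>0\<close> is impossible because \<open>R\<close> does not lie in a fibre of the second projection.
  Therefore \<open>F\<^sub>0 = F\<^sub>1 = 0\<close> (\<open>prime_curve_relation_trivial\<close>, \<open>contact_along_line\<close>).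

  So the embedded tangent space is all of \<open>k\<^sup>4\<close> at every point of \<open>L\<close>, while the local dimension of \<open>X\<close>
  is at most \<open>2\<close> (\<open>dim_at_le_two\<close>): a longer chain of irreducible closed subsets would give four
  algebraically independent forms of equal degree on \<open>X\<close>, and the spaces of forms on \<open>\<bbbP>\<^sup>1 \<times> \<bbbP>\<^sup>1\<close>
  grow too slowly for that.
\<close>

section \<open>Forms on a product of two projective lines\<close>

text \<open>Over a finite field, \<open>1 + (\<Prod>c. X - c)\<close> would have no root.\<close>

lemma infinite_UNIV_alg_closed: "infinite (UNIV :: 'a::alg_closed_field set)"
proof
  assume fin: "finite (UNIV :: 'a set)"
  define p :: "'a poly" where "p = (\<Prod>c\<in>UNIV. [:-c, 1:]) + 1"
  have "degree (\<Prod>c\<in>(UNIV::'a set). [:-c, 1:]) = card (UNIV :: 'a set)"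
    by (subst degree_prod_eq_sum_degree) auto
  moreover have "card (UNIV :: 'a set) > 0" using fin by (simp add: card_gt_0_iff)
  ultimately have "degree p > 0"
    unfolding p_def by (subst degree_add_eq_left) auto
  then obtain x where "poly p x = 0" using alg_closed_imp_poly_has_root by blast
  moreover have "poly (\<Prod>c\<in>(UNIV::'a set). [:-c, 1:]) x = 0"
    unfolding poly_prod using fin by (subst prod_zero_iff) (auto intro: bexI[of _ x])
  ultimately show False by (simp add: p_def)
qed

lemma poly_eq_zero_if_cofinite_roots:
  fixes p :: "'a::alg_closed_field poly"
  assumes "finite S" and "\<And>x. x \<notin> S \<Longrightarrow> poly p x = 0"
  shows "p = 0"
proof (rule ccontr)
  assume "p \<noteq> 0"
  then have "finite {x. poly p x = 0}" by (rule poly_roots_finite)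
  then have "finite (S \<union> {x. poly p x = 0})" using assms(1) by simp
  moreover have "S \<union> {x. poly p x = 0} = UNIV" using assms(2) by auto
  ultimately show False using infinite_UNIV_alg_closed by metis
qed

text \<open>A polynomial in \<open>X\<close> and \<open>Y\<close> is an element of \<open>k[Y][X]\<close>: the variable \<open>X\<close> is the outer one.\<close>

definition eval2 :: "'a::comm_ring_1 poly poly \<Rightarrow> 'a \<Rightarrow> 'a \<Rightarrow> 'a" where
  "eval2 P X Y = poly (poly P [:X:]) Y"

lemma eval2_simps [simp]:
  "eval2 0 X Y = 0" "eval2 1 X Y = 1"
  "eval2 (P + Q) X Y = eval2 P X Y + eval2 Q X Y"
  "eval2 (P - Q) X Y = eval2 P X Y - eval2 Q X Y"
  "eval2 (- P) X Y = - eval2 P X Y"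
  "eval2 (P * Q) X Y = eval2 P X Y * eval2 Q X Y"
  "eval2 (P ^ n) X Y = eval2 P X Y ^ n"
  "eval2 [:c:] X Y = poly c Y"
  by (simp_all add: eval2_def)

lemma eval2_sum [simp]: "eval2 (\<Sum>i\<in>I. P i) X Y = (\<Sum>i\<in>I. eval2 (P i) X Y)"
  by (induction I rule: infinite_finite_induct) simp_all

lemma eval2_prod [simp]: "eval2 (\<Prod>i\<in>I. P i) X Y = (\<Prod>i\<in>I. eval2 (P i) X Y)"
  by (induction I rule: infinite_finite_induct) simp_all

lemma eval2_monom [simp]: "eval2 (monom (monom c j) i) X Y = c * X ^ i * Y ^ j"
  by (simp add: eval2_def poly_monom)

lemma poly_poly_eqI:
  fixes P Q :: "'a::alg_closed_field poly poly"
  assumes "\<And>X Y. eval2 P X Y = eval2 Q X Y"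
  shows "P = Q"
proof -
  have "poly (P - Q) [:X:] = 0" for X
    by (rule poly_eq_zero_if_cofinite_roots[of "{}"]) (use assms[of X] in \<open>auto simp: eval2_def\<close>)
  then have "range (\<lambda>X. [:X:]) \<subseteq> {z. poly (P - Q) z = 0}" by auto
  moreover have "infinite (range (\<lambda>X::'a. [:X:]))"
    using infinite_UNIV_alg_closed by (subst finite_image_iff) (auto simp: inj_on_def)
  ultimately have "infinite {z. poly (P - Q) z = 0}" using finite_subset by blast
  then have "P - Q = 0" using poly_roots_finite by blast
  then show ?thesis by simp
qed

text \<open>A form of bidegree \<open>(m, n)\<close> in \<open>s, t\<close> and \<open>u, v\<close> is handled through its dehomogenisation at
  \<open>t = v = 1\<close>, with \<open>X = s\<close> and \<open>Y = u\<close>. Factors \<open>t\<close> and \<open>v\<close> are invisible there, so the bidegree has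
  to be carried along, and the actual degrees are only bounded by it.\<close>

definition bidegree_le :: "nat \<Rightarrow> nat \<Rightarrow> 'a::comm_ring_1 poly poly \<Rightarrow> bool" where
  "bidegree_le m n P \<longleftrightarrow> degree P \<le> m \<and> (\<forall>i. degree (coeff P i) \<le> n)"

definition hom_eval :: "nat \<Rightarrow> nat \<Rightarrow> 'a::comm_ring_1 poly poly \<Rightarrow> 'a \<Rightarrow> 'a \<Rightarrow> 'a \<Rightarrow> 'a \<Rightarrow> 'a" where
  "hom_eval m n P s t u v =
     (\<Sum>i\<le>m. \<Sum>j\<le>n. coeff (coeff P i) j * (s ^ i * t ^ (m - i)) * (u ^ j * v ^ (n - j)))"

lemma bidegree_le_0 [simp]: "bidegree_le m n 0"
  by (simp add: bidegree_le_def)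

lemma bidegree_le_add: "bidegree_le m n P \<Longrightarrow> bidegree_le m n Q \<Longrightarrow> bidegree_le m n (P + Q)"
  by (simp add: bidegree_le_def degree_add_le)

lemma bidegree_le_minus: "bidegree_le m n P \<Longrightarrow> bidegree_le m n (- P)"
  by (simp add: bidegree_le_def)

lemma bidegree_le_diff: "bidegree_le m n P \<Longrightarrow> bidegree_le m n Q \<Longrightarrow> bidegree_le m n (P - Q)"
  by (simp add: bidegree_le_def degree_diff_le)

lemma bidegree_le_mult:
  assumes "bidegree_le m n P" "bidegree_le m' n' Q"
  shows "bidegree_le (m + m') (n + n') (P * Q)"
proof -
  have "degree (P * Q) \<le> m + m'"
    using degree_mult_le[of P Q] assms by (simp add: bidegree_le_def)
  moreover have "degree (coeff (P * Q) i) \<le> n + n'" for i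
    unfolding coeff_mult
  proof (rule degree_sum_le)
    fix k assume "k \<in> {..i}"
    have "degree (coeff P k * coeff Q (i - k)) \<le> degree (coeff P k) + degree (coeff Q (i - k))"
      by (rule degree_mult_le)
    also have "\<dots> \<le> n + n'" using assms by (intro add_mono) (auto simp: bidegree_le_def)
    finally show "degree (coeff P k * coeff Q (i - k)) \<le> n + n'" .
  qed simp
  ultimately show ?thesis by (simp add: bidegree_le_def)
qed

lemma bidegree_le_const [simp]: "bidegree_le m n [:[:c:]:]"
  by (auto simp: bidegree_le_def coeff_pCons split: nat.split)

lemma bidegree_le_power: "bidegree_le m n P \<Longrightarrow> bidegree_le (k * m) (k * n) (P ^ k)"
proof (induction k)
  case 0
  then show ?case using bidegree_le_const[of 0 0 1] by (simp add: one_pCons)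
next
  case (Suc k)
  then show ?case using bidegree_le_mult[of m n P "k * m" "k * n" "P ^ k"] by simp
qed

lemma bidegree_le_sum: "(\<And>i. i \<in> I \<Longrightarrow> bidegree_le m n (P i)) \<Longrightarrow> bidegree_le m n (\<Sum>i\<in>I. P i)"
  by (induction I rule: infinite_finite_induct) (auto intro: bidegree_le_add)

lemma bidegree_le_smult: "bidegree_le m n P \<Longrightarrow> bidegree_le m n ([:[:c:]:] * P)"
  using bidegree_le_mult[of 0 0 "[:[:c:]:]" m n P] by simp

lemma bidegree_le_monom: "i \<le> m \<Longrightarrow> j \<le> n \<Longrightarrow> bidegree_le m n (monom (monom c j) i)"
  by (auto simp: bidegree_le_def degree_monom_le[THEN order_trans] )

lemma hom_eval_add: "hom_eval m n (P + Q) s t u v = hom_eval m n P s t u v + hom_eval m n Q s t u v"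
  by (simp add: hom_eval_def algebra_simps sum.distrib)

lemma hom_eval_0 [simp]: "hom_eval m n 0 s t u v = 0"
  by (simp add: hom_eval_def)

lemma hom_eval_monom:
  assumes "i \<le> m" "j \<le> n"
  shows "hom_eval m n (monom (monom c j) i) s t u v = c * (s ^ i * t ^ (m - i)) * (u ^ j * v ^ (n - j))"
proof -
  have "hom_eval m n (monom (monom c j) i) s t u v =
     (\<Sum>i'\<le>m. \<Sum>j'\<le>n. if i' = i then if j' = j then
        c * (s ^ i * t ^ (m - i)) * (u ^ j * v ^ (n - j)) else 0 else 0)"
    unfolding hom_eval_def by (intro sum.cong refl) (auto simp: coeff_monom)
  also have "\<dots> = (\<Sum>i'\<le>m. if i' = i then \<Sum>j'\<le>n. if j' = j then
        c * (s ^ i * t ^ (m - i)) * (u ^ j * v ^ (n - j)) else 0 else 0)"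
    by (intro sum.cong refl) auto
  finally show ?thesis using assms by simp
qed

lemma monom_sum_left: "monom (\<Sum>j\<in>J. f j) i = (\<Sum>j\<in>J. monom (f j) i)"
  by (induction J rule: infinite_finite_induct) (simp_all flip: add_monom)

lemma bidegree_le_expansion:
  assumes "bidegree_le m n P"
  shows "P = (\<Sum>i\<le>m. \<Sum>j\<le>n. monom (monom (coeff (coeff P i) j) j) i)"
proof -
  have "P = (\<Sum>i\<le>m. monom (coeff P i) i)"
    using assms by (intro poly_as_sum_of_monoms'[symmetric]) (simp add: bidegree_le_def)
  also have "\<dots> = (\<Sum>i\<le>m. \<Sum>j\<le>n. monom (monom (coeff (coeff P i) j) j) i)"
  proof (intro sum.cong refl)
    fix i
    have "coeff P i = (\<Sum>j\<le>n. monom (coeff (coeff P i) j) j)"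
      using assms by (intro poly_as_sum_of_monoms'[symmetric]) (simp add: bidegree_le_def)
    then have "monom (coeff P i) i = monom (\<Sum>j\<le>n. monom (coeff (coeff P i) j) j) i" by simp
    then show "monom (coeff P i) i = (\<Sum>j\<le>n. monom (monom (coeff (coeff P i) j) j) i)"
      by (simp add: monom_sum_left)
  qed
  finally show ?thesis .
qed

text \<open>Reduces identities that are linear in a form, such as the multiplicativity of \<open>hom_eval\<close>, to
  monomials.\<close>

lemma bidegree_le_induct [consumes 1, case_names zero monom add]:
  assumes "bidegree_le m n P"
    and "\<Phi> 0"
    and "\<And>c i j. i \<le> m \<Longrightarrow> j \<le> n \<Longrightarrow> \<Phi> (monom (monom c j) i)"
    and "\<And>P Q. \<Phi> P \<Longrightarrow> \<Phi> Q \<Longrightarrow> \<Phi> (P + Q)"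
  shows "\<Phi> P"
proof -
  have sum: "(\<And>i. i \<in> I \<Longrightarrow> \<Phi> (f i)) \<Longrightarrow> \<Phi> (sum f I)" for I :: "nat set" and f
    using assms(2,4) by (induction I rule: infinite_finite_induct) auto
  show ?thesis
    by (subst bidegree_le_expansion[OF assms(1)]) (intro sum assms(3), auto)
qed

lemma hom_eval_mult:
  assumes "bidegree_le m n P" "bidegree_le m' n' Q"
  shows "hom_eval (m + m') (n + n') (P * Q) s t u v = hom_eval m n P s t u v * hom_eval m' n' Q s t u v"
  using assms(1)
proof (induction rule: bidegree_le_induct)
  case (monom c i j)
  note ij = this
  show ?case using assms(2)
  proof (induction rule: bidegree_le_induct)
    case (monom d k l)
    have "t ^ (m + m' - (i + k)) = t ^ (m - i) * t ^ (m' - k)"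
      "v ^ (n + n' - (j + l)) = v ^ (n - j) * v ^ (n' - l)"
      using ij monom by (simp_all flip: power_add)
    then show ?case using ij monom
      by (simp add: mult_monom hom_eval_monom power_add ac_simps)
  qed (simp_all add: distrib_left hom_eval_add)
qed (simp_all add: distrib_right hom_eval_add)

lemma hom_eval_const [simp]: "hom_eval 0 0 [:[:c:]:] s t u v = c"
  by (simp add: hom_eval_def)

lemma hom_eval_smult: 
  "bidegree_le m n P \<Longrightarrow> hom_eval m n ([:[:c:]:] * P) s t u v = c * hom_eval m n P s t u v"
  using hom_eval_mult[of 0 0 "[:[:c:]:]" m n P] by simp

lemma hom_eval_minus: "hom_eval m n (- P) s t u v = - hom_eval m n P s t u v"
  by (simp add: hom_eval_def sum_negf)

lemma hom_eval_diff: "hom_eval m n (P - Q) s t u v = hom_eval m n P s t u v - hom_eval m n Q s t u v"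
  using hom_eval_add[of m n P "- Q"] by (simp add: hom_eval_minus)

lemma hom_eval_sum: "hom_eval m n (\<Sum>i\<in>I. P i) s t u v = (\<Sum>i\<in>I. hom_eval m n (P i) s t u v)"
  by (induction I rule: infinite_finite_induct) (simp_all add: hom_eval_add)

lemma hom_eval_power:
  assumes "bidegree_le m n P"
  shows "hom_eval (k * m) (k * n) (P ^ k) s t u v = hom_eval m n P s t u v ^ k"
proof (induction k)
  case 0
  then show ?case using hom_eval_const[of 1] by (simp add: one_pCons)
next
  case (Suc k)
  then show ?case
    using hom_eval_mult[OF assms bidegree_le_power[OF assms, of k]] by simp
qed

lemma hom_eval_affine:
  assumes "bidegree_le m n P"
  shows "hom_eval m n P X 1 Y 1 = eval2 P X Y"
  using assms by (induction rule: bidegree_le_induct) (simp_all add: hom_eval_add hom_eval_monom)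

lemma hom_eval_scale:
  "hom_eval m n P (c * s) (c * t) (d * u) (d * v) = c ^ m * d ^ n * hom_eval m n P s t u v"
  unfolding hom_eval_def sum_distrib_left
proof (intro sum.cong refl)
  fix i j assume "i \<in> {..m}" "j \<in> {..n}"
  then have "c ^ m = c ^ i * c ^ (m - i)" "d ^ n = d ^ j * d ^ (n - j)" by (simp_all flip: power_add)
  then show "coeff (coeff P i) j * ((c * s) ^ i * (c * t) ^ (m - i)) * ((d * u) ^ j * (d * v) ^ (n - j)) =
        c ^ m * d ^ n * (coeff (coeff P i) j * (s ^ i * t ^ (m - i)) * (u ^ j * v ^ (n - j)))"
    by (simp add: power_mult_distrib ac_simps)
qed

text \<open>The functions given by forms of bidegree \<open>(m, n)\<close>. Over an infinite field they determine the form,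
  and at this level the symmetries \<open>s \<leftrightarrow> t\<close> and \<open>(s, t) \<leftrightarrow> (u, v)\<close> are just permutations of arguments.\<close>

definition biform :: "nat \<Rightarrow> nat \<Rightarrow> ('a::comm_ring_1 \<Rightarrow> 'a \<Rightarrow> 'a \<Rightarrow> 'a \<Rightarrow> 'a) \<Rightarrow> bool" where
  "biform m n f \<longleftrightarrow> (\<exists>P. bidegree_le m n P \<and> f = hom_eval m n P)"

lemma biform_hom_eval: "bidegree_le m n P \<Longrightarrow> biform m n (hom_eval m n P)"
  by (auto simp: biform_def)

lemma biform_zero: "biform m n (\<lambda>s t u v. 0)"
  unfolding biform_def by (rule exI[of _ 0]) (auto simp: fun_eq_iff)

lemma biform_const: "biform 0 0 (\<lambda>s t u v. c)"
  unfolding biform_def by (rule exI[of _ "[:[:c:]:]"]) (auto simp: fun_eq_iff)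

lemma biform_monom: "i \<le> m \<Longrightarrow> j \<le> n \<Longrightarrow>
    biform m n (\<lambda>s t u v. c * (s ^ i * t ^ (m - i)) * (u ^ j * v ^ (n - j)))"
  unfolding biform_def 
  by (rule exI[of _ "monom (monom c j) i"]) (auto simp: fun_eq_iff hom_eval_monom bidegree_le_monom)

lemma biform_add:
  assumes "biform m n f" "biform m n g"
  shows "biform m n (\<lambda>s t u v. f s t u v + g s t u v)"
proof -
  obtain P Q where "bidegree_le m n P" "f = hom_eval m n P" "bidegree_le m n Q" "g = hom_eval m n Q"
    using assms by (auto simp: biform_def)
  then show ?thesis unfolding biform_def
    by (intro exI[of _ "P + Q"]) (auto simp: fun_eq_iff hom_eval_add bidegree_le_add)
qed

lemma biform_mult:
  assumes "biform m n f" "biform m' n' g"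
  shows "biform (m + m') (n + n') (\<lambda>s t u v. f s t u v * g s t u v)"
proof -
  obtain P Q where "bidegree_le m n P" "f = hom_eval m n P" "bidegree_le m' n' Q" "g = hom_eval m' n' Q"
    using assms by (auto simp: biform_def)
  then show ?thesis unfolding biform_def
    by (intro exI[of _ "P * Q"]) (auto simp: fun_eq_iff hom_eval_mult bidegree_le_mult)
qed

lemma biform_cmult: "biform m n f \<Longrightarrow> biform m n (\<lambda>s t u v. c * f s t u v)"
  using biform_mult[OF biform_const] by fastforce

lemma biform_sum:
  "(\<And>i. i \<in> I \<Longrightarrow> biform m n (f i)) \<Longrightarrow> biform m n (\<lambda>s t u v. \<Sum>i\<in>I. f i s t u v)"
  by (induction I rule: infinite_finite_induct) (auto intro: biform_zero biform_add)

lemma biform_power: "biform m n f \<Longrightarrow> biform (k * m) (k * n) (\<lambda>s t u v. f s t u v ^ k)"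
proof (induction k)
  case 0
  then show ?case using biform_const[of 1] by simp
next
  case (Suc k)
  then show ?case using biform_mult[of m n f "k * m" "k * n"] by simp
qed

lemma biform_prod:
  assumes "finite I" "\<And>i. i \<in> I \<Longrightarrow> biform (e i * m) (e i * n) (f i)"
  shows "biform (sum e I * m) (sum e I * n) (\<lambda>s t u v. \<Prod>i\<in>I. f i s t u v)"
  using assms
proof (induction rule: finite_induct)
  case empty
  then show ?case using biform_const[of 1] by simp
next
  case (insert x F)
  then show ?case
    using biform_mult[of "e x * m" "e x * n" "f x" "sum e F * m" "sum e F * n"
        "\<lambda>s t u v. \<Prod>i\<in>F. f i s t u v"]
    by (simp add: algebra_simps)
qed

lemma biform_eqI:
  fixes f g :: "'a::alg_closed_field \<Rightarrow> 'a \<Rightarrow> 'a \<Rightarrow> 'a \<Rightarrow> 'a"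
  assumes "biform m n f" "biform m n g" and "\<And>X Y. f X 1 Y 1 = g X 1 Y 1"
  shows "f = g"
proof -
  obtain P Q where PQ: "bidegree_le m n P" "f = hom_eval m n P" "bidegree_le m n Q" "g = hom_eval m n Q"
    using assms by (auto simp: biform_def)
  have "P = Q"
    using assms(3) PQ by (intro poly_poly_eqI) (simp add: hom_eval_affine)
  then show ?thesis using PQ by simp
qed

lemma biform_swap_first:
  assumes "biform m n f"
  shows "biform m n (\<lambda>s t u v. f t s u v)"
proof -
  obtain P where P: "bidegree_le m n P" "f = hom_eval m n P" using assms by (auto simp: biform_def)
  have "biform m n (\<lambda>s t u v. coeff (coeff P i) j * (t ^ i * s ^ (m - i)) * (u ^ j * v ^ (n - j)))"
    if "i \<le> m" "j \<le> n" for i j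
    using biform_monom[of "m - i" m j n "coeff (coeff P i) j"] that by (simp add: ac_simps)
  then show ?thesis unfolding P(2) hom_eval_def by (intro biform_sum) auto
qed

lemma biform_swap_factors:
  assumes "biform m n f"
  shows "biform n m (\<lambda>s t u v. f u v s t)"
proof -
  obtain P where P: "bidegree_le m n P" "f = hom_eval m n P" using assms by (auto simp: biform_def)
  have "biform n m (\<lambda>s t u v. coeff (coeff P i) j * (u ^ i * v ^ (m - i)) * (s ^ j * t ^ (n - j)))"
    if "i \<le> m" "j \<le> n" for i j
    using biform_monom[of j n i m "coeff (coeff P i) j"] that by (simp add: ac_simps)
  then show ?thesis unfolding P(2) hom_eval_def by (intro biform_sum) auto
qed

section \<open>Common zeros of two forms\<close>

text \<open>The binary form of degree \<open>n\<close> whose dehomogenisation at \<open>y = 1\<close> is \<open>p\<close>.\<close>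

definition hform :: "nat \<Rightarrow> 'a::comm_ring_1 poly \<Rightarrow> 'a \<Rightarrow> 'a \<Rightarrow> 'a" where
  "hform n p x y = (\<Sum>i\<le>n. coeff p i * x ^ i * y ^ (n - i))"

lemma hform_0 [simp]: "hform n 0 x y = 0"
  by (simp add: hform_def)

lemma hform_affine: "degree p \<le> n \<Longrightarrow> hform n p x 1 = poly p x"
  unfolding hform_def poly_altdef
  by (rule sum.mono_neutral_cong_right) (auto simp: coeff_eq_0)

lemma hform_infinity: "hform n p 1 0 = coeff p n"
proof -
  have "hform n p 1 0 = (\<Sum>i\<le>n. if i = n then coeff p n else 0)"
    unfolding hform_def by (intro sum.cong refl) (auto simp: power_0_left)
  then show ?thesis by simp
qed

lemma hform_scale: "hform n p (c * x) (c * y) = c ^ n * hform n p x y"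
  unfolding hform_def sum_distrib_left
proof (intro sum.cong refl)
  fix i assume "i \<in> {..n}"
  then have "c ^ n = c ^ i * c ^ (n - i)" by (simp flip: power_add)
  then show "coeff p i * (c * x) ^ i * (c * y) ^ (n - i) = c ^ n * (coeff p i * x ^ i * y ^ (n - i))"
    by (simp add: power_mult_distrib ac_simps)
qed

lemma hform_has_zero:
  fixes p :: "'a::alg_closed_field poly"
  assumes "n > 0" "degree p \<le> n"
  shows "\<exists>x y. (x, y) \<noteq> (0, 0) \<and> hform n p x y = 0"
proof (cases "coeff p n = 0")
  case True
  then have "hform n p 1 0 = 0 \<and> (1, 0) \<noteq> (0::'a, 0::'a)" by (simp add: hform_infinity)
  then show ?thesis by blast
next
  case False
  then have "degree p > 0" using assms le_degree by fastforce
  then obtain x where "poly p x = 0" using alg_closed_imp_poly_has_root by blast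
  then have "hform n p x 1 = 0 \<and> (x, 1) \<noteq> (0::'a, 0::'a)" using assms by (simp add: hform_affine)
  then show ?thesis by blast
qed

lemma hom_eval_eq_hform:
  "hom_eval m n P s t u v = hform m (map_poly (\<lambda>c. hform n c u v) P) s t"
  unfolding hom_eval_def hform_def[of m]
  by (simp add: coeff_map_poly hform_def sum_distrib_left sum_distrib_right ac_simps)

text \<open>The projective substitute for a determinant that vanishes somewhere. If row \<open>r\<close> of a square matrix
  consists of forms of degree \<open>d r\<close> in \<open>u, v\<close>, then its determinant is a form of positive degree. In
  terms of the two charts: its dehomogenisations \<open>d1\<close> at \<open>v = 1\<close> and \<open>d2\<close> at \<open>u = 1\<close> satisfy
  \<open>d1(Y) = Y ^ D * d2(1 / Y)\<close>, and without roots both would be nonzero constants, which is impossible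
  for \<open>D > 0\<close>. A vanishing determinant yields a linear dependence of the rows.\<close>

lemma homogeneous_pencil_singular:
  fixes E :: "nat \<Rightarrow> nat \<Rightarrow> 'a::alg_closed_field poly"
  assumes deg: "\<And>r c. r < K \<Longrightarrow> c < K \<Longrightarrow> degree (E r c) \<le> d r"
    and pos: "(\<Sum>r<K. d r) > 0"
  shows "\<exists>u v w. (u, v) \<noteq> (0, 0) \<and> (\<exists>r<K. w r \<noteq> 0) \<and>
           (\<forall>c<K. (\<Sum>r<K. w r * hform (d r) (E r c) u v) = 0)"
proof -
  define D where "D = (\<Sum>r<K. d r)"
  define F where "F r c = (\<Sum>j\<le>d r. monom (coeff (E r c) j) (d r - j))" for r c
  have polyE: "poly (E r c) Y = hform (d r) (E r c) Y 1" if "r < K" "c < K" for r c Y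
    using deg[OF that] by (simp add: hform_affine)
  have polyF: "poly (F r c) Z = hform (d r) (E r c) 1 Z" for r c Z
    by (simp add: F_def hform_def poly_sum poly_monom)
  have kernel: "\<exists>w. (\<exists>r<K. w r \<noteq> 0) \<and> (\<forall>c<K. (\<Sum>r<K. w r * a r c) = 0)"
    if "det (mat K K (\<lambda>(c, r). a r c)) = 0" for a :: "nat \<Rightarrow> nat \<Rightarrow> 'a"
  proof -
    let ?A = "mat K K (\<lambda>(c, r). a r c)"
    have "?A \<in> carrier_mat K K" by simp
    from det_0_iff_vec_prod_zero_field[OF this] that obtain x
      where x: "x \<in> carrier_vec K" "x \<noteq> 0\<^sub>v K" "?A *\<^sub>v x = 0\<^sub>v K" by auto
    have "\<exists>r<K. vec_index x r \<noteq> 0"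
    proof (rule ccontr)
      assume "\<not> ?thesis"
      then have "x = 0\<^sub>v K" using x(1) by (intro eq_vecI) auto
      then show False using x(2) by simp
    qed
    moreover have "(\<Sum>r<K. vec_index x r * a r c) = 0" if "c < K" for c
    proof -
      have "vec_index (?A *\<^sub>v x) c = 0" using x(3) that by simp
      then show ?thesis using that x(1)
        by (simp add: scalar_prod_def atLeast0LessThan mult.commute)
    qed
    ultimately show ?thesis by (intro exI[of _ "vec_index x"]) auto
  qed
  define d1 where "d1 = det (mat K K (\<lambda>(c, r). E r c))"
  define d2 where "d2 = det (mat K K (\<lambda>(c, r). F r c))"
  have ev: "poly (det (mat K K (\<lambda>(c, r). G r c))) Y = det (mat K K (\<lambda>(c, r). poly (G r c) Y))"
    for G :: "nat \<Rightarrow> nat \<Rightarrow> 'a poly" and Y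
  proof -
    interpret comm_ring_hom "\<lambda>p::'a poly. poly p Y" by unfold_locales auto
    have "map_mat (\<lambda>p. poly p Y) (mat K K (\<lambda>(c, r). G r c)) = mat K K (\<lambda>(c, r). poly (G r c) Y)"
      by (intro eq_matI) auto
    then show ?thesis using hom_det[of "mat K K (\<lambda>(c, r). G r c)"] by simp
  qed
  show ?thesis
  proof (cases "(\<exists>Y. poly d1 Y = 0) \<or> (\<exists>Z. poly d2 Z = 0)")
    case True
    then show ?thesis
    proof
      assume "\<exists>Y. poly d1 Y = 0"
      then obtain Y where "poly d1 Y = 0" by blast
      then obtain w where "\<exists>r<K. w r \<noteq> 0" "\<forall>c<K. (\<Sum>r<K. w r * poly (E r c) Y) = 0"
        using kernel[of "\<lambda>r c. poly (E r c) Y"] unfolding d1_def ev by blast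
      moreover from this(2) have "\<forall>c<K. (\<Sum>r<K. w r * hform (d r) (E r c) Y 1) = 0"
        by (simp add: polyE)
      moreover have "(Y, 1) \<noteq> (0::'a, 0::'a)" by simp
      ultimately show ?thesis by blast
    next
      assume "\<exists>Z. poly d2 Z = 0"
      then obtain Z where "poly d2 Z = 0" by blast
      then obtain w where "\<exists>r<K. w r \<noteq> 0" "\<forall>c<K. (\<Sum>r<K. w r * poly (F r c) Z) = 0"
        using kernel[of "\<lambda>r c. poly (F r c) Z"] unfolding d2_def ev by blast
      moreover from this(2) have "\<forall>c<K. (\<Sum>r<K. w r * hform (d r) (E r c) 1 Z) = 0"
        by (simp add: polyF)
      moreover have "(1, Z) \<noteq> (0::'a, 0::'a)" by simp
      ultimately show ?thesis by blast
    qed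
  next
    case False
    then have "degree d1 = 0" "degree d2 = 0" using alg_closed_imp_poly_has_root by blast+
    then obtain c1 c2 where c12: "d1 = [:c1:]" "d2 = [:c2:]" using degree_eq_zeroE by metis
    have eq: "c1 = Y ^ D * c2" if "Y \<noteq> 0" for Y
    proof -
      have "c1 = det (mat K K (\<lambda>(c, r). poly (E r c) Y))"
        using ev[of E Y] c12 by (simp add: d1_def)
      also have "mat K K (\<lambda>(c, r). poly (E r c) Y) =
                 mat K K (\<lambda>(c, r). Y ^ d r * poly (F r c) (1 / Y))"
      proof (intro eq_matI; clarsimp)
        fix r c assume "r < K" "c < K"
        then have "poly (E r c) Y = hform (d r) (E r c) (Y * 1) (Y * (1 / Y))"
          using that by (simp add: polyE)
        then show "poly (E r c) Y = Y ^ d r * poly (F r c) (1 / Y)"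
          unfolding hform_scale polyF .
      qed
      also have "det \<dots> = det (transpose_mat \<dots>)" by (subst det_transpose) auto
      also have "transpose_mat (mat K K (\<lambda>(c, r). Y ^ d r * poly (F r c) (1 / Y))) =
                 mat K K (\<lambda>(r, c). Y ^ d r * poly (F r c) (1 / Y))"
        by (intro eq_matI) auto
      also have "det \<dots> = Y ^ D * det (mat K K (\<lambda>(r, c). poly (F r c) (1 / Y)))"
      proof -
        have *: "(\<Prod>i<K. Y ^ d i) = Y ^ D" by (simp add: D_def power_sum)
        have "det (mat K K (\<lambda>(r, c). Y ^ d r * poly (F r c) (1 / Y))) =
              (\<Sum>p\<in>{p. p permutes {0..<K}}. signof p * (\<Prod>i<K. Y ^ d i * poly (F i (p i)) (1 / Y)))"
          unfolding atLeast0LessThan[symmetric]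
          by (subst det_def'[of _ K]) (auto intro!: sum.cong prod.cong)
        also have "\<dots> = Y ^ D * (\<Sum>p\<in>{p. p permutes {0..<K}}. signof p * (\<Prod>i<K. poly (F i (p i)) (1 / Y)))"
          unfolding prod.distrib * sum_distrib_left by (intro sum.cong refl) (simp add: ac_simps)
        also have "(\<Sum>p\<in>{p. p permutes {0..<K}}. signof p * (\<Prod>i<K. poly (F i (p i)) (1 / Y))) =
            det (mat K K (\<lambda>(r, c). poly (F r c) (1 / Y)))"
          unfolding atLeast0LessThan[symmetric]
          by (subst det_def'[of _ K]) (auto intro!: sum.cong prod.cong)
        finally show ?thesis .
      qed
      also have "det (mat K K (\<lambda>(r, c). poly (F r c) (1 / Y))) = 
                 det (transpose_mat (mat K K (\<lambda>(r, c). poly (F r c) (1 / Y))))"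
        by (subst det_transpose) auto
      also have "transpose_mat (mat K K (\<lambda>(r, c). poly (F r c) (1 / Y))) =
                 mat K K (\<lambda>(c, r). poly (F r c) (1 / Y))"
        by (intro eq_matI) auto
      also have "det \<dots> = c2" using ev[of F "1 / Y"] c12 by (simp add: d2_def)
      finally show ?thesis .
    qed
    have "[:c1:] - monom c2 D = 0"
      by (rule poly_eq_zero_if_cofinite_roots[of "{0}"]) (use eq in \<open>auto simp: poly_monom mult.commute\<close>)
    then have "coeff ([:c1:] - monom c2 D) 0 = 0" by simp
    then have "c1 = 0" using pos by (simp add: coeff_monom flip: D_def)
    then show ?thesis using False c12 by simp
  qed
qed

lemma dvd_of_dvd_mult_no_common_root:
  fixes P :: "'a::alg_closed_field poly"
  assumes "P dvd g * Q" "P \<noteq> 0" "\<And>x. poly P x = 0 \<Longrightarrow> poly Q x \<noteq> 0"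
  shows "P dvd g"
  using assms
proof (induction "degree P" arbitrary: P g)
  case 0
  then have "P dvd 1" using is_unit_iff_degree[of P] by metis
  then show ?case using dvd_trans one_dvd by blast
next
  case (Suc k)
  then obtain x where x: "poly P x = 0"
    using alg_closed_imp_poly_has_root[of P] by (metis zero_less_Suc)
  then obtain P' where P': "P = [:-x, 1:] * P'" unfolding poly_eq_0_iff_dvd by (rule dvdE)
  obtain k' where "g * Q = P * k'" using Suc.prems(1) by (rule dvdE)
  then have "poly (g * Q) x = 0" using x by simp
  then have "poly g x = 0" using Suc.prems(3)[OF x] by simp
  then obtain g' where g': "g = [:-x, 1:] * g'" unfolding poly_eq_0_iff_dvd by (rule dvdE)
  have "P' \<noteq> 0" using Suc.prems(2) P' by auto
  then have "degree P = Suc (degree P')" unfolding P' by (subst degree_mult_eq) auto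
  moreover have "P' dvd g' * Q"
    using Suc.prems(1) unfolding P' g' mult.assoc by (subst (asm) dvd_mult_cancel_left) auto
  ultimately have prems: "k = degree P'" "P' dvd g' * Q" using Suc.hyps(2) by simp_all
  have "poly Q z \<noteq> 0" if "poly P' z = 0" for z
    using Suc.prems(3)[of z] that unfolding P' by simp
  from Suc.hyps(1)[OF prems \<open>P' \<noteq> 0\<close> this] have "P' dvd g'" .
  then show ?case unfolding P' g' by (rule mult_dvd_mono[OF dvd_refl])
qed

text \<open>The Sylvester criterion, homogeneously: the case that both leading coefficients vanish is the common
  zero at infinity. Otherwise, if \<open>P\<close> and \<open>Q\<close> had no common root, \<open>P\<close> would divide \<open>g\<close> and \<open>Q\<close>
  would divide \<open>f\<close>, against the bounds on the degrees.\<close>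

lemma binary_forms_common_zero:
  fixes P Q f g :: "'a::alg_closed_field poly"
  assumes deg: "degree P \<le> m" "degree Q \<le> M"
    and rel: "f * P + g * Q = 0" and nz: "f \<noteq> 0 \<or> g \<noteq> 0"
    and df: "f = 0 \<or> degree f < M" and dg: "g = 0 \<or> degree g < m" and pos: "m > 0" "M > 0"
  shows "\<exists>s t. (s, t) \<noteq> (0, 0) \<and> hform m P s t = 0 \<and> hform M Q s t = 0"
proof (cases "P = 0 \<or> Q = 0")
  case True
  obtain x y x' y' where "(x, y) \<noteq> (0, 0)" "hform m P x y = 0" "(x', y') \<noteq> (0, 0)" "hform M Q x' y' = 0"
    using hform_has_zero[OF pos(1) deg(1)] hform_has_zero[OF pos(2) deg(2)] by blast
  then show ?thesis using True hform_0 by fast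
next
  case False
  show ?thesis
  proof (rule ccontr)
    assume no: "\<not> ?thesis"
    have aff: "poly Q x \<noteq> 0" if "poly P x = 0" for x
      using no that deg hform_affine[of P m x] hform_affine[of Q M x] by (metis prod.inject zero_neq_one)
    have inf: "coeff P m \<noteq> 0 \<or> coeff Q M \<noteq> 0"
      using no hform_infinity[of m P] hform_infinity[of M Q] by (metis prod.inject zero_neq_one)
    have eq: "f * P = (- g) * Q" "g * Q = (- f) * P" using rel by (simp_all add: eq_neg_iff_add_eq_0 add.commute)
    have fg: "f \<noteq> 0" "g \<noteq> 0" using rel nz False by auto
    have "P dvd - g * Q" unfolding eq(1)[symmetric] by simp
    from dvd_of_dvd_mult_no_common_root[OF this] have "P dvd - g" using aff False by blast
    moreover have "Q dvd - f * P" unfolding eq(2)[symmetric] by simp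
    from dvd_of_dvd_mult_no_common_root[OF this] have "Q dvd - f" using aff False by blast
    ultimately have "degree P \<le> degree g" "degree Q \<le> degree f"
      using fg dvd_imp_degree_le[of P "- g"] dvd_imp_degree_le[of Q "- f"] by auto
    then have "degree P < m" "degree Q < M" using df dg fg by auto
    then show False using inf by (simp add: coeff_eq_0)
  qed
qed

lemma sum_lessThan_add:
  "(\<Sum>r<M + m. f r) = (\<Sum>r<M. f r) + (\<Sum>r<m. f (M + r))" for f :: "nat \<Rightarrow> 'a::comm_monoid_add"
  by (induction m) (simp_all add: add.assoc)

text \<open>Elimination of \<open>s, t\<close>: the rows of the Sylvester matrix are forms in \<open>u, v\<close>, \<open>M\<close> of them of
  degree \<open>n\<close> and \<open>m\<close> of them of degree \<open>N\<close>. So the resultant has degree \<open>M n + m N > 0\<close> and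
  vanishes at some point \<open>(u : v)\<close>.\<close>

theorem biforms_common_zero:
  fixes P Q :: "'a::alg_closed_field poly poly"
  assumes P: "bidegree_le m n P" and Q: "bidegree_le M N Q" and pos: "m > 0" "M > 0" "N > 0"
  shows "\<exists>s t u v. (s, t) \<noteq> (0, 0) \<and> (u, v) \<noteq> (0, 0) \<and>
           hom_eval m n P s t u v = 0 \<and> hom_eval M N Q s t u v = 0"
proof -
  define K where "K = m + M"
  define E where "E r c = (if r < M then (if r \<le> c then coeff P (c - r) else 0)
      else (if r - M \<le> c then coeff Q (c - (r - M)) else 0))" for r c
  define d where "d r = (if r < M then n else N)" for r
  have "(\<Sum>r<K. d r) > 0"
  proof -
    have "d M \<le> (\<Sum>r<K. d r)" using pos by (intro member_le_sum) (auto simp: K_def)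
    then show ?thesis using pos by (simp add: d_def)
  qed
  moreover have "degree (E r c) \<le> d r" for r c
    using P Q by (auto simp: E_def d_def bidegree_le_def)
  ultimately obtain u v w where uv: "(u, v) \<noteq> (0, 0)" and w: "\<exists>r<K. w r \<noteq> 0"
    and ker: "\<And>c. c < K \<Longrightarrow> (\<Sum>r<K. w r * hform (d r) (E r c) u v) = 0"
    using homogeneous_pencil_singular[of K E d] by blast
  define P' where "P' = map_poly (\<lambda>c. hform n c u v) P"
  define Q' where "Q' = map_poly (\<lambda>c. hform N c u v) Q"
  define f where "f = (\<Sum>r<M. monom (w r) r)"
  define g where "g = (\<Sum>r<m. monom (w (M + r)) r)"
  have cf: "coeff f k = (if k < M then w k else 0)" for k by (simp add: f_def coeff_sum coeff_monom)
  have cg: "coeff g k = (if k < m then w (M + k) else 0)" for k by (simp add: g_def coeff_sum coeff_monom)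
  have cP: "coeff P' k = hform n (coeff P k) u v" for k by (simp add: P'_def coeff_map_poly)
  have cQ: "coeff Q' k = hform N (coeff Q k) u v" for k by (simp add: Q'_def coeff_map_poly)
  have dP: "degree P' \<le> m" using P by (intro degree_le) (auto simp: cP bidegree_le_def coeff_eq_0)
  have dQ: "degree Q' \<le> M" using Q by (intro degree_le) (auto simp: cQ bidegree_le_def coeff_eq_0)
  have "degree f \<le> M - 1" by (rule degree_le) (auto simp: cf)
  then have df: "f = 0 \<or> degree f < M" using pos by linarith
  have "degree g \<le> m - 1" by (rule degree_le) (auto simp: cg)
  then have dg: "g = 0 \<or> degree g < m" using pos by linarith
  have "coeff (f * P' + g * Q') c = 0" for c
  proof (cases "c < K")
    case True
    have 1: "(\<Sum>r<M. w r * hform (d r) (E r c) u v) = coeff (f * P') c"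
    proof -
      have "coeff (f * P') c = (\<Sum>k\<in>{..c} \<inter> {..<M}. w k * hform n (coeff P (c - k)) u v)"
        unfolding coeff_mult cf cP by (auto intro!: sum.mono_neutral_cong_right split: if_splits)
      also have "\<dots> = (\<Sum>r<M. w r * hform (d r) (E r c) u v)"
        by (rule sum.mono_neutral_cong_left) (auto simp: d_def E_def)
      finally show ?thesis by simp
    qed
    have 2: "(\<Sum>r<m. w (M + r) * hform (d (M + r)) (E (M + r) c) u v) = coeff (g * Q') c"
    proof -
      have "coeff (g * Q') c = (\<Sum>k\<in>{..c} \<inter> {..<m}. w (M + k) * hform N (coeff Q (c - k)) u v)"
        unfolding coeff_mult cg cQ by (auto intro!: sum.mono_neutral_cong_right split: if_splits)
      also have "\<dots> = (\<Sum>r<m. w (M + r) * hform (d (M + r)) (E (M + r) c) u v)"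
        by (rule sum.mono_neutral_cong_left) (auto simp: d_def E_def)
      finally show ?thesis by simp
    qed
    have "(\<Sum>r<K. w r * hform (d r) (E r c) u v) =
       (\<Sum>r<M. w r * hform (d r) (E r c) u v) + (\<Sum>r<m. w (M + r) * hform (d (M + r)) (E (M + r) c) u v)"
      unfolding K_def by (subst add.commute) (rule sum_lessThan_add)
    then show ?thesis using ker[OF True] 1 2 by simp
  next
    case False
    have "degree (f * P') < K \<or> f = 0" using degree_mult_le[of f P'] df dP by (auto simp: K_def)
    moreover have "degree (g * Q') < K \<or> g = 0" using degree_mult_le[of g Q'] dg dQ by (auto simp: K_def)
    ultimately show ?thesis using False by (auto simp: coeff_eq_0)
  qed
  then have rel: "f * P' + g * Q' = 0" by (simp add: poly_eq_iff)
  have "f \<noteq> 0 \<or> g \<noteq> 0"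
  proof -
    obtain r where r: "r < K" "w r \<noteq> 0" using w by blast
    show ?thesis
    proof (cases "r < M")
      case True
      then show ?thesis using cf[of r] r by auto
    next
      case False
      then have "r - M < m" "M + (r - M) = r" using r by (auto simp: K_def)
      then show ?thesis using cg[of "r - M"] r by auto
    qed
  qed
  from binary_forms_common_zero[OF dP dQ rel this df dg pos(1,2)]
  obtain s t where "(s, t) \<noteq> (0, 0)" "hform m P' s t = 0" "hform M Q' s t = 0" by blast
  then have "hom_eval m n P s t u v = 0" "hom_eval M N Q s t u v = 0"
    by (simp_all add: hom_eval_eq_hform P'_def Q'_def)
  then show ?thesis using uv \<open>(s, t) \<noteq> (0, 0)\<close> by blast
qed

section \<open>Prime factors\<close>

lemma prime_elem_linear: "prime_elem [:[:-y, 1:]:]" for y :: "'a::field"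
  by (intro lift_prime_elem_poly prime_elem_linear_field_poly) simp

text \<open>As \<open>k\<close> is algebraically closed, the primes of \<open>k[Y]\<close> are the \<open>Y - y\<close>; so this says that \<open>P\<close> is
  primitive as a polynomial in \<open>X\<close>. The definition avoids gcds in \<open>k[Y]\<close>.\<close>

definition content_free :: "'a::comm_ring_1 poly poly \<Rightarrow> bool" where
  "content_free P \<longleftrightarrow> (\<forall>y. \<not> [:[:-y, 1:]:] dvd P)"

lemma content_free_part:
  fixes P :: "'a::field poly poly"
  assumes "P \<noteq> 0"
  shows "\<exists>d Q. d \<noteq> 0 \<and> P = [:d:] * Q \<and> content_free Q"
  using assms
proof (induction "degree (lead_coeff P)" arbitrary: P rule: less_induct)
  case less
  show ?case
  proof (cases "content_free P")
    case True
    then show ?thesis by (intro exI[of _ 1] exI[of _ P]) (simp add: one_pCons[symmetric])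
  next
    case False
    then obtain y P' where P': "P = [:[:-y, 1:]:] * P'" unfolding content_free_def by (auto elim: dvdE)
    have "P' \<noteq> 0" using P' less.prems by auto
    have "lead_coeff P = [:-y, 1:] * lead_coeff P'" unfolding P' lead_coeff_mult by simp
    then have "degree (lead_coeff P) = Suc (degree (lead_coeff P'))"
      using \<open>P' \<noteq> 0\<close> by (simp only:) (subst degree_mult_eq, auto)
    then obtain d Q where "d \<noteq> 0" "P' = [:d:] * Q" "content_free Q"
      using less.hyps[OF _ \<open>P' \<noteq> 0\<close>] by auto
    moreover from this have "[:-y, 1:] * d \<noteq> 0" by (simp only: mult_eq_0_iff) simp
    moreover have "[:[:-y, 1:]:] * ([:d:] * Q) = [:[:-y, 1:] * d:] * Q"
      by (simp only: mult.assoc[symmetric]) simp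
    ultimately show ?thesis using P' by blast
  qed
qed

text \<open>Gauss's lemma: the linear factors of \<open>c\<close> are prime in \<open>k[Y][X]\<close>, do not divide \<open>P\<close>, and so can be
  removed one at a time.\<close>

lemma content_free_dvd_cancel:
  fixes P f :: "'a::alg_closed_field poly poly"
  assumes "content_free P" "c \<noteq> 0" "P dvd [:c:] * f"
  shows "P dvd f"
  using assms(2,3)
proof (induction "degree c" arbitrary: c)
  case 0
  then obtain k where k: "c = [:k:]" "k \<noteq> 0" by (metis degree_eq_zeroE pCons_0_0)
  then have "f = [:[:1 / k:]:] * ([:c:] * f)" by (simp add: one_pCons[symmetric])
  then show ?case using 0 dvd_mult by metis
next
  case (Suc n)
  obtain y where y: "poly c y = 0"
    using alg_closed_imp_poly_has_root[of c] Suc.hyps(2) by (metis zero_less_Suc)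
  then obtain c' where c': "c = [:-y, 1:] * c'" unfolding poly_eq_0_iff_dvd by (rule dvdE)
  have "c' \<noteq> 0" using c' Suc.prems by auto
  then have deg: "degree c = Suc (degree c')" unfolding c' by (subst degree_mult_eq) auto
  obtain h where h: "[:c:] * f = P * h" using Suc.prems(2) by (rule dvdE)
  let ?L = "[:[:-y, 1:]:]"
  have c: "[:c:] = ?L * [:c':]" by (simp add: c')
  have "P * h = ?L * ([:c':] * f)" unfolding h[symmetric] c by (simp only: mult.assoc)
  then have "?L dvd P * h" by (metis dvd_triv_left)
  then have "?L dvd h"
    using prime_elem_dvd_mult_iff[OF prime_elem_linear[of y]] assms(1) unfolding content_free_def by blast
  then obtain h' where "h = ?L * h'" by (rule dvdE)
  then have "?L * ([:c':] * f) = ?L * (P * h')" using \<open>P * h = ?L * ([:c':] * f)\<close>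
    by (simp only: ac_simps)
  then have "[:c':] * f = P * h'" using mult_left_cancel[of ?L] by (metis pCons_eq_0_iff zero_neq_one)
  then have "P dvd [:c':] * f" by (metis dvd_triv_left)
  then show ?case using Suc.hyps(1)[of c'] deg Suc.hyps(2) \<open>c' \<noteq> 0\<close> by simp
qed

text \<open>The prime factor is a polynomial \<open>P\<close> of least positive degree in \<open>X\<close> among the factors of \<open>Q\<close>
  over \<open>k(Y)\<close>, made primitive. If \<open>P\<close> divides \<open>f g\<close>, consider an element \<open>r\<close> of least degree of the
  ideal \<open>(P, f)\<close>; by pseudo-division it divides \<open>P\<close> and \<open>f\<close> up to factors in \<open>k[Y]\<close>. By minimality
  of \<open>P\<close>, either \<open>r\<close> is in \<open>k[Y]\<close>, and then \<open>P\<close> divides \<open>r g\<close>, or \<open>r\<close> has the same degree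
  as \<open>P\<close>, and then \<open>P\<close> divides a multiple of \<open>f\<close>; Gauss's lemma concludes.\<close>

theorem exists_prime_factor:
  fixes Q :: "'a::alg_closed_field poly poly"
  assumes "degree Q > 0"
  shows "\<exists>P. prime_elem P \<and> P dvd Q \<and> degree P > 0"
proof -
  define S where "S = {P. degree P > 0 \<and> (\<exists>c. c \<noteq> 0 \<and> P dvd [:c:] * Q)}"
  have "Q \<in> S" using assms unfolding S_def by (auto intro!: exI[of _ 1])
  then obtain R where R: "R \<in> S" and R_min: "\<And>P. P \<in> S \<Longrightarrow> degree R \<le> degree P"
    using ex_has_least_nat[of "\<lambda>P. P \<in> S" Q degree] by auto
  have "R \<noteq> 0" using R by (auto simp: S_def)
  then obtain d P where dP: "d \<noteq> 0" "R = [:d:] * P" "content_free P"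
    using content_free_part by blast
  have degP: "degree P = degree R" using dP by simp
  obtain c where c: "c \<noteq> 0" "R dvd [:c:] * Q" using R by (auto simp: S_def)
  have Q: "P dvd [:c:] * Q" using c(2) dP(2) by (metis dvd_mult_right)
  then have PQ: "P dvd Q" using content_free_dvd_cancel dP c by blast
  have posP: "degree P > 0" using R degP by (simp add: S_def)
  have "prime_elem P"
  proof (rule prime_elemI)
    show "P \<noteq> 0" using posP by auto
    show "\<not> P dvd 1"
    proof
      assume "P dvd 1"
      then have "degree P \<le> degree (1 :: 'a poly poly)" by (intro dvd_imp_degree_le) simp_all
      then show False using posP by simp
    qed
    fix f g assume fg: "P dvd f * g"
    show "P dvd f \<or> P dvd g"
    proof (cases "P dvd f")
      case False
      define J where "J = {x. \<exists>\<alpha> \<beta>. x = \<alpha> * P + \<beta> * f}"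
      have "P = 1 * P + 0 * f" "f = 0 * P + 1 * f" by simp_all
      then have PJ: "P \<in> J" and fJ: "f \<in> J" unfolding J_def by blast+
      obtain r where r: "r \<in> J" "r \<noteq> 0" and r_min: "\<And>x. x \<in> J \<Longrightarrow> x \<noteq> 0 \<Longrightarrow> degree r \<le> degree x"
        using ex_has_least_nat[of "\<lambda>x. x \<in> J \<and> x \<noteq> 0" P degree] PJ \<open>P \<noteq> 0\<close> by auto
      have r_dvd: "\<exists>c. c \<noteq> 0 \<and> r dvd [:c:] * x" if x: "x \<in> J" for x
      proof -
        obtain a q where aq: "a \<noteq> 0" "Polynomial.smult a x = r * q + pseudo_mod x r"
          using pseudo_mod(1)[OF r(2), of x] by auto
        obtain \<alpha> \<beta> \<alpha>' \<beta>' where "x = \<alpha> * P + \<beta> * f" "r = \<alpha>' * P + \<beta>' * f"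
          using x r(1) unfolding J_def by blast
        moreover have eq: "pseudo_mod x r = [:a:] * x - r * q" using aq(2) by (simp add: algebra_simps)
        ultimately have "pseudo_mod x r = ([:a:] * \<alpha> - \<alpha>' * q) * P + ([:a:] * \<beta> - \<beta>' * q) * f"
          by (simp add: algebra_simps)
        then have "pseudo_mod x r \<in> J" unfolding J_def by blast
        then have "pseudo_mod x r = 0" using pseudo_mod(2)[OF r(2), of x] r_min by (meson not_less)
        then have "[:a:] * x = r * q" using eq by (simp only: right_minus_eq)
        then have "r dvd [:a:] * x" by (rule dvdI)
        then show ?thesis using aq(1) by blast
      qed
      obtain c1 where c1: "c1 \<noteq> 0" "r dvd [:c1:] * P" using r_dvd PJ by blast
      obtain c2 where c2: "c2 \<noteq> 0" "r dvd [:c2:] * f" using r_dvd fJ by blast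
      show ?thesis
      proof (cases "degree r = 0")
        case True
        then obtain e where e: "r = [:e:]" "e \<noteq> 0" using r(2) by (metis degree_eq_zeroE pCons_0_0)
        obtain \<alpha> \<beta> where "r = \<alpha> * P + \<beta> * f" using r(1) by (auto simp: J_def)
        then have "r * g = P * (\<alpha> * g) + \<beta> * (f * g)" by (simp only: algebra_simps)
        moreover have "P dvd P * (\<alpha> * g) + \<beta> * (f * g)"
          using dvd_add[OF dvd_triv_left dvd_mult[OF fg]] .
        ultimately have "P dvd [:e:] * g" unfolding e(1) by (simp only:)
        then show ?thesis using content_free_dvd_cancel dP e by blast
      next
        case False
        have "r dvd [:c1:] * ([:c:] * Q)" using c1(2) Q by (meson dvd_trans mult_dvd_mono dvd_refl)
        then have "r dvd [:c1 * c:] * Q" by (simp add: mult.commute)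
        then have "r \<in> S" using False c1 c unfolding S_def by (auto intro!: exI[of _ "c1 * c"])
        then have "degree P \<le> degree r" using R_min degP by simp
        moreover have "degree r \<le> degree P" using r_min[OF PJ \<open>P \<noteq> 0\<close>] .
        moreover obtain s where s: "[:c1:] * P = r * s" using c1(2) by (rule dvdE)
        moreover have "s \<noteq> 0" using s c1 \<open>P \<noteq> 0\<close> by auto
        moreover have "degree ([:c1:] * P) = degree P" using c1 by simp
        ultimately have "degree s = 0" using r(2) by (simp add: degree_mult_eq)
        then obtain e where e: "s = [:e:]" "e \<noteq> 0" using \<open>s \<noteq> 0\<close> by (metis degree_eq_zeroE pCons_0_0)
        obtain k where k: "[:c2:] * f = r * k" using c2(2) by (rule dvdE)
        have "[:e * c2:] * f = s * ([:c2:] * f)" by (simp add: e mult.commute)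
        also have "\<dots> = ([:c1:] * P) * k" unfolding k s by (simp only: ac_simps)
        also have "\<dots> = P * ([:c1:] * k)" by (simp only: ac_simps)
        finally have "P dvd [:e * c2:] * f" by (rule dvdI)
        then show ?thesis using content_free_dvd_cancel dP e c2 by (metis mult_eq_0_iff)
      qed
    qed simp
  qed
  then show ?thesis using PQ posP by blast
qed

lemma coeff_mult_top:
  assumes "degree a \<le> n" "degree b \<le> n'"
  shows "coeff (a * b) (n + n') = coeff a n * coeff b n'"
proof -
  have "coeff (a * b) (n + n') = (\<Sum>i\<le>n + n'. if i = n then coeff a n * coeff b n' else 0)"
    unfolding coeff_mult
  proof (intro sum.cong refl)
    fix i assume "i \<in> {..n + n'}"
    then show "coeff a i * coeff b (n + n' - i) = (if i = n then coeff a n * coeff b n' else 0)"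
      using assms by (cases i n rule: linorder_cases) (auto simp: coeff_eq_0)
  qed
  then show ?thesis by simp
qed

lemma bidegree_le_mono: "bidegree_le m n P \<Longrightarrow> m \<le> m' \<Longrightarrow> n \<le> n' \<Longrightarrow> bidegree_le m' n' P"
  unfolding bidegree_le_def by (meson le_trans)

lemma bidegree_exact:
  assumes "P \<noteq> 0"
  shows "\<exists>n i. bidegree_le (degree P) n P \<and> coeff (coeff P i) n \<noteq> 0"
proof -
  define n where "n = Max ((\<lambda>i. degree (coeff P i)) ` {..degree P})"
  have le: "degree (coeff P i) \<le> n" for i
    by (cases "i \<le> degree P") (auto simp: n_def coeff_eq_0)
  have "n \<in> (\<lambda>i. degree (coeff P i)) ` {..degree P}" unfolding n_def by (intro Max_in) auto
  then obtain i where i: "n = degree (coeff P i)" by auto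
  show ?thesis
  proof (cases "coeff P i = 0")
    case False
    then show ?thesis using le i by (intro exI[of _ n] exI[of _ i]) (simp add: bidegree_le_def)
  next
    case True
    then have "n = 0" using i by simp
    moreover have "coeff (lead_coeff P) 0 \<noteq> 0"
      using le[of "degree P"] \<open>n = 0\<close> assms leading_coeff_neq_0[of "lead_coeff P"] by simp
    ultimately show ?thesis using le
      by (intro exI[of _ n] exI[of _ "degree P"]) (auto simp: bidegree_le_def)
  qed
qed

text \<open>Degrees in \<open>X\<close> and in \<open>Y\<close> are additive. For \<open>Y\<close>, the coefficients of the top powers \<open>Y ^ n\<close> and
  \<open>Y ^ n'\<close> are nonzero polynomials in \<open>X\<close>, and their product is the coefficient of \<open>Y ^ (n + n')\<close>.
  The hypotheses on \<open>n\<close> say that it is the exact degree of \<open>P\<close> in \<open>Y\<close>.\<close>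

lemma bidegree_of_cofactor:
  fixes P Q :: "'a::idom poly poly"
  assumes PQ: "bidegree_le M N (P * Q)" and "Q \<noteq> 0"
    and n: "bidegree_le (degree P) n P" "coeff (coeff P i) n \<noteq> 0"
  shows "degree P \<le> M" "n \<le> N" "bidegree_le (M - degree P) (N - n) Q"
proof -
  have nz: "P \<noteq> 0" "Q \<noteq> 0" using assms by auto
  obtain n' i' where n': "bidegree_le (degree Q) n' Q" "coeff (coeff Q i') n' \<noteq> 0"
    using bidegree_exact nz by blast
  define p where "p = map_poly (\<lambda>c. coeff c n) P"
  define q where "q = map_poly (\<lambda>c. coeff c n') Q"
  have "p \<noteq> 0" "q \<noteq> 0" using n(2) n'(2) unfolding p_def q_def
    by (auto simp: poly_eq_iff coeff_map_poly)
  then have "p * q \<noteq> 0" by simp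
  then obtain k where "coeff (p * q) k \<noteq> 0" by (auto simp: poly_eq_iff)
  moreover have "coeff (p * q) k = coeff (coeff (P * Q) k) (n + n')"
    unfolding coeff_mult[of _ _ k] coeff_sum p_def q_def
    by (intro sum.cong refl)
       (use n n' in \<open>simp add: coeff_map_poly coeff_mult_top bidegree_le_def\<close>)
  ultimately have "n + n' \<le> degree (coeff (P * Q) k)" by (intro le_degree) simp
  also have "\<dots> \<le> N" using PQ by (simp add: bidegree_le_def)
  finally have *: "n + n' \<le> N" .
  have "degree P + degree Q \<le> M" using PQ nz by (simp add: bidegree_le_def degree_mult_eq)
  then show "degree P \<le> M" "n \<le> N" "bidegree_le (M - degree P) (N - n) Q"
    using * by (auto intro: bidegree_le_mono[OF n'(1)])
qed

section \<open>Relations along an irreducible curve\<close>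

text \<open>The form \<open>G(P, Q)\<close>, for the binary form \<open>G\<close> of degree \<open>n\<close>.\<close>

definition subst_form ::
    "nat \<Rightarrow> 'a::comm_ring_1 poly \<Rightarrow> 'a poly poly \<Rightarrow> 'a poly poly \<Rightarrow> 'a poly poly" where
  "subst_form n G P Q = (\<Sum>i\<le>n. [:[:coeff G i:]:] * (P ^ i * Q ^ (n - i)))"

lemma eval2_subst_form: "eval2 (subst_form n G P Q) X Y = hform n G (eval2 P X Y) (eval2 Q X Y)"
  unfolding subst_form_def hform_def
  by (simp only: eval2_sum eval2_simps) (simp add: mult.assoc)

lemma
  assumes "bidegree_le a b P" "bidegree_le a b Q"
  shows bidegree_le_subst_form: "bidegree_le (n * a) (n * b) (subst_form n G P Q)"
    and hom_eval_subst_form: "hom_eval (n * a) (n * b) (subst_form n G P Q) s t u v =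
      hform n G (hom_eval a b P s t u v) (hom_eval a b Q s t u v)"
proof -
  have *: "bidegree_le (n * a) (n * b) (P ^ i * Q ^ (n - i)) \<and>
     hom_eval (n * a) (n * b) (P ^ i * Q ^ (n - i)) s t u v =
       hom_eval a b P s t u v ^ i * hom_eval a b Q s t u v ^ (n - i)" if "i \<le> n" for i
  proof -
    have n: "n * a = i * a + (n - i) * a" "n * b = i * b + (n - i) * b"
      using that by (simp_all flip: add_mult_distrib)
    show ?thesis unfolding n
      by (intro conjI bidegree_le_mult bidegree_le_power assms, subst hom_eval_mult)
         (simp_all add: bidegree_le_power hom_eval_power assms)
  qed
  show "bidegree_le (n * a) (n * b) (subst_form n G P Q)"
    unfolding subst_form_def using * by (intro bidegree_le_sum bidegree_le_smult) auto
  show "hom_eval (n * a) (n * b) (subst_form n G P Q) s t u v =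
      hform n G (hom_eval a b P s t u v) (hom_eval a b Q s t u v)"
    unfolding subst_form_def hom_eval_sum hform_def
    by (intro sum.cong refl, subst hom_eval_smult) (use * in \<open>auto simp: mult.assoc\<close>)
qed

lemma hform_pCons_0: "hform (Suc n) (pCons 0 H) x y = x * hform n H x y"
  unfolding hform_def by (subst sum.atMost_Suc_shift) (simp add: sum_distrib_left ac_simps)

lemma hform_Suc: "degree H \<le> n \<Longrightarrow> hform (Suc n) H x y = y * hform n H x y"
  unfolding hform_def by (simp add: coeff_eq_0 sum_distrib_left Suc_diff_le ac_simps)

lemma hform_smult: "hform n (Polynomial.smult c H) x y = c * hform n H x y"
  by (simp add: hform_def sum_distrib_left ac_simps)

lemma hform_diff: "hform n (G - H) x y = hform n G x y - hform n H x y"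
  by (simp add: hform_def sum_subtractf algebra_simps)

lemma hform_linear_factor:
  fixes G :: "'a::field poly"
  assumes deg: "degree G \<le> Suc n" and zero: "hform (Suc n) G c d = 0" and nz: "(c, d) \<noteq> (0, 0)"
  shows "\<exists>G'. degree G' \<le> n \<and> (\<forall>x y. hform (Suc n) G x y = (d * x - c * y) * hform n G' x y)"
proof (cases "d = 0")
  case False
  have "hform (Suc n) G (d * (c / d)) (d * 1) = 0" using zero False by simp
  then have "poly G (c / d) = 0" unfolding hform_scale using False by (simp add: hform_affine[OF deg])
  then obtain H where H: "G = [:- (c / d), 1:] * H" unfolding poly_eq_0_iff_dvd by (rule dvdE)
  have dH: "degree H \<le> n"
  proof (cases "H = 0")
    case False
    then have "degree G = Suc (degree H)" unfolding H by (subst degree_mult_eq) auto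
    then show ?thesis using deg by simp
  qed simp
  have G: "G = pCons 0 H - Polynomial.smult (c / d) H" by (simp add: H algebra_simps)
  have "hform (Suc n) G x y = (d * x - c * y) * hform n (Polynomial.smult (1 / d) H) x y" for x y
    unfolding G hform_diff hform_pCons_0 hform_smult hform_Suc[OF dH] using False
    by (simp add: field_simps)
  then show ?thesis using dH by (intro exI[of _ "Polynomial.smult (1 / d) H"]) simp
next
  case True
  then have "c \<noteq> 0" using nz by simp
  have "hform (Suc n) G (c * 1) (c * 0) = 0" using zero True by simp
  then have "coeff G (Suc n) = 0" unfolding hform_scale using \<open>c \<noteq> 0\<close> by (simp add: hform_infinity)
  then have dG: "degree G \<le> n" using deg
    by (metis degree_0 le_SucE leading_coeff_0_iff zero_le)
  have "hform (Suc n) G x y = (d * x - c * y) * hform n (Polynomial.smult (- 1 / c) G) x y" for x y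
    unfolding hform_smult hform_Suc[OF dG] using True \<open>c \<noteq> 0\<close> by simp
  then show ?thesis using dG by (intro exI[of _ "Polynomial.smult (- 1 / c) G"]) simp
qed

lemma hform_eq_0_imp:
  fixes G :: "'a::alg_closed_field poly"
  assumes "degree G \<le> n" "\<And>x y. hform n G x y = 0"
  shows "G = 0"
  by (rule poly_eq_zero_if_cofinite_roots[of "{}"]) (use assms hform_affine[of G n] in auto)

text \<open>A form that has positive degree in \<open>u, v\<close> lies in the ideal \<open>(u, v)\<close>; recall that \<open>v = 1\<close>.\<close>

lemma split_inner_constant_term:
  fixes h :: "'a::idom poly poly"
  assumes "bidegree_le m (Suc n) h"
  shows "\<exists>h1 h2. h = [:[:0, 1:]:] * h1 + h2 \<and> bidegree_le m n h1 \<and> bidegree_le m n h2"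
proof (intro exI conjI)
  let ?h1 = "map_poly (poly_shift 1) h" and ?h2 = "map_poly (\<lambda>c. [:coeff c 0:]) h"
  have c1: "coeff ?h1 i = poly_shift 1 (coeff h i)" and c2: "coeff ?h2 i = [:coeff (coeff h i) 0:]" for i
    by (simp_all add: coeff_map_poly)
  have sp: "c = [:0, 1:] * poly_shift 1 c + [:coeff c 0:]" for c :: "'a poly"
    by (auto simp: poly_eq_iff coeff_pCons coeff_poly_shift split: nat.split)
  show "h = [:[:0, 1:]:] * ?h1 + ?h2"
  proof (rule poly_eqI)
    fix i
    have "coeff ([:[:0, 1:]:] * ?h1 + ?h2) i = [:0, 1:] * poly_shift 1 (coeff h i) + [:coeff (coeff h i) 0:]"
      by (simp only: coeff_add c1 c2 mult_pCons_left mult_zero_left pCons_0_0 add_0_right coeff_smult)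
    then show "coeff h i = coeff ([:[:0, 1:]:] * ?h1 + ?h2) i" using sp[of "coeff h i"] by (simp only:)
  qed
  have "degree ?h1 \<le> m"
    by (rule degree_le, intro allI impI, subst c1) (use assms in \<open>simp add: bidegree_le_def coeff_eq_0\<close>)
  moreover have "degree ?h2 \<le> m"
    by (rule degree_le, intro allI impI, subst c2) (use assms in \<open>simp add: bidegree_le_def coeff_eq_0\<close>)
  moreover have "degree (poly_shift 1 (coeff h i)) \<le> n" for i
    using assms by (intro degree_le) (auto simp: coeff_poly_shift coeff_eq_0 bidegree_le_def le_less_trans[of _ "Suc n"])
  ultimately show "bidegree_le m n ?h1" "bidegree_le m n ?h2"
    unfolding bidegree_le_def c1 c2 by simp_all
qed

lemma bidegree_le_of_inner_var_mult:
  fixes P :: "'a::idom poly poly"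
  assumes "bidegree_le m (Suc n) ([:[:0, 1:]:] * P)"
  shows "bidegree_le m n P"
proof -
  have c: "coeff ([:[:0, 1:]:] * P) i = [:0, 1:] * coeff P i" for i
    by (simp only: mult_pCons_left mult_zero_left pCons_0_0 add_0_right coeff_smult)
  have "degree P \<le> m" using assms unfolding bidegree_le_def by (simp add: degree_mult_eq)
  moreover have "degree (coeff P i) \<le> n" for i
  proof (cases "coeff P i = 0")
    case False
    then have "degree ([:0, 1:] * coeff P i) = Suc (degree (coeff P i))" by (subst degree_mult_eq) auto
    then show ?thesis using assms c[of i] unfolding bidegree_le_def by (metis Suc_le_mono)
  qed simp
  ultimately show ?thesis by (simp add: bidegree_le_def)
qed

lemma bidegree_le_0_1: "bidegree_le 0 1 1" "bidegree_le 0 1 [:[:0, 1:]:]"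
  by (auto simp: bidegree_le_def coeff_pCons split: nat.split)

text \<open>The heart of the proof. \<open>R\<close> is an irreducible curve of bidegree \<open>(degree R, n')\<close>. Common factors of
  \<open>G0\<close> and \<open>G1\<close> are removed by induction on \<open>n\<close>; this is possible because \<open>R\<close> divides no form
  \<open>d P - c Q\<close>: otherwise a zero of \<open>R\<close> and \<open>P\<close>, or of \<open>R\<close> and \<open>Q\<close>, would be a zero of all three.
  If \<open>G0\<close> and \<open>G1\<close> are coprime, the relation \<open>u G0(P, Q) + v G1(P, Q) = R h\<close> is lifted to forms:
  with \<open>h = u h1 + v h2\<close> there is a form \<open>S\<close> such that \<open>G0(P, Q) = v S + R h1\<close> and
  \<open>G1(P, Q) = - u S + R h2\<close>. A common zero of \<open>R\<close> and \<open>S\<close> contradicts coprimality.\<close>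

theorem prime_curve_relation_trivial:
  fixes R P Q :: "'a::alg_closed_field poly poly"
  assumes R: "prime_elem R" "degree R > 0" "bidegree_le (degree R) n' R" "coeff (coeff R i') n' \<noteq> 0" "n' < b"
    and P: "bidegree_le a b P" and Q: "bidegree_le a b Q" and ab: "a > 0" "b > 1"
    and nobase: "\<And>s t u v. (s, t) \<noteq> (0, 0) \<Longrightarrow> (u, v) \<noteq> (0, 0) \<Longrightarrow>
       hom_eval (degree R) n' R s t u v = 0 \<Longrightarrow> hom_eval a b P s t u v = 0 \<Longrightarrow>
       hom_eval a b Q s t u v = 0 \<Longrightarrow> False"
    and G: "degree G0 \<le> n" "degree G1 \<le> n"
    and rel: "R dvd [:[:0, 1:]:] * subst_form n G0 P Q + subst_form n G1 P Q"
  shows "G0 = 0 \<and> G1 = 0"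
proof -
  let ?m = "degree R"
  have vanish: "hom_eval M N (R * h) s t u v = 0"
    if "bidegree_le M N (R * h)" "hom_eval ?m n' R s t u v = 0" for M N h s t u v
  proof (cases "h = 0")
    case False
    note * = bidegree_of_cofactor[OF that(1) this R(3,4)]
    show ?thesis using hom_eval_mult[OF R(3) *(3), of s t u v] *(1,2) that(2) by simp
  qed simp
  have nonzero_divisor: "\<not> R dvd [:[:d:]:] * P - [:[:c:]:] * Q" if cd: "(c, d) \<noteq> (0, 0)" for c d
  proof
    assume "R dvd [:[:d:]:] * P - [:[:c:]:] * Q"
    then obtain h where h: "[:[:d:]:] * P - [:[:c:]:] * Q = R * h" by (rule dvdE)
    \<comment> \<open>One of the two forms, such that \<open>S\<close> and \<open>d P - c Q\<close> have the same span as \<open>P\<close> and \<open>Q\<close>.\<close>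
    define S where "S = (if d = 0 then P else Q)"
    have "bidegree_le a b S" using P Q by (simp add: S_def)
    from biforms_common_zero[OF R(3) this R(2) ab(1)] obtain s t u v
      where st: "(s, t) \<noteq> (0, 0)" and uv: "(u, v) \<noteq> (0, 0)"
      and zero: "hom_eval ?m n' R s t u v = 0" "hom_eval a b S s t u v = 0"
      using ab(2) by auto
    have bd: "bidegree_le a b ([:[:d:]:] * P - [:[:c:]:] * Q)"
      by (intro bidegree_le_diff bidegree_le_smult P Q)
    have "hom_eval a b ([:[:d:]:] * P - [:[:c:]:] * Q) s t u v = 0"
      using vanish[of a b h s t u v] bd zero(1) unfolding h by blast
    then have "d * hom_eval a b P s t u v = c * hom_eval a b Q s t u v"
      unfolding hom_eval_diff hom_eval_smult[OF P] hom_eval_smult[OF Q] by simp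
    then have "hom_eval a b P s t u v = 0" "hom_eval a b Q s t u v = 0"
      using zero(2) cd by (auto simp: S_def split: if_splits)
    then show False using nobase st uv zero(1) by blast
  qed
  show ?thesis using G rel
  proof (induction n arbitrary: G0 G1)
    case 0
    then obtain g0 g1 where g: "G0 = [:g0:]" "G1 = [:g1:]" using degree_eq_zeroE by (metis le_zero_eq)
    have eq: "[:[:0, 1:]:] * subst_form 0 G0 P Q + subst_form 0 G1 P Q = [:[:g1, g0:]:]"
      by (simp add: subst_form_def g)
    have "[:[:g1, g0:]:] = (0 :: 'a poly poly)"
    proof (rule ccontr)
      assume "[:[:g1, g0:]:] \<noteq> (0 :: 'a poly poly)"
      then have "degree R \<le> degree [:[:g1, g0:]:]" using 0(3) unfolding eq by (intro dvd_imp_degree_le)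
      then show False using R(2) by simp
    qed
    then show ?case using g by simp
  next
    case (Suc n)
    show ?case
    proof (cases "\<exists>c d. (c, d) \<noteq> (0, 0) \<and> hform (Suc n) G0 c d = 0 \<and> hform (Suc n) G1 c d = 0")
      case True
      then obtain c d where cd: "(c, d) \<noteq> (0, 0)" "hform (Suc n) G0 c d = 0" "hform (Suc n) G1 c d = 0"
        by blast
      obtain H0 where H0: "degree H0 \<le> n" "\<And>x y. hform (Suc n) G0 x y = (d * x - c * y) * hform n H0 x y"
        using hform_linear_factor[OF Suc.prems(1) cd(2,1)] by blast
      obtain H1 where H1: "degree H1 \<le> n" "\<And>x y. hform (Suc n) G1 x y = (d * x - c * y) * hform n H1 x y"
        using hform_linear_factor[OF Suc.prems(2) cd(3,1)] by blast
      let ?L = "[:[:d:]:] * P - [:[:c:]:] * Q"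
      have "[:[:0, 1:]:] * subst_form (Suc n) G0 P Q + subst_form (Suc n) G1 P Q =
            ?L * ([:[:0, 1:]:] * subst_form n H0 P Q + subst_form n H1 P Q)"
        by (intro poly_poly_eqI)
           (simp only: eval2_simps eval2_subst_form H0(2) H1(2), simp add: algebra_simps)
      then have "R dvd ?L * ([:[:0, 1:]:] * subst_form n H0 P Q + subst_form n H1 P Q)"
        using Suc.prems(3) by simp
      then have "R dvd [:[:0, 1:]:] * subst_form n H0 P Q + subst_form n H1 P Q"
        using nonzero_divisor[OF cd(1)] prime_elem_dvd_mult_iff[OF R(1)] by blast
      from Suc.IH[OF H0(1) H1(1) this] have "H0 = 0" "H1 = 0" by auto
      then show ?thesis using H0(2) H1(2) hform_eq_0_imp[OF Suc.prems(1)] hform_eq_0_imp[OF Suc.prems(2)]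
        by simp
    next
      case False
      define A where "A = subst_form (Suc n) G0 P Q"
      define B where "B = subst_form (Suc n) G1 P Q"
      define M where "M = Suc n * a"
      define N where "N = Suc n * b"
      note bdA = bidegree_le_subst_form[OF P Q, of "Suc n" G0, folded A_def M_def N_def]
      note bdB = bidegree_le_subst_form[OF P Q, of "Suc n" G1, folded B_def M_def N_def]
      obtain h where h: "[:[:0, 1:]:] * A + B = R * h"
        using Suc.prems(3) unfolding A_def B_def by (rule dvdE)
      have "b \<le> N" by (simp add: N_def)
      have "bidegree_le (0 + M) (1 + N) ([:[:0, 1:]:] * A)"
        by (intro bidegree_le_mult bidegree_le_0_1 bdA)
      then have bdh: "bidegree_le M (Suc N) (R * h)"
        unfolding h[symmetric] using bidegree_le_mono[OF bdB, of M "Suc N"]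
        by (intro bidegree_le_add) simp_all
      have "\<exists>h1 h2. h = [:[:0, 1:]:] * h1 + h2 \<and> bidegree_le M N (R * h1) \<and> bidegree_le M N (R * h2)"
      proof (cases "h = 0")
        case True
        then show ?thesis by (intro exI[of _ 0]) simp
      next
        case False
        note * = bidegree_of_cofactor[OF bdh this R(3,4)]
        have "Suc N - n' = Suc (N - n')" using R(5) \<open>b \<le> N\<close> by simp
        then obtain h1 h2 where h12: "h = [:[:0, 1:]:] * h1 + h2"
          and bd12: "bidegree_le (M - ?m) (N - n') h1" "bidegree_le (M - ?m) (N - n') h2"
          using split_inner_constant_term *(3) by metis
        have eqs: "M = ?m + (M - ?m)" "N = n' + (N - n')" using *(1) R(5) \<open>b \<le> N\<close> by simp_all
        have "bidegree_le M N (R * h1)" "bidegree_le M N (R * h2)"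
          using bidegree_le_mult[OF R(3) bd12(1)] bidegree_le_mult[OF R(3) bd12(2)] eqs by simp_all
        then show ?thesis using h12 by blast
      qed
      then obtain h1 h2 where h12: "h = [:[:0, 1:]:] * h1 + h2"
        and bd12: "bidegree_le M N (R * h1)" "bidegree_le M N (R * h2)" by blast
      define S where "S = A - R * h1"
      have A: "A = S * 1 + R * h1" by (simp add: S_def)
      have YS: "[:[:0, 1:]:] * S = - (B - R * h2)"
      proof -
        have "[:[:0, 1:]:] * S + (B - R * h2) = ([:[:0, 1:]:] * A + B) - R * ([:[:0, 1:]:] * h1 + h2)"
          unfolding S_def by (simp only: algebra_simps)
        also have "\<dots> = 0" unfolding h h12[symmetric] by simp
        finally show ?thesis by (simp only: eq_neg_iff_add_eq_0)
      qed
      have B: "B = - ([:[:0, 1:]:] * S) + R * h2" unfolding YS by simp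
      have "N > 1" using ab(2) \<open>b \<le> N\<close> by simp
      then have N: "N = Suc (N - 1)" by simp
      have "bidegree_le M N ([:[:0, 1:]:] * S)"
        unfolding YS by (intro bidegree_le_minus bidegree_le_diff bdB bd12)
      then have bdS: "bidegree_le M (N - 1) S"
        using bidegree_le_of_inner_var_mult N by metis
      have "M > 0" using ab by (simp add: M_def)
      from biforms_common_zero[OF R(3) bdS R(2) this] obtain s t u v
        where st: "(s, t) \<noteq> (0, 0)" and uv: "(u, v) \<noteq> (0, 0)"
        and zero: "hom_eval ?m n' R s t u v = 0" "hom_eval M (N - 1) S s t u v = 0"
        using \<open>N > 1\<close> by auto
      have "hom_eval M N (S * 1) s t u v = 0"
        using hom_eval_mult[OF bdS bidegree_le_0_1(1), of s t u v] N zero(2) by simp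
      then have "hom_eval M N A s t u v = 0"
        unfolding A hom_eval_add using vanish[OF bd12(1) zero(1)] by simp
      moreover have "hom_eval M N ([:[:0, 1:]:] * S) s t u v = 0"
        using hom_eval_mult[OF bidegree_le_0_1(2) bdS, of s t u v] N zero(2) by simp
      then have "hom_eval M N B s t u v = 0"
        unfolding B hom_eval_add hom_eval_minus using vanish[OF bd12(2) zero(1)] by simp
      ultimately have "hform (Suc n) G0 (hom_eval a b P s t u v) (hom_eval a b Q s t u v) = 0"
        "hform (Suc n) G1 (hom_eval a b P s t u v) (hom_eval a b Q s t u v) = 0"
        unfolding A_def B_def M_def N_def by (simp_all only: hom_eval_subst_form[OF P Q])
      moreover have "(hom_eval a b P s t u v, hom_eval a b Q s t u v) \<noteq> (0, 0)"
        using nobase[OF st uv zero(1)] by blast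
      ultimately show ?thesis using False by blast
    qed
  qed
qed

section \<open>Polynomials in several variables\<close>

lemma mpoly_as_sum: "f = (\<Sum>m\<in>Poly_Mapping.keys f. Poly_Mapping.single m (Poly_Mapping.lookup f m))"
proof (rule poly_mapping_eqI)
  fix k
  have "Poly_Mapping.lookup (\<Sum>m\<in>Poly_Mapping.keys f. Poly_Mapping.single m (Poly_Mapping.lookup f m)) k =
     (\<Sum>m\<in>Poly_Mapping.keys f. if m = k then Poly_Mapping.lookup f k else 0)"
    unfolding lookup_sum by (intro sum.cong refl) (simp add: lookup_single)
  then show "Poly_Mapping.lookup f k =
     Poly_Mapping.lookup (\<Sum>m\<in>Poly_Mapping.keys f. Poly_Mapping.single m (Poly_Mapping.lookup f m)) k"
    by (simp add: in_keys_iff)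
qed

text \<open>The product ranges over all variables, not over the support of \<open>m\<close>, which makes \<open>mono_eval\<close>
  visibly multiplicative.\<close>

definition mono_eval :: "('v::finite \<Rightarrow> 'r::comm_ring_1) \<Rightarrow> ('v \<Rightarrow>\<^sub>0 nat) \<Rightarrow> 'r" where
  "mono_eval x m = (\<Prod>i\<in>UNIV. x i ^ Poly_Mapping.lookup m i)"

lemma mono_eval_add: "mono_eval x (m + m') = mono_eval x m * mono_eval x m'"
  by (simp add: mono_eval_def lookup_add power_add prod.distrib)

lemma mono_eval_0 [simp]: "mono_eval x 0 = 1"
  by (simp add: mono_eval_def)

text \<open>Polynomials over \<open>k\<close> are evaluated at points of \<open>k\<close>, but also at vectors of polynomials in one and
  two variables; these cases share the ring homomorphism \<open>h\<close> on coefficients.\<close>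

locale coefficient_hom =
  fixes h :: "'k::field \<Rightarrow> 'r::comm_ring_1"
  assumes h_0: "h 0 = 0" and h_1: "h 1 = 1" and h_add: "h (c + d) = h c + h d"
    and h_mult: "h (c * d) = h c * h d"
begin

definition aeval :: "('v::finite, 'k) mpoly \<Rightarrow> ('v \<Rightarrow> 'r) \<Rightarrow> 'r" where
  "aeval f x = (\<Sum>m\<in>Poly_Mapping.keys f. h (Poly_Mapping.lookup f m) * mono_eval x m)"

lemma h_of_nat: "h (of_nat n) = of_nat n"
  by (induction n) (simp_all add: h_0 h_1 h_add)

lemma aeval_superset:
  assumes "finite S" "Poly_Mapping.keys f \<subseteq> S"
  shows "aeval f x = (\<Sum>m\<in>S. h (Poly_Mapping.lookup f m) * mono_eval x m)"
  unfolding aeval_def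
  by (rule sum.mono_neutral_left) (use assms in \<open>auto simp: in_keys_iff h_0\<close>)

lemma aeval_0 [simp]: "aeval 0 x = 0"
  by (simp add: aeval_def)

lemma aeval_add: "aeval (f + g) x = aeval f x + aeval g x"
proof -
  let ?S = "Poly_Mapping.keys f \<union> Poly_Mapping.keys g"
  have "Poly_Mapping.keys (f + g) \<subseteq> ?S" by (rule keys_add)
  then show ?thesis
    by (simp add: aeval_superset[of ?S] lookup_add h_add distrib_right sum.distrib)
qed

lemma aeval_sum: "aeval (\<Sum>i\<in>I. f i) x = (\<Sum>i\<in>I. aeval (f i) x)"
  by (induction I rule: infinite_finite_induct) (simp_all add: aeval_add)

lemma aeval_single: "aeval (Poly_Mapping.single m c) x = h c * mono_eval x m"
  by (subst aeval_superset[of "{m}"]) auto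

lemma aeval_mult: "aeval (f * g) x = aeval f x * aeval g x"
proof -
  let ?s = "\<lambda>f m. Poly_Mapping.single m (Poly_Mapping.lookup f m)"
  have "f * g = (\<Sum>m\<in>Poly_Mapping.keys f. ?s f m) * (\<Sum>m\<in>Poly_Mapping.keys g. ?s g m)"
    by (simp flip: mpoly_as_sum)
  also have "\<dots> = (\<Sum>m\<in>Poly_Mapping.keys f. \<Sum>m'\<in>Poly_Mapping.keys g. ?s f m * ?s g m')"
    by (rule sum_product)
  finally have "aeval (f * g) x =
      (\<Sum>m\<in>Poly_Mapping.keys f. \<Sum>m'\<in>Poly_Mapping.keys g. aeval (?s f m * ?s g m') x)"
    by (simp only: aeval_sum)
  also have "\<dots> = aeval f x * aeval g x"
    unfolding aeval_def[of f] aeval_def[of g] sum_product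
    by (simp add: mult_single aeval_single h_mult mono_eval_add ac_simps)
  finally show ?thesis .
qed

lemma aeval_power: "aeval (f ^ n) x = aeval f x ^ n"
proof (induction n)
  case 0
  have "aeval 1 x = 1" using aeval_single[of 0 1 x] by (simp add: h_1)
  then show ?case by simp
qed (simp add: aeval_mult)

lemma aeval_deriv:
  "aeval (mp_deriv i f) x = (\<Sum>m\<in>Poly_Mapping.keys f. h (Poly_Mapping.lookup f m) *
     (of_nat (Poly_Mapping.lookup m i) * x i ^ (Poly_Mapping.lookup m i - 1) *
      (\<Prod>j\<in>UNIV - {i}. x j ^ Poly_Mapping.lookup m j)))"
proof -
  have mono: "mono_eval x (m - Poly_Mapping.single i 1) =
      x i ^ (Poly_Mapping.lookup m i - 1) * (\<Prod>j\<in>UNIV - {i}. x j ^ Poly_Mapping.lookup m j)" for m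
    unfolding mono_eval_def
    by (subst prod.remove[of _ i]) (auto simp: lookup_minus lookup_single intro!: prod.cong)
  show ?thesis
    unfolding mp_deriv_def aeval_sum aeval_single mono h_mult h_of_nat
    by (intro sum.cong refl) (simp add: ac_simps)
qed

end

lemma power_first_order:
  fixes x w e :: "'r::comm_ring_1"
  shows "e\<^sup>2 dvd (x + e * w) ^ n - x ^ n - e * (of_nat n * x ^ (n - 1) * w)"
proof (induction n)
  case (Suc n)
  then obtain r where r: "(x + e * w) ^ n - x ^ n - e * (of_nat n * x ^ (n - 1) * w) = e\<^sup>2 * r"
    by (rule dvdE)
  then have eq: "(x + e * w) ^ n = x ^ n + e * (of_nat n * x ^ (n - 1) * w) + e\<^sup>2 * r"
    by (simp add: algebra_simps)
  have xn: "of_nat n * x ^ n = of_nat n * x ^ (n - 1) * x" by (cases n) simp_all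
  have "(x + e * w) ^ Suc n - x ^ Suc n - e * (of_nat (Suc n) * x ^ (Suc n - 1) * w) =
      (x + e * w) * (x ^ n + e * (of_nat n * x ^ (n - 1) * w) + e\<^sup>2 * r) - x * x ^ n
      - e * ((of_nat n * x ^ n + x ^ n) * w)"
    by (simp add: eq algebra_simps)
  also have "\<dots> = e\<^sup>2 * (w * (of_nat n * x ^ (n - 1) * w) + (x + e * w) * r)"
    unfolding xn by (simp add: algebra_simps power2_eq_square)
  finally show ?case by simp
qed simp

lemma product_first_order:
  fixes e :: "'r::comm_ring_1"
  assumes "e\<^sup>2 dvd A' - A - e * a" "e\<^sup>2 dvd B' - B - e * b"
  shows "e\<^sup>2 dvd A' * B' - A * B - e * (a * B + A * b)"
proof -
  obtain r s where "A' - A - e * a = e\<^sup>2 * r" "B' - B - e * b = e\<^sup>2 * s" using assms by (auto elim!: dvdE)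
  then have "A' = A + e * a + e\<^sup>2 * r" "B' = B + e * b + e\<^sup>2 * s" by (simp_all add: algebra_simps)
  then have "A' * B' - A * B - e * (a * B + A * b) =
     e\<^sup>2 * (a * b + A * s + r * B + e * (a * s + r * b) + e\<^sup>2 * (r * s))"
    by (simp add: algebra_simps power2_eq_square)
  then show ?thesis by simp
qed

lemma monomial_first_order:
  fixes x w :: "'i \<Rightarrow> 'r::comm_ring_1" and e :: 'r
  assumes "finite I"
  shows "e\<^sup>2 dvd (\<Prod>i\<in>I. (x i + e * w i) ^ n i) - (\<Prod>i\<in>I. x i ^ n i)
    - e * (\<Sum>j\<in>I. of_nat (n j) * x j ^ (n j - 1) * w j * (\<Prod>i\<in>I - {j}. x i ^ n i))"
  using assms
proof (induction rule: finite_induct)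
  case (insert k I)
  have "(\<Prod>i\<in>insert k I - {j}. x i ^ n i) = x k ^ n k * (\<Prod>i\<in>I - {j}. x i ^ n i)" if "j \<in> I" for j
  proof -
    have "insert k I - {j} = insert k (I - {j})" using that insert.hyps by auto
    then show ?thesis using insert.hyps by simp
  qed
  then have "(\<Sum>j\<in>insert k I. of_nat (n j) * x j ^ (n j - 1) * w j * (\<Prod>i\<in>insert k I - {j}. x i ^ n i)) =
     of_nat (n k) * x k ^ (n k - 1) * w k * (\<Prod>i\<in>I. x i ^ n i) +
     x k ^ n k * (\<Sum>j\<in>I. of_nat (n j) * x j ^ (n j - 1) * w j * (\<Prod>i\<in>I - {j}. x i ^ n i))"
    using insert.hyps by (simp add: sum_distrib_left ac_simps cong: sum.cong)
  then show ?case
    using product_first_order[OF power_first_order[of e "x k" "w k" "n k"] insert.IH] insert.hyps by simp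
qed simp

text \<open>Taylor expansion to first order, in any commutative ring and characteristic. It is applied with the
  equation of a curve as \<open>e\<close>.\<close>

lemma (in coefficient_hom) aeval_first_order:
  "e\<^sup>2 dvd aeval f (\<lambda>i. x i + e * w i) - aeval f x - e * (\<Sum>i\<in>UNIV. aeval (mp_deriv i f) x * w i)"
proof -
  let ?D = "\<lambda>m j. of_nat (Poly_Mapping.lookup m j) * x j ^ (Poly_Mapping.lookup m j - 1) * w j *
     (\<Prod>i\<in>UNIV - {j}. x i ^ Poly_Mapping.lookup m i)"
  have "(\<Sum>i\<in>UNIV. aeval (mp_deriv i f) x * w i) =
      (\<Sum>m\<in>Poly_Mapping.keys f. h (Poly_Mapping.lookup f m) * (\<Sum>j\<in>UNIV. ?D m j))"
    unfolding aeval_deriv sum_distrib_right sum_distrib_left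
    by (subst sum.swap) (simp add: ac_simps)
  moreover have "e * (\<Sum>m\<in>Poly_Mapping.keys f. h (Poly_Mapping.lookup f m) * (\<Sum>j\<in>UNIV. ?D m j)) =
      (\<Sum>m\<in>Poly_Mapping.keys f. h (Poly_Mapping.lookup f m) * (e * (\<Sum>j\<in>UNIV. ?D m j)))"
    by (subst sum_distrib_left) (simp only: mult.left_commute)
  ultimately have "aeval f (\<lambda>i. x i + e * w i) - aeval f x - e * (\<Sum>i\<in>UNIV. aeval (mp_deriv i f) x * w i) =
     (\<Sum>m\<in>Poly_Mapping.keys f. h (Poly_Mapping.lookup f m) *
        (mono_eval (\<lambda>i. x i + e * w i) m - mono_eval x m - e * (\<Sum>j\<in>UNIV. ?D m j)))"
    by (simp only: aeval_def[of f] right_diff_distrib sum_subtractf)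
  also have "e\<^sup>2 dvd \<dots>"
    unfolding mono_eval_def by (intro dvd_sum dvd_mult monomial_first_order) simp
  finally show ?thesis .
qed

interpretation eval_field: coefficient_hom "\<lambda>c. c :: 'k::field"
  by unfold_locales simp_all

interpretation eval_poly: coefficient_hom "\<lambda>c. [:c:] :: 'k::field poly"
  by unfold_locales (simp_all add: one_pCons)

interpretation eval_poly2: coefficient_hom "\<lambda>c. [:[:c:]:] :: 'k::field poly poly"
  by unfold_locales (simp_all add: one_pCons)

lemma mp_eval_eq_aeval: "mp_eval f x = eval_field.aeval f x"
proof -
  have "(\<Prod>i\<in>Poly_Mapping.keys m. x i ^ Poly_Mapping.lookup m i) = mono_eval x m" for m
    unfolding mono_eval_def by (rule prod.mono_neutral_left) (auto simp: in_keys_iff)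
  then show ?thesis by (simp add: mp_eval_def eval_field.aeval_def)
qed

lemmas mp_eval_mult = eval_field.aeval_mult[folded mp_eval_eq_aeval]
  and mp_eval_power = eval_field.aeval_power[folded mp_eval_eq_aeval]
  and mp_eval_sum = eval_field.aeval_sum[folded mp_eval_eq_aeval]
  and mp_eval_single = eval_field.aeval_single[folded mp_eval_eq_aeval]

lemma mp_eval_0 [simp]: "mp_eval 0 x = 0"
  by (simp add: mp_eval_def)

lemma eval2_aeval: "eval2 (eval_poly2.aeval f P) X Y = mp_eval f (\<lambda>i. eval2 (P i) X Y)"
  unfolding mp_eval_eq_aeval eval_poly2.aeval_def eval_field.aeval_def mono_eval_def
  by (simp only: eval2_sum eval2_simps eval2_prod) simp

lemma poly_aeval: "poly (eval_poly.aeval f p) z = mp_eval f (\<lambda>i. poly (p i) z)"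
  unfolding mp_eval_eq_aeval eval_poly.aeval_def eval_field.aeval_def mono_eval_def
  by (simp add: poly_sum poly_prod)

lemma homogeneous_0: "homogeneous d 0"
  by (simp add: homogeneous_def)

lemma homogeneous_add: "homogeneous d f \<Longrightarrow> homogeneous d g \<Longrightarrow> homogeneous d (f + g)"
  unfolding homogeneous_def using keys_add[of f g] by blast

lemma homogeneous_sum: "(\<And>i. i \<in> I \<Longrightarrow> homogeneous d (f i)) \<Longrightarrow> homogeneous d (\<Sum>i\<in>I. f i)"
  by (induction I rule: infinite_finite_induct) (auto intro: homogeneous_add homogeneous_0)

lemma homogeneous_single:
  "(\<Sum>i\<in>UNIV. Poly_Mapping.lookup m i) = d \<Longrightarrow> homogeneous d (Poly_Mapping.single m c)"
  by (simp add: homogeneous_def)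

lemma homogeneous_mult:
  assumes "homogeneous d f" "homogeneous e g"
  shows "homogeneous (d + e) (f * g)"
  unfolding homogeneous_def
proof
  fix m assume "m \<in> Poly_Mapping.keys (f * g)"
  then obtain m1 m2 where "m = m1 + m2" "m1 \<in> Poly_Mapping.keys f" "m2 \<in> Poly_Mapping.keys g"
    using keys_mult[of f g] by blast
  then show "(\<Sum>i\<in>UNIV. Poly_Mapping.lookup m i) = d + e"
    using assms by (simp add: homogeneous_def lookup_add sum.distrib)
qed

lemma homogeneous_power: "homogeneous d f \<Longrightarrow> homogeneous (n * d) (f ^ n)"
proof (induction n)
  case 0
  have "homogeneous 0 (Poly_Mapping.single (0 :: 'a \<Rightarrow>\<^sub>0 nat) (1 :: 'b))" by (rule homogeneous_single) simp
  then show ?case by simp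
qed (simp add: homogeneous_mult)

lemma homogeneous_deriv:
  assumes "homogeneous d f"
  shows "homogeneous (d - 1) (mp_deriv i f)"
  unfolding mp_deriv_def
proof (rule homogeneous_sum)
  fix m assume m: "m \<in> Poly_Mapping.keys f"
  let ?c = "of_nat (Poly_Mapping.lookup m i) * Poly_Mapping.lookup f m"
  show "homogeneous (d - 1) (Poly_Mapping.single (m - Poly_Mapping.single i 1) ?c)"
  proof (cases "Poly_Mapping.lookup m i = 0")
    case True
    then show ?thesis by (simp add: homogeneous_0)
  next
    case False
    have "(\<Sum>j\<in>UNIV. Poly_Mapping.lookup m j) = d" using assms m by (simp add: homogeneous_def)
    moreover have "(\<Sum>j\<in>UNIV. Poly_Mapping.lookup m j) = (\<Sum>j\<in>UNIV. 
        Poly_Mapping.lookup (m - Poly_Mapping.single i 1) j + (if j = i then 1 else 0))"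
      using False by (intro sum.cong refl) (auto simp: lookup_minus lookup_single)
    ultimately have "(\<Sum>j\<in>UNIV. Poly_Mapping.lookup (m - Poly_Mapping.single i 1) j) = d - 1"
      by (simp add: sum.distrib)
    then show ?thesis by (rule homogeneous_single)
  qed
qed

lemma mp_eval_scale:
  assumes "homogeneous d f"
  shows "mp_eval f (\<lambda>i. c * x i) = c ^ d * mp_eval f x"
proof -
  have "mono_eval (\<lambda>i. c * x i) m = c ^ d * mono_eval x m" if "m \<in> Poly_Mapping.keys f" for m
    using assms that by (simp add: mono_eval_def power_mult_distrib prod.distrib homogeneous_def
        flip: power_sum)
  then show ?thesis
    unfolding mp_eval_eq_aeval eval_field.aeval_def sum_distrib_left by (simp add: ac_simps)
qed

lemma biform_mp_eval:
  fixes f :: "'v::finite \<Rightarrow> 'k::field \<Rightarrow> 'k \<Rightarrow> 'k \<Rightarrow> 'k \<Rightarrow> 'k"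
  assumes F: "homogeneous d F" and f: "\<And>i. biform a b (f i)"
  shows "biform (d * a) (d * b) (\<lambda>s t u v. mp_eval F (\<lambda>i. f i s t u v))"
  unfolding mp_eval_eq_aeval eval_field.aeval_def
proof (intro biform_sum biform_cmult)
  fix m assume "m \<in> Poly_Mapping.keys F"
  then have d: "(\<Sum>i\<in>UNIV. Poly_Mapping.lookup m i) = d" using F by (simp add: homogeneous_def)
  show "biform (d * a) (d * b) (\<lambda>s t u v. mono_eval (\<lambda>i. f i s t u v) m)"
    unfolding mono_eval_def d[symmetric] by (intro biform_prod biform_power f) simp
qed

text \<open>The derivative in a direction along which \<open>F\<close> vanishes identically: expand \<open>F(z + x w) = 0\<close> in
  \<open>k[x]\<close> modulo \<open>x\<^sup>2\<close>.\<close>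

lemma deriv_along_subspace:
  fixes F :: "('v::finite, 'k::alg_closed_field) mpoly"
  assumes "\<And>c. mp_eval F (\<lambda>i. z i + c * w i) = 0"
  shows "(\<Sum>i\<in>UNIV. mp_eval (mp_deriv i F) z * w i) = 0"
proof -
  let ?x = "[:0, 1:] :: 'k poly"
  let ?D = "\<Sum>i\<in>UNIV. mp_eval (mp_deriv i F) z * w i"
  have zero: "eval_poly.aeval F (\<lambda>i. [:z i:] + ?x * [:w i:]) = 0"
    by (rule poly_eq_zero_if_cofinite_roots[of "{}"]) (simp_all add: poly_aeval assms)
  have const: "eval_poly.aeval f (\<lambda>i. [:z i:]) = [:mp_eval f z:]" for f :: "('v, 'k) mpoly"
  proof -
    have "poly (eval_poly.aeval f (\<lambda>i. [:z i:]) - [:mp_eval f z:]) c = 0" for c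
      by (simp add: poly_aeval)
    then have "eval_poly.aeval f (\<lambda>i. [:z i:]) - [:mp_eval f z:] = 0"
      by (intro poly_eq_zero_if_cofinite_roots[of "{}"]) simp_all
    then show ?thesis by simp
  qed
  have sum: "(\<Sum>i\<in>UNIV. [:mp_eval (mp_deriv i F) z:] * [:w i:]) = [:?D:]"
    by (rule poly_eqI) (simp add: coeff_sum coeff_pCons mult.commute split: nat.split)
  have "mp_eval F z = 0" using assms[of 0] by simp
  then have "?x\<^sup>2 dvd - (?x * [:?D:])"
    using eval_poly.aeval_first_order[of ?x F "\<lambda>i. [:z i:]" "\<lambda>i. [:w i:]"] zero
    by (simp only: const sum) simp
  then have "?x * ?x dvd ?x * [:?D:]" by (simp only: dvd_minus_iff power2_eq_square)
  then have "?x dvd [:?D:]" by (subst (asm) dvd_mult_cancel_left) simp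
  then have "poly [:?D:] 0 = 0" by (subst poly_eq_0_iff_dvd) simp
  then show ?thesis by simp
qed

section \<open>Contact along the line\<close>

no_notation vec_index (infixl \<open>$\<close> 100)

text \<open>Coordinates \<open>r 1, \<dots>, r 4\<close> on \<open>k\<^sup>4\<close> that extend two given independent linear forms, and the dual
  basis \<open>e 1, \<dots>, e 4\<close>; the common zeros of the two forms are spanned by \<open>e 3\<close> and \<open>e 4\<close>.\<close>

lemma dual_bases_extending_pair:
  fixes \<alpha> \<beta> :: "'k::field ^ 4"
  assumes "\<forall>x y. x *s \<alpha> + y *s \<beta> = 0 \<longrightarrow> x = 0 \<and> y = 0"
  shows "\<exists>r e :: 4 \<Rightarrow> 'k ^ 4. r 1 = \<alpha> \<and> r 2 = \<beta> \<and>
     (\<forall>p i. p $ i = (\<Sum>j\<in>UNIV. (\<Sum>l\<in>UNIV. r j $ l * p $ l) * e j $ i)) \<and>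
     (\<forall>j k. (\<Sum>l\<in>UNIV. r j $ l * e k $ l) = (if j = k then 1 else 0))"
proof -
  have indep: "x = 0 \<and> y = 0" if "x *s \<alpha> + y *s \<beta> = 0" for x y using assms that by blast
  have "\<alpha> \<noteq> \<beta>" using indep[of 1 "-1"] by (auto simp: vec_eq_iff)
  have "vec.independent {\<alpha>, \<beta>}"
  proof -
    have "\<beta> \<noteq> 0" using indep[of 0 1] by auto
    moreover have "\<alpha> \<notin> vec.span {\<beta>}"
    proof
      assume "\<alpha> \<in> vec.span {\<beta>}"
      then obtain k where "\<alpha> = k *s \<beta>" by (auto simp: vec.span_singleton)
      then have "1 *s \<alpha> + (- k) *s \<beta> = 0" by (simp add: vec_eq_iff)
      then show False using indep by fastforce
    qed
    ultimately show ?thesis by (subst vec.independent_insert) auto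
  qed
  define B where "B = vec.extend_basis {\<alpha>, \<beta>}"
  have B: "vec.independent B" "vec.span B = UNIV" "{\<alpha>, \<beta>} \<subseteq> B"
    unfolding B_def using \<open>vec.independent {\<alpha>, \<beta>}\<close>
    by (rule vec.independent_extend_basis vec.span_extend_basis vec.extend_basis_superset)+
  have "card B = vec.dim (UNIV :: ('k ^ 4) set)"
    using B by (intro vec.dim_eq_card[symmetric]) auto
  then have "card B = 4" by (simp only: vec.dim_UNIV card_cart_basis) simp
  then have "finite B" by (metis card.infinite zero_neq_numeral)
  then have "card (B - {\<alpha>, \<beta>}) = 2"
    using B(3) \<open>card B = 4\<close> \<open>\<alpha> \<noteq> \<beta>\<close> by (subst card_Diff_subset) auto
  then obtain \<gamma> \<delta> where "B - {\<alpha>, \<beta>} = {\<gamma>, \<delta>}" by (auto simp: card_2_iff)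
  then have Beq: "B = {\<alpha>, \<beta>, \<gamma>, \<delta>}" using B(3) by auto
  define r :: "4 \<Rightarrow> 'k ^ 4" where "r j = (if j = 1 then \<alpha> else if j = 2 then \<beta> else if j = 3 then \<gamma> else \<delta>)" for j
  have r: "r 1 = \<alpha>" "r 2 = \<beta>" "r 3 = \<gamma>" "r 4 = \<delta>" by (simp_all add: r_def)
  define A :: "'k ^ 4 ^ 4" where "A = (\<chi> j. r j)"
  have "Finite_Cartesian_Product.rows A = range r"
    by (auto simp: Finite_Cartesian_Product.rows_def Finite_Cartesian_Product.row_def A_def vec_lambda_eta)
  also have "\<dots> = B" unfolding UNIV_4 Beq by (simp add: r)
  finally have "Finite_Cartesian_Product.rows A = B" .
  then have "vec.span (Finite_Cartesian_Product.rows A) = UNIV" using B by simp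
  then obtain C :: "'k ^ 4 ^ 4" where CA: "C ** A = Finite_Cartesian_Product.mat 1"
    unfolding matrix_left_invertible_span_rows_gen[symmetric] by blast
  then have AC: "A ** C = Finite_Cartesian_Product.mat 1" by (simp add: matrix_left_right_inverse)
  define e :: "4 \<Rightarrow> 'k ^ 4" where "e j = (\<chi> i. C $ i $ j)" for j
  have "p $ i = (\<Sum>j\<in>UNIV. (\<Sum>l\<in>UNIV. r j $ l * p $ l) * e j $ i)" for p :: "'k ^ 4" and i
  proof -
    have "p = C *v (A *v p)" using CA by (simp add: matrix_vector_mul_assoc)
    then have "p $ i = (C *v (A *v p)) $ i" by simp
    then show ?thesis by (simp add: matrix_vector_mult_def A_def e_def mult.commute)
  qed
  moreover have "(\<Sum>l\<in>UNIV. r j $ l * e k $ l) = (if j = k then 1 else 0)" for j k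
  proof -
    have "(\<Sum>l\<in>UNIV. r j $ l * e k $ l) = (A ** C) $ j $ k"
      by (simp add: matrix_matrix_mult_def A_def e_def)
    then show ?thesis by (simp add: AC Finite_Cartesian_Product.mat_def)
  qed
  ultimately show ?thesis using r(1,2) by (intro exI[of _ r] exI[of _ e]) blast
qed

lemma binary_form_of_plane:
  fixes H :: "('v::finite, 'k::field) mpoly"
  assumes "homogeneous n H"
  shows "\<exists>G. degree G \<le> n \<and> (\<forall>c d. mp_eval H (\<lambda>i. c * x i + d * y i) = hform n G c d)"
proof -
  have "biform 1 0 (\<lambda>s t u v. s * x i + t * y i)" for i
    using biform_add[OF biform_monom[of 1 1 0 0 "x i"] biform_monom[of 0 1 0 0 "y i"]]
    by (simp add: mult.commute)
  then have "biform (n * 1) (n * 0) (\<lambda>s t u v. mp_eval H (\<lambda>i. s * x i + t * y i))"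
    by (intro biform_mp_eval[OF assms])
  then obtain P where P: "bidegree_le n 0 P"
    "\<And>s t u v. mp_eval H (\<lambda>i. s * x i + t * y i) = hom_eval n 0 P s t u v"
    unfolding biform_def by (auto simp: fun_eq_iff)
  define G where "G = map_poly (\<lambda>c. coeff c 0) P"
  have c: "coeff G i = coeff (coeff P i) 0" for i by (simp add: G_def coeff_map_poly)
  have "degree G \<le> n"
    by (rule degree_le, intro allI impI, subst c) (use P(1) in \<open>simp add: bidegree_le_def coeff_eq_0\<close>)
  moreover have "mp_eval H (\<lambda>i. s * x i + t * y i) = hform n G s t" for s t
    unfolding P(2)[of s t 1 1] hom_eval_def hform_def by (simp add: c mult.assoc)
  ultimately show ?thesis by blast
qed

lemma bidegree_le_scalar_sum:
  "(\<And>i. bidegree_le a b (P i)) \<Longrightarrow> bidegree_le a b (\<Sum>i\<in>I. [:[:c i:]:] * P i)"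
  by (intro bidegree_le_sum bidegree_le_smult)

lemma hom_eval_scalar_sum:
  "(\<And>i. bidegree_le a b (P i)) \<Longrightarrow>
   hom_eval a b (\<Sum>i\<in>I. [:[:c i:]:] * P i) s t u v = (\<Sum>i\<in>I. c i * hom_eval a b (P i) s t u v)"
  by (simp only: hom_eval_sum hom_eval_smult)

text \<open>The two assertions are that the curve \<open>lin 1 = 0\<close> is mapped onto the line spanned by \<open>e 3\<close> and
  \<open>e 4\<close>, and that all forms vanishing on the image are singular along this line. In the notation of the
  introduction, \<open>lin 1 = v q\<close>, \<open>lin 2 = - u q\<close>, \<open>lin 3 = P\<close> and \<open>lin 4 = Q\<close>. The hypothesis on the
  degree of \<open>lin 1\<close> says that the curve has a component, visible in this chart, on which the second
  projection is not constant.\<close>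

theorem contact_along_line_chart:
  fixes P :: "4 \<Rightarrow> 'k::alg_closed_field poly poly" and r e :: "4 \<Rightarrow> 'k ^ 4"
  defines "lin \<equiv> \<lambda>j. \<Sum>i\<in>UNIV. [:[:r j $ i:]:] * P i"
  assumes bd: "\<And>i. bidegree_le a b (P i)" and ab: "a > 0" "b > 1"
    and dual: "\<And>p i. p $ i = (\<Sum>j\<in>UNIV. (\<Sum>l\<in>UNIV. r j $ l * p $ l) * e j $ i)"
    and rel: "[:[:0, 1:]:] * lin 1 + lin 2 = 0" and deg: "degree (lin 1) > 0"
    and bpfree: "\<forall>s t u v. (s, t) \<noteq> (0, 0) \<longrightarrow> (u, v) \<noteq> (0, 0) \<longrightarrow>
       (\<exists>i. hom_eval a b (P i) s t u v \<noteq> 0)"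
  shows "(c, d) \<noteq> (0, 0) \<Longrightarrow> \<exists>s t u v \<rho>. (s, t) \<noteq> (0, 0) \<and> (u, v) \<noteq> (0, 0) \<and> \<rho> \<noteq> 0 \<and>
       (\<forall>i. hom_eval a b (P i) s t u v = \<rho> * (c * e 3 $ i + d * e 4 $ i))"
    and "homogeneous D F \<Longrightarrow> (\<And>X Y. mp_eval F (\<lambda>i. eval2 (P i) X Y) = 0) \<Longrightarrow>
       mp_eval (mp_deriv j F) (\<lambda>i. c * e 3 $ i + d * e 4 $ i) = 0"
proof -
  define q where "q = lin 1"
  have lin2: "lin 2 = - ([:[:0, 1:]:] * q)" using rel unfolding q_def by (simp only: eq_neg_iff_add_eq_0 add.commute)
  have bdl: "bidegree_le a b (lin j)" for j unfolding lin_def by (intro bidegree_le_scalar_sum bd)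
  have "bidegree_le a (Suc (b - 1)) ([:[:0, 1:]:] * q)"
    using bidegree_le_minus[OF bdl[of 2]] ab(2) unfolding lin2 by simp
  then have bdq: "bidegree_le a (b - 1) q" by (rule bidegree_le_of_inner_var_mult)
  have b: "b = Suc (b - 1)" using ab by simp
  have hlin: "hom_eval a b (lin j) s t u v = (\<Sum>l\<in>UNIV. r j $ l * hom_eval a b (P l) s t u v)" for j s t u v
    unfolding lin_def by (rule hom_eval_scalar_sum) (rule bd)
  have hP: "hom_eval a b (P i) s t u v = (\<Sum>j\<in>UNIV. hom_eval a b (lin j) s t u v * e j $ i)" for i s t u v
    using dual[of "\<chi> l. hom_eval a b (P l) s t u v" i] by (simp add: hlin)
  have elin: "eval2 (lin j) X Y = (\<Sum>l\<in>UNIV. r j $ l * eval2 (P l) X Y)" for j X Y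
    unfolding lin_def by (simp only: eval2_sum eval2_simps) simp
  have eP: "eval2 (P i) X Y = (\<Sum>j\<in>UNIV. eval2 (lin j) X Y * e j $ i)" for i X Y
    using dual[of "\<chi> l. eval2 (P l) X Y" i] by (simp add: elin)
  have q_zero: "hom_eval a b (lin 1) s t u v = 0 \<and> hom_eval a b (lin 2) s t u v = 0"
    if "hom_eval a (b - 1) q s t u v = 0" for s t u v
  proof -
    have "hom_eval a b (lin 1 * 1) s t u v = 0"
      using hom_eval_mult[OF bdq bidegree_le_0_1(1), of s t u v] that b by (simp add: q_def)
    moreover have "hom_eval a b ([:[:0, 1:]:] * q) s t u v = 0"
      using hom_eval_mult[OF bidegree_le_0_1(2) bdq, of s t u v] that b by simp
    ultimately show ?thesis unfolding lin2 hom_eval_minus by simp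
  qed
  have on_curve: "\<exists>s t u v \<rho>. (s, t) \<noteq> (0, 0) \<and> (u, v) \<noteq> (0, 0) \<and> \<rho> \<noteq> 0 \<and>
       (\<forall>i. hom_eval a b (P i) s t u v = \<rho> * (c * e 3 $ i + d * e 4 $ i))"
    if cd: "(c, d) \<noteq> (0, 0)" for c d
  proof -
    have bdS: "bidegree_le a b ([:[:d:]:] * lin 3 - [:[:c:]:] * lin 4)"
      by (intro bidegree_le_diff bidegree_le_smult bdl)
    from biforms_common_zero[OF bdq bdS ab(1) ab(1)] ab(2) obtain s t u v
      where st: "(s, t) \<noteq> (0, 0)" and uv: "(u, v) \<noteq> (0, 0)"
        and zero: "hom_eval a (b - 1) q s t u v = 0"
          "hom_eval a b ([:[:d:]:] * lin 3 - [:[:c:]:] * lin 4) s t u v = 0" by auto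
    define x where "x = hom_eval a b (lin 3) s t u v"
    define y where "y = hom_eval a b (lin 4) s t u v"
    have xy: "d * x = c * y"
      using zero(2) unfolding hom_eval_diff hom_eval_smult[OF bdl] x_def y_def by simp
    have P: "hom_eval a b (P i) s t u v = x * e 3 $ i + y * e 4 $ i" for i
      unfolding hP sum_4 using q_zero[OF zero(1)] by (simp add: x_def y_def)
    \<comment> \<open>The factor with \<open>(x, y) = \<rho> (c, d)\<close>; \<open>c\<close> and \<open>d\<close> are not both zero.\<close>
    define \<rho> where "\<rho> = (if c \<noteq> 0 then x / c else y / d)"
    have \<rho>: "x = \<rho> * c" "y = \<rho> * d" using xy cd by (auto simp: \<rho>_def field_simps)
    have "\<exists>i. hom_eval a b (P i) s t u v \<noteq> 0" using bpfree st uv by blast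
    then have "\<rho> \<noteq> 0" using P \<rho> by auto
    moreover have "hom_eval a b (P i) s t u v = \<rho> * (c * e 3 $ i + d * e 4 $ i)" for i
      unfolding P \<rho> by (simp add: algebra_simps)
    ultimately show ?thesis using st uv by blast
  qed
  show "\<exists>s t u v \<rho>. (s, t) \<noteq> (0, 0) \<and> (u, v) \<noteq> (0, 0) \<and> \<rho> \<noteq> 0 \<and>
       (\<forall>i. hom_eval a b (P i) s t u v = \<rho> * (c * e 3 $ i + d * e 4 $ i))" if "(c, d) \<noteq> (0, 0)"
    using on_curve[OF that] .

  assume F: "homogeneous D F" and F0: "\<And>X Y. mp_eval F (\<lambda>i. eval2 (P i) X Y) = 0"
  have F_image: "mp_eval F (\<lambda>i. hom_eval a b (P i) s t u v) = 0" for s t u v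
  proof -
    have "(\<lambda>s t u v. mp_eval F (\<lambda>i. hom_eval a b (P i) s t u v)) = (\<lambda>s t u v. 0)"
      by (rule biform_eqI[OF biform_mp_eval[OF F biform_hom_eval[OF bd]] biform_zero])
         (simp add: hom_eval_affine[OF bd] F0)
    then show ?thesis by (simp add: fun_eq_iff)
  qed
  have F_line: "mp_eval F (\<lambda>i. c * e 3 $ i + d * e 4 $ i) = 0" for c d
  proof -
    have *: "mp_eval F (\<lambda>i. c * e 3 $ i + d * e 4 $ i) = 0" if cd: "(c, d) \<noteq> (0, 0)" for c d
    proof -
      obtain s t u v \<rho> where "\<rho> \<noteq> 0" "\<And>i. hom_eval a b (P i) s t u v = \<rho> * (c * e 3 $ i + d * e 4 $ i)"
        using on_curve[OF cd] by blast
      then have "\<rho> ^ D * mp_eval F (\<lambda>i. c * e 3 $ i + d * e 4 $ i) = 0"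
        using F_image[of s t u v] by (simp add: mp_eval_scale[OF F])
      then show ?thesis using \<open>\<rho> \<noteq> 0\<close> by simp
    qed
    show ?thesis
    proof (cases "(c, d) = (0, 0)")
      case True
      have "mp_eval F (\<lambda>i. 0 * (1 * e 3 $ i + 0 * e 4 $ i)) = 0"
        using *[of 1 0] by (subst mp_eval_scale[OF F]) simp
      then show ?thesis using True by simp
    qed (rule *)
  qed
  obtain R where R: "prime_elem R" "R dvd q" "degree R > 0"
    using exists_prime_factor deg unfolding q_def by blast
  obtain h where h: "q = R * h" using R(2) by (rule dvdE)
  have "h \<noteq> 0" using deg h unfolding q_def by auto
  obtain n' i' where n': "bidegree_le (degree R) n' R" "coeff (coeff R i') n' \<noteq> 0"
    using bidegree_exact[of R] R(3) by (metis degree_0 less_numeral_extra(3))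
  note cof = bidegree_of_cofactor[OF bdq[unfolded h] \<open>h \<noteq> 0\<close> n']
  have "n' < b" using cof(2) ab by simp
  have nobase: False
    if "(s, t) \<noteq> (0, 0)" "(u, v) \<noteq> (0, 0)" "hom_eval (degree R) n' R s t u v = 0"
      "hom_eval a b (lin 3) s t u v = 0" "hom_eval a b (lin 4) s t u v = 0" for s t u v
  proof -
    have "degree R + (a - degree R) = a" "n' + (b - 1 - n') = b - 1" using cof(1,2) by simp_all
    then have "hom_eval a (b - 1) q s t u v = 0"
      using hom_eval_mult[OF n'(1) cof(3), of s t u v] that(3) by (simp only: h mult_zero_left)
    then have "hom_eval a b (P i) s t u v = 0" for i
      using that(4,5) q_zero unfolding hP sum_4 by simp
    then show False using bpfree that(1,2) by blast
  qed
  define dF where "dF k = (\<Sum>i\<in>UNIV. Poly_Mapping.single 0 (e k $ i) * mp_deriv i F)" for k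
  have dF_eval: "mp_eval (dF k) x = (\<Sum>i\<in>UNIV. mp_eval (mp_deriv i F) x * e k $ i)" for k x
    by (simp add: dF_def mp_eval_sum mp_eval_mult mp_eval_single mult.commute)
  have "homogeneous (0 + (D - 1)) (dF k)" for k
    unfolding dF_def by (intro homogeneous_sum homogeneous_mult homogeneous_deriv F homogeneous_single) simp
  then have dF_hom: "homogeneous (D - 1) (dF k)" for k by simp
  obtain G1 where G1: "degree G1 \<le> D - 1"
    "\<And>c d. mp_eval (dF 1) (\<lambda>i. c * e 3 $ i + d * e 4 $ i) = hform (D - 1) G1 c d"
    using binary_form_of_plane[OF dF_hom] by blast
  obtain G2 where G2: "degree G2 \<le> D - 1"
    "\<And>c d. mp_eval (dF 2) (\<lambda>i. c * e 3 $ i + d * e 4 $ i) = hform (D - 1) G2 c d"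
    using binary_form_of_plane[OF dF_hom] by blast
  define z where "z i = [:[:e 3 $ i:]:] * lin 3 + [:[:e 4 $ i:]:] * lin 4" for i
  \<comment> \<open>The parametrisation is \<open>z + q w\<close>, where \<open>z\<close> runs in the plane of \<open>e 3\<close> and \<open>e 4\<close> and the direction
  \<open>w = v e 1 - u e 2\<close> is normal to it.\<close>
  define w where "w i = [:[:e 1 $ i:]:] - [:[:0, 1:]:] * [:[:e 2 $ i:]:]" for i
  have ez: "eval2 (z i) X Y = eval2 (lin 3) X Y * e 3 $ i + eval2 (lin 4) X Y * e 4 $ i" for i X Y
    unfolding z_def by (simp only: eval2_simps) (simp add: mult.commute)
  have Pzw: "P i = z i + q * w i" for i
  proof (rule poly_poly_eqI)
    fix X Y
    have "eval2 (lin 2) X Y = - (Y * eval2 q X Y)" unfolding lin2 by (simp only: eval2_simps) simp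
    then show "eval2 (P i) X Y = eval2 (z i + q * w i) X Y"
      unfolding eP sum_4 by (simp only: eval2_simps ez w_def q_def) (simp add: algebra_simps)
  qed
  have FP: "eval_poly2.aeval F (\<lambda>i. z i + q * w i) = 0"
    by (rule poly_poly_eqI) (simp only: eval2_aeval Pzw[symmetric] F0 eval2_simps)
  have Fz: "eval_poly2.aeval F z = 0"
    by (rule poly_poly_eqI) (simp only: eval2_aeval ez F_line eval2_simps)
  let ?T = "\<Sum>i\<in>UNIV. eval_poly2.aeval (mp_deriv i F) z * w i"
  have "q\<^sup>2 dvd - (q * ?T)"
    using eval_poly2.aeval_first_order[of q F z w] unfolding FP Fz by simp
  then have "q * q dvd q * ?T" by (simp only: dvd_minus_iff power2_eq_square)
  moreover have "q \<noteq> 0" using deg by (auto simp: q_def)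
  ultimately have "q dvd ?T" by (simp only: dvd_mult_cancel_left) simp
  then have "R dvd ?T" using R(2) dvd_trans by blast
  also have "?T = [:[:0, 1:]:] * subst_form (D - 1) (- G2) (lin 3) (lin 4) + subst_form (D - 1) G1 (lin 3) (lin 4)"
  proof (rule poly_poly_eqI)
    fix X Y
    let ?c = "eval2 (lin 3) X Y" and ?d = "eval2 (lin 4) X Y"
    let ?x = "\<lambda>i. ?c * e 3 $ i + ?d * e 4 $ i"
    have "eval2 ?T X Y = (\<Sum>i\<in>UNIV. mp_eval (mp_deriv i F) ?x * (e 1 $ i - Y * e 2 $ i))"
      unfolding w_def by (simp only: eval2_sum eval2_simps eval2_aeval ez) simp
    also have "\<dots> = hform (D - 1) G1 ?c ?d - Y * hform (D - 1) G2 ?c ?d"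
      unfolding G1(2)[symmetric] G2(2)[symmetric] dF_eval
      by (simp add: algebra_simps sum_subtractf sum_distrib_left)
    also have "\<dots> = Y * hform (D - 1) (- G2) ?c ?d + hform (D - 1) G1 ?c ?d"
      using hform_smult[of "D - 1" "-1" G2 ?c ?d] by simp
    finally show "eval2 ?T X Y = eval2 ([:[:0, 1:]:] * subst_form (D - 1) (- G2) (lin 3) (lin 4) +
        subst_form (D - 1) G1 (lin 3) (lin 4)) X Y"
      by (simp only: eval2_simps eval2_subst_form) simp
  qed
  finally have "- G2 = 0 \<and> G1 = 0"
    using G1(1) G2(1)
    by (intro prime_curve_relation_trivial[OF R(1,3) n' \<open>n' < b\<close> bdl bdl ab nobase]) auto
  then have normal: "mp_eval (dF k) (\<lambda>i. c * e 3 $ i + d * e 4 $ i) = 0" if "k = 1 \<or> k = 2" for k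
    using that G1(2) G2(2) by auto
  have tangent: "mp_eval (dF k) (\<lambda>i. c * e 3 $ i + d * e 4 $ i) = 0" if "k = 3 \<or> k = 4" for k
    unfolding dF_eval
  proof (rule deriv_along_subspace)
    fix x
    show "mp_eval F (\<lambda>i. c * e 3 $ i + d * e 4 $ i + x * e k $ i) = 0"
      using that F_line[of "c + x" d] F_line[of c "d + x"] by (auto simp: algebra_simps)
  qed
  let ?z = "\<lambda>i. c * e 3 $ i + d * e 4 $ i"
  have unit: "(if i = j then 1 else 0) = (\<Sum>k\<in>UNIV. r k $ j * e k $ i)" for i
  proof -
    have "(\<Sum>l\<in>UNIV. r k $ l * (\<chi> l. if l = j then 1 else 0) $ l) = r k $ j" for k
      by (simp add: if_distrib cong: if_cong)
    then show ?thesis using dual[of "\<chi> l. if l = j then 1 else 0" i] by simp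
  qed
  have "mp_eval (mp_deriv j F) ?z = (\<Sum>i\<in>UNIV. mp_eval (mp_deriv i F) ?z * (if i = j then 1 else 0))"
    by (simp add: if_distrib cong: if_cong)
  also have "\<dots> = (\<Sum>k\<in>UNIV. r k $ j * mp_eval (dF k) ?z)"
    unfolding unit dF_eval sum_distrib_left by (subst sum.swap) (simp add: ac_simps)
  also have "\<dots> = 0" by (simp add: sum_4 normal tangent)
  finally show "mp_eval (mp_deriv j F) (\<lambda>i. c * e 3 $ i + d * e 4 $ i) = 0" .
qed


text \<open>The curve \<open>q = 0\<close> has bidegree \<open>(a, b - 1)\<close> with \<open>a > 0\<close>. In the chart \<open>t = 1\<close> its equation has
  degree \<open>0\<close> in \<open>s\<close> only if \<open>q\<close> is \<open>t ^ a\<close> times a form in \<open>u, v\<close>; after exchanging \<open>s\<close> and \<open>t\<close>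
  it then has degree \<open>a\<close>. So one of the two charts satisfies the hypothesis of
  \<open>contact_along_line_chart\<close>.\<close>

theorem contact_along_line:
  fixes f :: "4 \<Rightarrow> 'k::alg_closed_field \<Rightarrow> 'k \<Rightarrow> 'k \<Rightarrow> 'k \<Rightarrow> 'k" and \<alpha> \<beta> :: "'k ^ 4"
  assumes f: "\<And>i. biform a b (f i)" and ab: "a > 0" "b > 1"
    and indep: "\<forall>c :: 'k ^ 4. (\<forall>s t u v. (\<Sum>i\<in>UNIV. c $ i * f i s t u v) = 0) \<longrightarrow> c = 0"
    and bpfree: "\<forall>s t u v. (s, t) \<noteq> (0, 0) \<longrightarrow> (u, v) \<noteq> (0, 0) \<longrightarrow> (\<exists>i. f i s t u v \<noteq> 0)"
    and rel: "\<And>s t u v. (\<Sum>i\<in>UNIV. (\<alpha> $ i * u + \<beta> $ i * v) * f i s t u v) = 0"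
    and nz: "\<alpha> \<noteq> 0 \<or> \<beta> \<noteq> 0"
  shows "\<exists>x y :: 'k ^ 4. (\<forall>c d. c *s x + d *s y = 0 \<longrightarrow> c = 0 \<and> d = 0) \<and>
     (\<forall>c d. (c, d) \<noteq> (0, 0) \<longrightarrow> (\<exists>s t u v \<rho>. (s, t) \<noteq> (0, 0) \<and> (u, v) \<noteq> (0, 0) \<and> \<rho> \<noteq> 0 \<and>
        (\<forall>i. f i s t u v = \<rho> * (c * x $ i + d * y $ i)))) \<and>
     (\<forall>D F. homogeneous D F \<longrightarrow> (\<forall>s t u v. mp_eval F (\<lambda>i. f i s t u v) = 0) \<longrightarrow>
        (\<forall>j c d. mp_eval (mp_deriv j F) (\<lambda>i. c * x $ i + d * y $ i) = 0))"
proof -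
  obtain P where "\<forall>i. bidegree_le a b (P i) \<and> f i = hom_eval a b (P i)"
    using f unfolding biform_def by metis
  then have P: "bidegree_le a b (P i)" "f i = hom_eval a b (P i)" for i by blast+
  define l where "l \<gamma> Q = (\<Sum>i\<in>UNIV. [:[:\<gamma> $ i:]:] * Q i)" for \<gamma> :: "'k ^ 4" and Q :: "4 \<Rightarrow> 'k poly poly"
  have bdl: "bidegree_le a b (l \<gamma> P)" for \<gamma> unfolding l_def by (intro bidegree_le_scalar_sum P)
  have l_eval: "hom_eval a b (l \<gamma> P) s t u v = (\<Sum>i\<in>UNIV. \<gamma> $ i * f i s t u v)" for \<gamma> s t u v
    unfolding l_def P(2) by (rule hom_eval_scalar_sum) (rule P)
  have l_affine: "eval2 (l \<gamma> Q) X Y = (\<Sum>i\<in>UNIV. \<gamma> $ i * eval2 (Q i) X Y)" for \<gamma> Q X Y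
    unfolding l_def by (simp only: eval2_sum eval2_simps) simp
  have l_nonzero: "\<gamma> = 0" if "l \<gamma> P = 0" for \<gamma>
    by (rule indep[rule_format]) (simp flip: l_eval add: that)
  have relA: "[:[:0, 1:]:] * l \<alpha> Q + l \<beta> Q = 0"
    if "\<And>X Y. (\<Sum>i\<in>UNIV. (\<alpha> $ i * Y + \<beta> $ i * 1) * eval2 (Q i) X Y) = 0" for Q
  proof (rule poly_poly_eqI)
    fix X Y
    have "eval2 ([:[:0, 1:]:] * l \<alpha> Q + l \<beta> Q) X Y =
        (\<Sum>i\<in>UNIV. (\<alpha> $ i * Y + \<beta> $ i * 1) * eval2 (Q i) X Y)"
      by (simp only: eval2_simps l_affine)
         (simp add: algebra_simps sum.distrib sum_distrib_left)
    then show "eval2 ([:[:0, 1:]:] * l \<alpha> Q + l \<beta> Q) X Y = eval2 0 X Y"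
      using that by (simp only: eval2_simps)
  qed
  have relP: "[:[:0, 1:]:] * l \<alpha> P + l \<beta> P = 0"
    by (rule relA) (use rel[where t = 1 and v = 1] in \<open>simp add: P(2) hom_eval_affine[OF P(1)]\<close>)
  have "l \<alpha> P \<noteq> 0"
  proof
    assume 0: "l \<alpha> P = 0"
    then have "l \<beta> P = 0" using relP by simp
    then show False using 0 l_nonzero nz by blast
  qed
  have "x = 0 \<and> y = 0" if xy: "x *s \<alpha> + y *s \<beta> = 0" for x y
  proof -
    have "[:[:x, - y:]:] * l \<alpha> P = 0"
    proof (rule poly_poly_eqI)
      fix X Y
      have 1: "Y * eval2 (l \<alpha> P) X Y + eval2 (l \<beta> P) X Y = 0"
        using arg_cong[OF relP, of "\<lambda>A. eval2 A X Y"] by (simp only: eval2_simps) simp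
      have "x * eval2 (l \<alpha> P) X Y + y * eval2 (l \<beta> P) X Y =
          (\<Sum>i\<in>UNIV. (x *s \<alpha> + y *s \<beta>) $ i * eval2 (P i) X Y)"
        by (simp add: l_affine algebra_simps sum.distrib sum_distrib_left)
      also have "\<dots> = 0" unfolding xy by simp
      finally have 2: "x * eval2 (l \<alpha> P) X Y + y * eval2 (l \<beta> P) X Y = 0" .
      have "eval2 ([:[:x, - y:]:] * l \<alpha> P) X Y = (x * eval2 (l \<alpha> P) X Y + y * eval2 (l \<beta> P) X Y)
          - y * (Y * eval2 (l \<alpha> P) X Y + eval2 (l \<beta> P) X Y)"
        by (simp only: eval2_simps) (simp add: algebra_simps)
      then show "eval2 ([:[:x, - y:]:] * l \<alpha> P) X Y = eval2 0 X Y"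
        unfolding 1 2 by (simp only: eval2_simps) simp
    qed
    then have "[:[:x, - y:]:] = (0 :: 'k poly poly)" using \<open>l \<alpha> P \<noteq> 0\<close> by (simp only: mult_eq_0_iff) simp
    then show ?thesis by simp
  qed
  then have "\<forall>x y. x *s \<alpha> + y *s \<beta> = 0 \<longrightarrow> x = 0 \<and> y = 0" by blast
  from dual_bases_extending_pair[OF this] obtain r e :: "4 \<Rightarrow> 'k ^ 4" where r: "r 1 = \<alpha>" "r 2 = \<beta>"
    and dual': "\<forall>p i. p $ i = (\<Sum>j\<in>UNIV. (\<Sum>l\<in>UNIV. r j $ l * p $ l) * e j $ i)"
    and orth': "\<forall>j k. (\<Sum>l\<in>UNIV. r j $ l * e k $ l) = (if j = k then 1 else 0)"
    by (elim exE conjE)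
  note dual = dual'[rule_format] and orth = orth'[rule_format]
  have indep34: "c = 0 \<and> d = 0" if "c *s e 3 + d *s e 4 = 0" for c d
  proof -
    have "c * (\<Sum>l\<in>UNIV. r j $ l * e 3 $ l) + d * (\<Sum>l\<in>UNIV. r j $ l * e 4 $ l) =
       (\<Sum>l\<in>UNIV. r j $ l * (c *s e 3 + d *s e 4) $ l)" for j
      by (simp add: sum_distrib_left sum.distrib algebra_simps)
    from this[of 3] this[of 4] show ?thesis unfolding that orth by simp
  qed
  then have indep34': "\<forall>c d. c *s e 3 + d *s e 4 = 0 \<longrightarrow> c = 0 \<and> d = 0" by blast
  have chart: "(\<forall>c d. (c, d) \<noteq> (0, 0) \<longrightarrow> (\<exists>s t u v \<rho>. (s, t) \<noteq> (0, 0) \<and> (u, v) \<noteq> (0, 0) \<and> \<rho> \<noteq> 0 \<and>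
        (\<forall>i. hom_eval a b (Q i) s t u v = \<rho> * (c * e 3 $ i + d * e 4 $ i)))) \<and>
     (\<forall>D F. homogeneous D F \<longrightarrow> (\<forall>s t u v. mp_eval F (\<lambda>i. hom_eval a b (Q i) s t u v) = 0) \<longrightarrow>
        (\<forall>j c d. mp_eval (mp_deriv j F) (\<lambda>i. c * e 3 $ i + d * e 4 $ i) = 0))"
    if Q: "\<And>i. bidegree_le a b (Q i)" and relQ: "[:[:0, 1:]:] * l \<alpha> Q + l \<beta> Q = 0"
      and deg: "degree (l \<alpha> Q) > 0"
      and bpfQ: "\<forall>s t u v. (s, t) \<noteq> (0, 0) \<longrightarrow> (u, v) \<noteq> (0, 0) \<longrightarrow>
        (\<exists>i. hom_eval a b (Q i) s t u v \<noteq> 0)" for Q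
  proof (intro conjI allI impI)
    note core = contact_along_line_chart[where P = Q and r = r, OF Q ab dual, unfolded r, folded l_def, OF relQ deg bpfQ]
    show "\<exists>s t u v \<rho>. (s, t) \<noteq> (0, 0) \<and> (u, v) \<noteq> (0, 0) \<and> \<rho> \<noteq> 0 \<and>
        (\<forall>i. hom_eval a b (Q i) s t u v = \<rho> * (c * e 3 $ i + d * e 4 $ i))"
      if "(c, d) \<noteq> (0, 0)" for c d
      using core(1)[OF that] .
    show "mp_eval (mp_deriv j F) (\<lambda>i. c * e 3 $ i + d * e 4 $ i) = 0"
      if "homogeneous D F" "\<forall>s t u v. mp_eval F (\<lambda>i. hom_eval a b (Q i) s t u v) = 0" for D F j c d
    proof (rule core(2))
      show "homogeneous D F" by fact
      show "mp_eval F (\<lambda>i. eval2 (Q i) X Y) = 0" for X Y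
        using that(2) by (simp flip: hom_eval_affine[OF Q])
    qed
  qed
  show ?thesis
  proof (cases "degree (l \<alpha> P) > 0")
    case True
    have bpfP: "\<forall>s t u v. (s, t) \<noteq> (0, 0) \<longrightarrow> (u, v) \<noteq> (0, 0) \<longrightarrow>
        (\<exists>i. hom_eval a b (P i) s t u v \<noteq> 0)"
      using bpfree unfolding P(2) .
    note ch = chart[OF P(1) relP True bpfP, folded P(2)]
    show ?thesis by (intro exI conjI) (rule indep34', rule ch[THEN conjunct1], rule ch[THEN conjunct2])
  next
    case False
    then obtain c where c: "l \<alpha> P = [:c:]" "c \<noteq> 0"
      using \<open>l \<alpha> P \<noteq> 0\<close> by (metis degree_eq_zeroE gr0I pCons_0_0)
    obtain P' where "\<forall>i. bidegree_le a b (P' i) \<and> (\<lambda>s t u v. f i t s u v) = hom_eval a b (P' i)"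
      using biform_swap_first[OF f] unfolding biform_def by metis
    then have P': "bidegree_le a b (P' i)" "f i t s u v = hom_eval a b (P' i) s t u v" for i s t u v
      by (blast, metis)
    have relP': "[:[:0, 1:]:] * l \<alpha> P' + l \<beta> P' = 0"
      by (rule relA) (use rel[where s = 1 and v = 1] in \<open>simp add: P'(2) hom_eval_affine[OF P'(1)]\<close>)
    have bdc: "bidegree_le 0 b [:c:]" using bdl[of \<alpha>] unfolding c by (simp add: bidegree_le_def)
    have one: "bidegree_le a 0 (1 :: 'k poly poly)" "hom_eval a 0 1 s t u v = t ^ a" for s t u v :: 'k
      using bidegree_le_monom[of 0 a 0 0 "1 :: 'k"] hom_eval_monom[of 0 a 0 0 "1 :: 'k" s t u v]
      by (simp_all add: monom_0 one_pCons)
    have "l \<alpha> P' = monom c a"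
    proof (rule poly_poly_eqI)
      fix X Y
      have "eval2 (l \<alpha> P') X Y = (\<Sum>i\<in>UNIV. \<alpha> $ i * f i 1 X Y 1)"
        by (simp add: l_affine P'(2) hom_eval_affine[OF P'(1)])
      also have "\<dots> = hom_eval (0 + a) (b + 0) ([:c:] * 1) 1 X Y 1"
        using l_eval[of \<alpha> 1 X Y 1] c by simp
      also have "\<dots> = hom_eval 0 b [:c:] 1 X Y 1 * X ^ a"
        by (simp only: hom_eval_mult[OF bdc one(1)] one(2))
      also have "hom_eval 0 b [:c:] 1 X Y 1 = hom_eval 0 b [:c:] X 1 Y 1" by (simp add: hom_eval_def)
      also have "\<dots> = poly c Y" by (simp add: hom_eval_affine[OF bdc])
      finally show "eval2 (l \<alpha> P') X Y = eval2 (monom c a) X Y"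
        by (simp add: eval2_def poly_monom poly_power)
    qed
    then have deg': "degree (l \<alpha> P') > 0" using c ab by (simp add: degree_monom_eq)
    have bpfP': "\<forall>s t u v. (s, t) \<noteq> (0, 0) \<longrightarrow> (u, v) \<noteq> (0, 0) \<longrightarrow>
        (\<exists>i. hom_eval a b (P' i) s t u v \<noteq> 0)"
      using bpfree unfolding P'(2)[symmetric] by auto
    note ch = chart[OF P'(1) relP' deg' bpfP', folded P'(2)]
    have on_line: "\<exists>s t u v \<rho>. (s, t) \<noteq> (0, 0) \<and> (u, v) \<noteq> (0, 0) \<and> \<rho> \<noteq> 0 \<and>
        (\<forall>i. f i s t u v = \<rho> * (c * e 3 $ i + d * e 4 $ i))" if cd: "(c, d) \<noteq> (0, 0)" for c d
    proof -
      from ch[THEN conjunct1, rule_format, OF cd]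
      obtain s t u v \<rho> where *: "(s, t) \<noteq> (0, 0)" "(u, v) \<noteq> (0, 0)" "\<rho> \<noteq> 0"
        "\<forall>i. f i t s u v = \<rho> * (c * e 3 $ i + d * e 4 $ i)" by (elim exE conjE)
      moreover have "(t, s) \<noteq> (0, 0)" using *(1) by auto
      ultimately show ?thesis by (intro exI conjI)
    qed
    have flat: "mp_eval (mp_deriv j F) (\<lambda>i. c * e 3 $ i + d * e 4 $ i) = 0"
      if "homogeneous D F" "\<forall>s t u v. mp_eval F (\<lambda>i. f i s t u v) = 0" for D F j c d
      by (rule ch[THEN conjunct2, rule_format, OF that(1)]) (use that(2) in simp)
    show ?thesis
      by (rule exI[of _ "e 3"], rule exI[of _ "e 4"], rule conjI, rule indep34', rule conjI,
          intro allI impI, rule on_line, assumption, intro allI impI, rule flat, assumption+)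
  qed
qed

section \<open>Dimension of the image\<close>

lemma more_unknowns_than_equations:
  fixes A :: "'i \<Rightarrow> 'j \<Rightarrow> 'k::field"
  assumes "finite J" "finite I" "card J < card I"
  shows "\<exists>c. (\<exists>i\<in>I. c i \<noteq> 0) \<and> (\<forall>j\<in>J. (\<Sum>i\<in>I. c i * A i j) = 0)"
  using assms
proof (induction J arbitrary: I A rule: finite_induct)
  case empty
  then obtain i where "i \<in> I" by fastforce
  then show ?case by (intro exI[of _ "\<lambda>_. 1"]) auto
next
  case (insert j J)
  show ?case
  proof (cases "\<forall>i\<in>I. A i j = 0")
    case True
    obtain c where "\<exists>i\<in>I. c i \<noteq> 0" "\<forall>j\<in>J. (\<Sum>i\<in>I. c i * A i j) = 0"
      using insert.IH[of I A] insert.prems insert.hyps by auto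
    then show ?thesis using True by (intro exI[of _ c]) simp
  next
    case False
    then obtain i0 where i0: "i0 \<in> I" "A i0 j \<noteq> 0" by blast
    have "card J < card (I - {i0})" using insert.prems insert.hyps i0 by simp
    from insert.IH[OF _ this, of "\<lambda>i k. A i k - A i j / A i0 j * A i0 k"] insert.prems
    obtain c where c: "\<exists>i\<in>I - {i0}. c i \<noteq> 0"
      "\<And>k. k \<in> J \<Longrightarrow> (\<Sum>i\<in>I - {i0}. c i * (A i k - A i j / A i0 j * A i0 k)) = 0" by auto
    define x where "x = - (\<Sum>i\<in>I - {i0}. c i * (A i j / A i0 j))"
    define c' where "c' i = (if i = i0 then x else c i)" for i
    have split: "(\<Sum>i\<in>I. c' i * A i k) = (\<Sum>i\<in>I - {i0}. c i * A i k) + x * A i0 k" for k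
    proof -
      have "(\<Sum>i\<in>I. c' i * A i k) = c' i0 * A i0 k + (\<Sum>i\<in>I - {i0}. c' i * A i k)"
        using insert.prems i0 by (simp add: sum.remove)
      also have "(\<Sum>i\<in>I - {i0}. c' i * A i k) = (\<Sum>i\<in>I - {i0}. c i * A i k)"
        by (intro sum.cong) (auto simp: c'_def)
      finally show ?thesis by (simp add: c'_def)
    qed
    have "(\<Sum>i\<in>I. c' i * A i k) = (\<Sum>i\<in>I - {i0}. c i * (A i k - A i j / A i0 j * A i0 k))" for k
      unfolding split x_def
      by (simp add: right_diff_distrib sum_subtractf sum_distrib_right mult.assoc)
    moreover have "(\<Sum>i\<in>I - {i0}. c i * (A i j - A i j / A i0 j * A i0 j)) = 0" using i0 by simp
    moreover have "\<exists>i\<in>I. c' i \<noteq> 0" using c(1) by (auto simp: c'_def)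
    ultimately show ?thesis using c(2) by (intro exI[of _ c']) auto
  qed
qed

lemma biforms_linear_dependence:
  fixes g :: "'i \<Rightarrow> 'k::field \<Rightarrow> 'k \<Rightarrow> 'k \<Rightarrow> 'k \<Rightarrow> 'k"
  assumes "finite I" and g: "\<And>i. i \<in> I \<Longrightarrow> biform m n (g i)" and card: "(m + 1) * (n + 1) < card I"
  shows "\<exists>c. (\<exists>i\<in>I. c i \<noteq> 0) \<and> (\<forall>s t u v. (\<Sum>i\<in>I. c i * g i s t u v) = 0)"
proof -
  obtain P where P: "\<And>i. i \<in> I \<Longrightarrow> g i = hom_eval m n (P i)"
    using g unfolding biform_def by metis
  have "card ({..m} \<times> {..n}) < card I" using card by simp
  from more_unknowns_than_equations[OF _ \<open>finite I\<close> this, of "\<lambda>i (j, k). coeff (coeff (P i) j) k"]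
  obtain c where c: "\<exists>i\<in>I. c i \<noteq> 0"
    "\<And>j k. j \<le> m \<Longrightarrow> k \<le> n \<Longrightarrow> (\<Sum>i\<in>I. c i * coeff (coeff (P i) j) k) = 0" by auto
  have "(\<Sum>i\<in>I. c i * g i s t u v) = 0" for s t u v
  proof -
    have "(\<Sum>i\<in>I. c i * g i s t u v) = (\<Sum>i\<in>I. \<Sum>j\<le>m. \<Sum>k\<le>n.
       c i * coeff (coeff (P i) j) k * ((s ^ j * t ^ (m - j)) * (u ^ k * v ^ (n - k))))"
      by (intro sum.cong refl) (simp add: P hom_eval_def sum_distrib_left mult.assoc)
    also have "\<dots> = (\<Sum>j\<le>m. \<Sum>i\<in>I. \<Sum>k\<le>n.
       c i * coeff (coeff (P i) j) k * ((s ^ j * t ^ (m - j)) * (u ^ k * v ^ (n - k))))"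
      by (rule sum.swap)
    also have "\<dots> = (\<Sum>j\<le>m. \<Sum>k\<le>n. \<Sum>i\<in>I.
       c i * coeff (coeff (P i) j) k * ((s ^ j * t ^ (m - j)) * (u ^ k * v ^ (n - k))))"
      by (intro sum.cong refl sum.swap)
    also have "\<dots> = 0" unfolding sum_distrib_right[symmetric] by (simp add: c(2))
    finally show ?thesis .
  qed
  then show ?thesis using c(1) by blast
qed

lemma vanishes_at_span:
  assumes "homogeneous d F"
  shows "vanishes_at F (vec.span {x}) \<longleftrightarrow> mp_eval F (($) x) = 0"
proof
  assume "vanishes_at F (vec.span {x})"
  then show "mp_eval F (($) x) = 0" by (simp add: vanishes_at_def vec.span_base)
next
  assume 0: "mp_eval F (($) x) = 0"
  have "($) (k *s x) = (\<lambda>i. k * x $ i)" for k by auto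
  then have "mp_eval F (($) (k *s x)) = 0" for k by (simp add: mp_eval_scale[OF assms] 0)
  then show "vanishes_at F (vec.span {x})"
    unfolding vanishes_at_def vec.span_singleton by blast
qed

definition vanishes_on :: "('n::finite, 'k::field) mpoly \<Rightarrow> ('k ^ 'n) set set \<Rightarrow> bool" where
  "vanishes_on F Z \<longleftrightarrow> (\<forall>P\<in>Z. vanishes_at F P)"

lemma proj_point_span:
  assumes "P \<in> proj_space"
  shows "\<exists>x. x \<noteq> 0 \<and> P = vec.span {x}"
proof -
  have P: "vec.subspace P" "vec.dim P = 1" using assms by (auto simp: proj_space_def)
  obtain B where B: "B \<subseteq> P" "vec.independent B" "P \<subseteq> vec.span B" "card B = 1"
    using vec.basis_exists[of P] P(2) by metis
  then obtain x where x: "B = {x}" by (auto simp: card_1_singleton_iff)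
  have "P = vec.span {x}"
    using B P(1) x by (metis subset_antisym vec.span_minimal)
  moreover have "x \<noteq> 0" using B(2) x by auto
  ultimately show ?thesis by blast
qed

lemma vanishes_at_mult:
  assumes "P \<in> proj_space" "homogeneous d F" "homogeneous e G"
  shows "vanishes_at (F * G) P \<longleftrightarrow> vanishes_at F P \<or> vanishes_at G P"
proof -
  obtain x where x: "P = vec.span {x}" using proj_point_span[OF assms(1)] by blast
  show ?thesis unfolding x
    using vanishes_at_span[OF homogeneous_mult[OF assms(2,3)]] vanishes_at_span[OF assms(2)]
      vanishes_at_span[OF assms(3)] by (simp add: mp_eval_mult)
qed

text \<open>Homogeneous primality of the ideal of \<open>Z\<close>: if \<open>F G\<close> vanishes on \<open>Z\<close>, then \<open>Z\<close> is the union of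
  its closed subsets \<open>F = 0\<close> and \<open>G = 0\<close>.\<close>

lemma irreducible_closed_prime:
  assumes X: "X \<subseteq> proj_space" and Z: "irreducible_closed_in X Z"
    and F: "homogeneous d F" and G: "homogeneous e G" and FG: "vanishes_on (F * G) Z"
  shows "vanishes_on F Z \<or> vanishes_on G Z"
proof -
  obtain S where S: "S \<subseteq> {F. \<exists>d. homogeneous d F}" "Z = {P \<in> X. \<forall>F\<in>S. vanishes_at F P}"
    using Z by (auto simp: irreducible_closed_in_def closed_in_def)
  define A where "A H = {P \<in> X. \<forall>F\<in>insert H S. vanishes_at F P}" for H
  have closed: "closed_in X (A H)" if "homogeneous c H" for c H
    unfolding closed_in_def A_def using that S(1) by (intro exI[of _ "insert H S"]) auto
  have "Z = A F \<union> A G"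
  proof
    show "Z \<subseteq> A F \<union> A G"
    proof
      fix P assume P: "P \<in> Z"
      then have "P \<in> proj_space" using S(2) X by auto
      moreover have "vanishes_at (F * G) P" using P FG by (simp add: vanishes_on_def)
      ultimately have "vanishes_at F P \<or> vanishes_at G P" using vanishes_at_mult[OF _ F G] by blast
      then show "P \<in> A F \<union> A G" using P S(2) by (auto simp: A_def)
    qed
  qed (auto simp: S(2) A_def)
  then have "Z = A F \<or> Z = A G"
    using Z closed[OF F] closed[OF G] by (auto simp: irreducible_closed_in_def)
  then show ?thesis by (auto simp: A_def vanishes_on_def)
qed

lemma irreducible_closed_power:
  assumes X: "X \<subseteq> proj_space" and Z: "irreducible_closed_in X Z" and F: "homogeneous d F"
    and "vanishes_on (F ^ k) Z"
  shows "vanishes_on F Z"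
  using assms(4)
proof (induction k)
  case 0
  obtain P where P: "P \<in> Z" "P \<in> X" using Z by (auto simp: irreducible_closed_in_def closed_in_def)
  then obtain x where "P = vec.span {x}" using X proj_point_span by blast
  then have "x \<in> P" by (simp add: vec.span_base)
  then have "mp_eval 1 (($) x) = (0 :: 'a)" using 0 P(1) by (simp add: vanishes_on_def vanishes_at_def)
  then show ?case using mp_eval_single[of 0 1 "($) x"] by simp
next
  case (Suc k)
  then show ?case
    using irreducible_closed_prime[OF X Z F homogeneous_power[OF F]] by auto
qed

lemma separating_form:
  assumes "closed_in X Z" "Z \<subset> Z'" "Z' \<subseteq> X"
  shows "\<exists>d F. homogeneous d F \<and> vanishes_on F Z \<and> \<not> vanishes_on F Z'"
proof -
  obtain S where S: "S \<subseteq> {F. \<exists>d. homogeneous d F}" "Z = {P \<in> X. \<forall>F\<in>S. vanishes_at F P}"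
    using assms(1) by (auto simp: closed_in_def)
  obtain Q where "Q \<in> Z'" "Q \<notin> Z" using assms(2) by blast
  then obtain F where "F \<in> S" "\<not> vanishes_at F Q" using S(2) assms(3) by auto
  then show ?thesis using S \<open>Q \<in> Z'\<close> unfolding vanishes_on_def by blast
qed

text \<open>One step of an algebraic relation down a chain of irreducible sets. A polynomial relation in \<open>H\<close> on
  \<open>Z\<close> can be divided by the lowest power of \<open>H\<close> in it, as \<open>H\<close> is not zero on \<open>Z\<close>; on \<open>Z'\<close>, where
  \<open>H = 0\<close>, only its lowest coefficient \<open>L k\<close> survives.\<close>

lemma lowest_coefficient_vanishes:
  assumes X: "X \<subseteq> proj_space" and Z: "irreducible_closed_in X Z" and sub: "Z' \<subseteq> Z"
    and H: "homogeneous D H" "vanishes_on H Z'" "\<not> vanishes_on H Z"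
    and L: "\<And>i. i \<le> N \<Longrightarrow> homogeneous (E - i * D) (L i)" and E: "N * D \<le> E"
    and sum: "vanishes_on (\<Sum>i\<le>N. H ^ i * L i) Z"
    and k: "k \<le> N" "\<And>i. i < k \<Longrightarrow> L i = 0"
  shows "vanishes_on (L k) Z'"
proof -
  define R where "R = (\<Sum>i\<in>{k..N}. H ^ (i - k) * L i)"
  have iE: "i * D \<le> E" if "i \<le> N" for i using that E by (meson le_trans mult_le_mono1)
  have "homogeneous (E - k * D) R"
    unfolding R_def
  proof (rule homogeneous_sum)
    fix i assume i: "i \<in> {k..N}"
    then have "i * D = (i - k) * D + k * D" by (simp flip: add_mult_distrib)
    then have "(i - k) * D + (E - i * D) = E - k * D" using iE[of i] i by simp
    then show "homogeneous (E - k * D) (H ^ (i - k) * L i)"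
      using homogeneous_mult[OF homogeneous_power[OF H(1), of "i - k"] L[of i]] i by simp
  qed
  moreover have "(\<Sum>i\<le>N. H ^ i * L i) = H ^ k * R"
  proof -
    have "(\<Sum>i\<le>N. H ^ i * L i) = (\<Sum>i\<in>{k..N}. H ^ i * L i)"
      by (rule sum.mono_neutral_right) (use k(2) in \<open>auto simp: not_le\<close>)
    also have "\<dots> = (\<Sum>i\<in>{k..N}. H ^ k * (H ^ (i - k) * L i))"
      by (intro sum.cong refl) (simp flip: mult.assoc power_add)
    finally show ?thesis by (simp add: R_def sum_distrib_left)
  qed
  ultimately have "vanishes_on (H ^ k) Z \<or> vanishes_on R Z"
    using irreducible_closed_prime[OF X Z homogeneous_power[OF H(1)]] sum by metis
  then have R: "vanishes_on R Z" using irreducible_closed_power[OF X Z H(1)] H(3) by blast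
  show ?thesis
    unfolding vanishes_on_def vanishes_at_def
  proof (intro ballI)
    fix P x assume P: "P \<in> Z'" "x \<in> P"
    then have "mp_eval H (($) x) = 0" "mp_eval R (($) x) = 0"
      using H(2) R sub by (auto simp: vanishes_on_def vanishes_at_def)
    moreover have "mp_eval R (($) x) = (\<Sum>i\<in>{k..N}. mp_eval H (($) x) ^ (i - k) * mp_eval (L i) (($) x))"
      by (simp add: R_def mp_eval_sum mp_eval_mult mp_eval_power)
    moreover have "(\<Sum>i\<in>{k..N}. 0 ^ (i - k) * mp_eval (L i) (($) x)) =
        (\<Sum>i\<in>{k..N}. if i = k then mp_eval (L k) (($) x) else 0)"
      by (intro sum.cong refl) (auto simp: power_0_left)
    ultimately have "(\<Sum>i\<in>{k..N}. if i = k then mp_eval (L k) (($) x) else 0) = 0" by simp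
    then show "mp_eval (L k) (($) x) = 0" using k(1) by simp
  qed
qed


text \<open>Choose forms \<open>H i\<close> that vanish on \<open>Z i\<close> but not on \<open>Z (i + 1)\<close>, and \<open>H0\<close> that does not vanish at
  a point of \<open>Z 0\<close>; by passing to powers, all have one degree \<open>D\<close>. Pulled back, the \<open>(N + 1) ^ 3\<close>
  monomials \<open>M i j l\<close> lie in a space of dimension \<open>(3 N D a + 1) (3 N D b + 1)\<close>, which is smaller
  for large \<open>N\<close>. So they are linearly dependent on \<open>X\<close>, and descending the chain isolates a nonzero
  multiple of a power of \<open>H0\<close> that vanishes on \<open>Z 0\<close>, a contradiction.\<close>

lemma no_chain_of_length_three:
  fixes X :: "('k::alg_closed_field ^ 'n::finite) set set"
  assumes f: "\<And>i. biform a b (f i)" and ab: "a > 0" "b > 0"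
    and X: "X \<subseteq> proj_space" "\<And>P. P \<in> X \<Longrightarrow> \<exists>s t u v. P = vec.span {\<chi> i. f i s t u v}"
    and irr: "\<And>i. i \<le> 3 \<Longrightarrow> irreducible_closed_in X (Z i)"
    and chain: "\<And>i. i < 3 \<Longrightarrow> Z i \<subset> Z (Suc i)"
  shows False
proof -
  have cl: "closed_in X (Z i)" "Z i \<noteq> {}" "Z i \<subseteq> X" if "i \<le> 3" for i
    using irr[OF that] by (auto simp: irreducible_closed_in_def closed_in_def)
  obtain P0 where P0: "P0 \<in> Z 0" using cl(2)[of 0] by auto
  then have P0': "P0 \<in> proj_space" using cl(3)[of 0] X by auto
  then obtain x0 where x0: "x0 \<noteq> 0" "P0 = vec.span {x0}" using proj_point_span by blast
  have "\<exists>i0. x0 $ i0 \<noteq> 0" using x0(1) by (simp add: Finite_Cartesian_Product.vec_eq_iff)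
  then obtain i0 where i0: "x0 $ i0 \<noteq> 0" by blast
  \<comment> \<open>A coordinate function that does not vanish at \<open>P0\<close>.\<close>
  define F0 :: "('n, 'k) mpoly" where "F0 = Poly_Mapping.single (Poly_Mapping.single i0 1) 1"
  have F0: "homogeneous 1 F0" unfolding F0_def
    by (rule homogeneous_single) (simp add: lookup_single when_def)
  have "mp_eval F0 (($) x0) = x0 $ i0"
    by (simp add: F0_def mp_eval_single mono_eval_def lookup_single when_def if_distrib cong: if_cong)
  then have F0_nz: "mp_eval F0 (($) x0) \<noteq> 0" using i0 by simp
  have "\<exists>d F. homogeneous d F \<and> vanishes_on F (Z i) \<and> \<not> vanishes_on F (Z (Suc i))" if "i < 3" for i
    using separating_form[of X "Z i" "Z (Suc i)"] cl[of i] cl[of "Suc i"] chain[OF that] that by simp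
  then obtain d F where F: "\<And>i. i < 3 \<Longrightarrow> homogeneous (d i) (F i)"
    "\<And>i. i < 3 \<Longrightarrow> vanishes_on (F i) (Z i)" "\<And>i. i < 3 \<Longrightarrow> \<not> vanishes_on (F i) (Z (Suc i))" by metis
  have Z0: "P0 \<in> Z i" if "i \<le> 3" for i using that
  proof (induction i)
    case (Suc i)
    then show ?case using chain[of i] by auto
  qed (rule P0)
  have d: "d i > 0" if "i < 3" for i
  proof (rule ccontr)
    assume "\<not> d i > 0"
    then have const: "homogeneous 0 (F i)" using F(1)[OF that] by simp
    have "mp_eval (F i) x = mp_eval (F i) (\<lambda>_. 0)" for x
      using mp_eval_scale[OF const, of 0 x] by simp
    moreover have "vanishes_at (F i) P0" using F(2)[OF that] Z0[of i] that by (simp add: vanishes_on_def)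
    then have "mp_eval (F i) (($) x0) = 0" using vanishes_at_span[OF const] x0 by simp
    ultimately have "mp_eval (F i) x = 0" for x by metis
    then show False using F(3)[OF that] by (simp add: vanishes_on_def vanishes_at_def)
  qed
  define D where "D = d 0 * d 1 * d 2"
  have D: "D > 0" using d[of 0] d[of 1] d[of 2] by (simp add: D_def)
  define H where "H i = F i ^ (D div d i)" for i
  have H: "homogeneous D (H i)" "vanishes_on (H i) (Z i)" "\<not> vanishes_on (H i) (Z (Suc i))" if i: "i < 3" for i
  proof -
    have "i = 0 \<or> i = 1 \<or> i = 2" using i by auto
    then have dvd: "D div d i * d i = D" "D div d i > 0"
      using d[of 0] d[of 1] d[of 2] by (auto simp: D_def)
    show "homogeneous D (H i)" using homogeneous_power[OF F(1)[OF i], of "D div d i"] dvd(1) by (simp add: H_def)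
    show "vanishes_on (H i) (Z i)" using F(2)[OF i] dvd(2)
      by (auto simp: H_def vanishes_on_def vanishes_at_def mp_eval_power)
    show "\<not> vanishes_on (H i) (Z (Suc i))"
      using irreducible_closed_power[OF X(1) irr[of "Suc i"] F(1)[OF i]] F(3)[OF i] i by (auto simp: H_def)
  qed
  define H0 where "H0 = F0 ^ D"
  have H0: "homogeneous D H0" using homogeneous_power[OF F0, of D] by (simp add: H0_def)
  have H0_nz: "mp_eval H0 (($) x0) \<noteq> 0" using F0_nz by (simp add: H0_def mp_eval_power)
  \<comment> \<open>With \<open>A = 3 D a\<close> and \<open>B = 3 D b\<close> the dimension of the target is at most \<open>(N + 1)\<^sup>2 A B\<close>, and the
  number of monomials is \<open>(N + 1) ^ 3\<close>; so \<open>N = A B\<close> suffices.\<close>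
  define N where "N = (3 * D * a) * (3 * D * b)"
  define M where "M i j l = H0 ^ (3 * N - i - j - l) * H 0 ^ i * H 1 ^ j * H 2 ^ l" for i j l
  have homM: "homogeneous (3 * N * D) (M i j l)" if "i \<le> N" "j \<le> N" "l \<le> N" for i j l
  proof -
    have "homogeneous ((3 * N - i - j - l) * D + i * D + j * D + l * D) (M i j l)"
      unfolding M_def by (intro homogeneous_mult homogeneous_power H H0) simp_all
    moreover have "(3 * N - i - j - l) * D + i * D + j * D + l * D = (3 * N - i - j - l + i + j + l) * D"
      by (simp only: add_mult_distrib)
    ultimately show ?thesis using that by simp
  qed
  let ?I = "{..N} \<times> {..N} \<times> {..N}"
  have biform_M: "biform (3 * N * D * a) (3 * N * D * b) (\<lambda>s t u v. mp_eval (M i j l) (\<lambda>n. f n s t u v))"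
    if "i \<le> N" "j \<le> N" "l \<le> N" for i j l
    by (rule biform_mp_eval[OF homM[OF that] f])
  have "card ?I = (N + 1) * ((N + 1) * (N + 1))" by simp
  have "(3 * N * D * a + 1) * (3 * N * D * b + 1) < card ?I"
  proof -
    define A where "A = 3 * D * a"
    define B where "B = 3 * D * b"
    have AB: "A > 0" "B > 0" using D ab by (simp_all add: A_def B_def)
    have "3 * N * D * a + 1 \<le> (N + 1) * A" "3 * N * D * b + 1 \<le> (N + 1) * B"
      using AB by (simp_all add: A_def B_def)
    then have "(3 * N * D * a + 1) * (3 * N * D * b + 1) \<le> ((N + 1) * A) * ((N + 1) * B)" by (rule mult_le_mono)
    also have "\<dots> = (N + 1) * (N + 1) * (A * B)" by (simp only: mult_ac)
    also have "A * B = N" by (simp only: N_def A_def B_def)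
    also have "(N + 1) * (N + 1) * N < card ?I" by simp
    finally show ?thesis .
  qed
  then have "\<exists>c. (\<exists>x\<in>?I. c x \<noteq> 0) \<and>
      (\<forall>s t u v. (\<Sum>x\<in>?I. c x * (case x of (i, j, l) \<Rightarrow> mp_eval (M i j l) (\<lambda>n. f n s t u v))) = 0)"
    using biform_M
    by (intro biforms_linear_dependence[of ?I "3 * N * D * a" "3 * N * D * b"]) auto
  then obtain c where c: "\<exists>x\<in>?I. c x \<noteq> 0"
    "\<And>s t u v. (\<Sum>x\<in>?I. c x * (case x of (i, j, l) \<Rightarrow> mp_eval (M i j l) (\<lambda>n. f n s t u v))) = 0"
    by blast
  define k where "k i j l = Poly_Mapping.single (0 :: 'n \<Rightarrow>\<^sub>0 nat) (c (i, j, l))" for i j l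
  define L1 where "L1 i j l = k i j l * H0 ^ (3 * N - i - j - l)" for i j l
  define L2 where "L2 j l = (\<Sum>i\<le>N. H 0 ^ i * L1 i j l)" for j l
  define L3 where "L3 l = (\<Sum>j\<le>N. H 1 ^ j * L2 j l)" for l
  have k: "homogeneous 0 (k i j l)" for i j l unfolding k_def by (rule homogeneous_single) simp
  have L1: "homogeneous (((3 * N - j - l) * D) - i * D) (L1 i j l)" for i j l
  proof -
    have "homogeneous (0 + (3 * N - i - j - l) * D) (L1 i j l)"
      unfolding L1_def by (intro homogeneous_mult homogeneous_power k H0)
    moreover have "3 * N - i - j - l = 3 * N - j - l - i" by simp
    ultimately show ?thesis by (simp only: diff_mult_distrib add_0)
  qed
  have L2: "homogeneous (((3 * N - l) * D) - j * D) (L2 j l)" if "j \<le> N" "l \<le> N" for j l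
    unfolding L2_def
  proof (rule homogeneous_sum)
    fix i assume "i \<in> {..N}"
    then have "i + (3 * N - j - l - i) = 3 * N - l - j" using that by simp
    then have "i * D + ((3 * N - j - l) * D - i * D) = (3 * N - l) * D - j * D"
      by (simp only: diff_mult_distrib[symmetric] add_mult_distrib[symmetric])
    then show "homogeneous ((3 * N - l) * D - j * D) (H 0 ^ i * L1 i j l)"
      using homogeneous_mult[OF homogeneous_power[OF H(1)[of 0], of i] L1[of j l i]] by simp
  qed
  have L3: "homogeneous (3 * N * D - l * D) (L3 l)" if "l \<le> N" for l
    unfolding L3_def
  proof (rule homogeneous_sum)
    fix j assume "j \<in> {..N}"
    then have j: "j \<le> N" and "j + (3 * N - l - j) = 3 * N - l" using that by simp_all
    then have "j * D + ((3 * N - l) * D - j * D) = 3 * N * D - l * D"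
      by (simp only: diff_mult_distrib[symmetric] add_mult_distrib[symmetric])
    then show "homogeneous (3 * N * D - l * D) (H 1 ^ j * L2 j l)"
      using homogeneous_mult[OF homogeneous_power[OF H(1)[of 1], of j] L2[OF j that]] by simp
  qed
  have total: "vanishes_on (\<Sum>l\<le>N. H 2 ^ l * L3 l) (Z 3)"
    unfolding vanishes_on_def
  proof
    fix P assume "P \<in> Z 3"
    then obtain s t u v where P: "P = vec.span {\<chi> i. f i s t u v}" using X(2) cl(3)[of 3] by blast
    have hom: "homogeneous (3 * N * D) (\<Sum>l\<le>N. H 2 ^ l * L3 l)"
    proof (rule homogeneous_sum)
      fix l assume "l \<in> {..N}"
      then have l: "l \<le> N" and "l + (3 * N - l) = 3 * N" by simp_all
      then have "l * D + (3 * N * D - l * D) = 3 * N * D"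
        by (simp only: diff_mult_distrib[symmetric] add_mult_distrib[symmetric])
      then show "homogeneous (3 * N * D) (H 2 ^ l * L3 l)"
        using homogeneous_mult[OF homogeneous_power[OF H(1)[of 2], of l] L3[OF l]] by simp
    qed
    let ?e = "\<lambda>G. mp_eval G (\<lambda>n. f n s t u v)"
    have "?e (\<Sum>l\<le>N. H 2 ^ l * L3 l) = (\<Sum>l\<le>N. \<Sum>j\<le>N. \<Sum>i\<le>N. c (i, j, l) * ?e (M i j l))"
      unfolding L3_def L2_def L1_def k_def M_def
      by (simp add: mp_eval_sum mp_eval_mult mp_eval_power mp_eval_single sum_distrib_left ac_simps)
    also have "\<dots> = (\<Sum>l\<le>N. \<Sum>i\<le>N. \<Sum>j\<le>N. c (i, j, l) * ?e (M i j l))"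
      by (intro sum.cong refl sum.swap)
    also have "\<dots> = (\<Sum>i\<le>N. \<Sum>l\<le>N. \<Sum>j\<le>N. c (i, j, l) * ?e (M i j l))"
      by (rule sum.swap)
    also have "\<dots> = (\<Sum>i\<le>N. \<Sum>j\<le>N. \<Sum>l\<le>N. c (i, j, l) * ?e (M i j l))"
      by (intro sum.cong refl sum.swap)
    also have "\<dots> = (\<Sum>x\<in>?I. c x * (case x of (i, j, l) \<Rightarrow> ?e (M i j l)))"
      by (simp add: sum.cartesian_product case_prod_beta)
    also have "\<dots> = 0" by (rule c(2))
    finally have "?e (\<Sum>l\<le>N. H 2 ^ l * L3 l) = 0" .
    moreover have "($) (\<chi> i. f i s t u v) = (\<lambda>n. f n s t u v)" by auto
    ultimately show "vanishes_at (\<Sum>l\<le>N. H 2 ^ l * L3 l) P"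
      unfolding P vanishes_at_span[OF hom] by simp
  qed
  have "\<exists>l. l \<le> N \<and> (\<exists>j\<le>N. \<exists>i\<le>N. c (i, j, l) \<noteq> 0)" using c(1) by auto
  \<comment> \<open>The exponents \<open>l\<close>, \<open>j\<close>, \<open>i\<close> are chosen least, one after the other, because each descent keeps only
  the terms with the lowest exponent.\<close>
  from exists_least_iff[THEN iffD1, OF this] obtain l
    where l: "l \<le> N" "\<exists>j\<le>N. \<exists>i\<le>N. c (i, j, l) \<noteq> 0"
      and "\<forall>l'<l. \<not> (l' \<le> N \<and> (\<exists>j\<le>N. \<exists>i\<le>N. c (i, j, l') \<noteq> 0))" by blast
  then have l_min: "c (i, j, l') = 0" if "l' < l" "j \<le> N" "i \<le> N" for i j l'
    using that l(1) by (meson le_trans less_imp_le)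
  have "\<exists>j. j \<le> N \<and> (\<exists>i\<le>N. c (i, j, l) \<noteq> 0)" using l(2) by blast
  from exists_least_iff[THEN iffD1, OF this] obtain j
    where j: "j \<le> N" "\<exists>i\<le>N. c (i, j, l) \<noteq> 0"
      and "\<forall>j'<j. \<not> (j' \<le> N \<and> (\<exists>i\<le>N. c (i, j', l) \<noteq> 0))" by blast
  then have j_min: "c (i, j', l) = 0" if "j' < j" "i \<le> N" for i j'
    using that j(1) by (meson le_trans less_imp_le)
  have "\<exists>i. i \<le> N \<and> c (i, j, l) \<noteq> 0" using j(2) by blast
  from exists_least_iff[THEN iffD1, OF this] obtain i
    where i: "i \<le> N" "c (i, j, l) \<noteq> 0"
      and "\<forall>i'<i. \<not> (i' \<le> N \<and> c (i', j, l) \<noteq> 0)" by blast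
  then have i_min: "c (i', j, l) = 0" if "i' < i" for i'
    using that i(1) by (meson le_trans less_imp_le)
  have sub: "Z 2 \<subseteq> Z 3" "Z 1 \<subseteq> Z 2" "Z 0 \<subseteq> Z 1"
    using chain[of 0] chain[of 1] chain[of 2] by (auto simp: numeral_2_eq_2 numeral_3_eq_3)
  have not_on: "\<not> vanishes_on (H 2) (Z 3)" "\<not> vanishes_on (H 1) (Z 2)" "\<not> vanishes_on (H 0) (Z 1)"
    using H(3)[of 0] H(3)[of 1] H(3)[of 2] by (simp_all add: numeral_2_eq_2 numeral_3_eq_3)
  have "vanishes_on (L3 l) (Z 2)"
  proof (rule lowest_coefficient_vanishes[OF X(1) irr sub(1) H(1,2) not_on(1) L3 _ total l(1)])
    show "L3 l' = 0" if "l' < l" for l'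
      using l_min[OF that] by (simp add: L3_def L2_def L1_def k_def)
  qed simp_all
  then have sum2: "vanishes_on (\<Sum>j\<le>N. H 1 ^ j * L2 j l) (Z 2)" by (simp add: L3_def)
  have "vanishes_on (L2 j l) (Z 1)"
  proof (rule lowest_coefficient_vanishes[OF X(1) irr sub(2) H(1,2) not_on(2) L2[OF _ l(1)] _ sum2 j(1)])
    show "L2 j' l = 0" if "j' < j" for j'
      using j_min[OF that] by (simp add: L2_def L1_def k_def)
    show "N * D \<le> (3 * N - l) * D" using l(1) by (intro mult_le_mono1) simp
  qed simp_all
  then have sum1: "vanishes_on (\<Sum>i\<le>N. H 0 ^ i * L1 i j l) (Z 1)" by (simp add: L2_def)
  have "vanishes_on (L1 i j l) (Z 0)"
  proof (rule lowest_coefficient_vanishes[OF X(1) irr sub(3) H(1,2) not_on(3) L1 _ sum1 i(1)])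
    show "L1 i' j l = 0" if "i' < i" for i'
      using i_min[OF that] by (simp add: L1_def k_def)
    show "N * D \<le> (3 * N - j - l) * D" using l(1) j(1) by (intro mult_le_mono1) simp
  qed simp_all
  then have "mp_eval (L1 i j l) (($) x0) = 0"
    using P0 x0(2) by (simp add: vanishes_on_def vanishes_at_def vec.span_base)
  then show False
    using i(2) H0_nz by (simp add: L1_def k_def mp_eval_mult mp_eval_single mp_eval_power)
qed

lemma dim_at_le_two:
  fixes X :: "('k::alg_closed_field ^ 'n::finite) set set"
  assumes "\<And>i. biform a b (f i)" "a > 0" "b > 0" "X \<subseteq> proj_space"
    "\<And>P. P \<in> X \<Longrightarrow> \<exists>s t u v. P = vec.span {\<chi> i. f i s t u v}"
  shows "dim_at X P \<le> 2"
  unfolding dim_at_def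
proof (rule Sup_least)
  fix m assume "m \<in> {enat n |n. \<exists>Z. (\<forall>i\<le>n. irreducible_closed_in X (Z i) \<and> P \<in> Z i) \<and> (\<forall>i<n. Z i \<subset> Z (Suc i))}"
  then obtain n Z where m: "m = enat n" and Z: "\<forall>i\<le>n. irreducible_closed_in X (Z i) \<and> P \<in> Z i"
    "\<forall>i<n. Z i \<subset> Z (Suc i)" by blast
  have "n \<le> 2"
  proof (rule ccontr)
    assume "\<not> n \<le> 2"
    then show False using no_chain_of_length_three[OF assms, of Z] Z by auto
  qed
  then show "m \<le> 2" unfolding m by (simp add: numeral_eq_enat)
qed

section \<open>The singular locus\<close>

definition pair_vec :: "'k \<Rightarrow> 'k \<Rightarrow> 'k ^ 2" where
  "pair_vec s t = (\<chi> i. if i = 1 then s else t)"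

lemma pair_vec_nth [simp]: "pair_vec s t $ 1 = s" "pair_vec s t $ 2 = t"
  by (simp_all add: pair_vec_def)

lemma pair_vec_eta: "pair_vec (x $ 1) (x $ 2) = x"
  by (auto simp: Finite_Cartesian_Product.vec_eq_iff forall_2)

lemma pair_vec_scale: "c *s pair_vec s t = pair_vec (c * s) (c * t)"
  by (auto simp: Finite_Cartesian_Product.vec_eq_iff forall_2)

lemma pair_vec_eq_0: "pair_vec s t = 0 \<longleftrightarrow> (s, t) = (0, 0)"
  by (auto simp: Finite_Cartesian_Product.vec_eq_iff forall_2)

definition bi_fun :: "'k::field bipoly \<Rightarrow> 'k \<Rightarrow> 'k \<Rightarrow> 'k \<Rightarrow> 'k \<Rightarrow> 'k" where
  "bi_fun g s t u v = bi_eval g (pair_vec s t) (pair_vec u v)"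

lemma prod_bi_variables: "prod h (UNIV :: (2 + 2) set) = h (Inl 1) * h (Inl 2) * (h (Inr 1) * h (Inr 2))"
  for h :: "2 + 2 \<Rightarrow> 'a::comm_monoid_mult"
  by (simp flip: UNIV_Plus_UNIV add: prod.Plus UNIV_2 ac_simps)

lemma bi_fun_expansion:
  assumes "g \<in> bigraded_piece a b"
  shows "bi_fun g s t u v = (\<Sum>m\<in>Poly_Mapping.keys g. Poly_Mapping.lookup g m *
     (s ^ Poly_Mapping.lookup m (Inl 1) * t ^ (a - Poly_Mapping.lookup m (Inl 1))) *
     (u ^ Poly_Mapping.lookup m (Inr 1) * v ^ (b - Poly_Mapping.lookup m (Inr 1))))"
  unfolding bi_fun_def bi_eval_def mp_eval_eq_aeval eval_field.aeval_def mono_eval_def prod_bi_variables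
proof (intro sum.cong refl)
  fix m assume "m \<in> Poly_Mapping.keys g"
  then have "Poly_Mapping.lookup m (Inl 1) + Poly_Mapping.lookup m (Inl 2) = a"
    "Poly_Mapping.lookup m (Inr 1) + Poly_Mapping.lookup m (Inr 2) = b"
    using assms by (auto simp: bigraded_piece_def sum_2)
  then have "Poly_Mapping.lookup m (Inl 2) = a - Poly_Mapping.lookup m (Inl 1)"
    "Poly_Mapping.lookup m (Inr 2) = b - Poly_Mapping.lookup m (Inr 1)" by simp_all
  then show "Poly_Mapping.lookup g m *
      (case_sum (($) (pair_vec s t)) (($) (pair_vec u v)) (Inl 1) ^ Poly_Mapping.lookup m (Inl 1) *
       case_sum (($) (pair_vec s t)) (($) (pair_vec u v)) (Inl 2) ^ Poly_Mapping.lookup m (Inl 2) *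
       (case_sum (($) (pair_vec s t)) (($) (pair_vec u v)) (Inr 1) ^ Poly_Mapping.lookup m (Inr 1) *
        case_sum (($) (pair_vec s t)) (($) (pair_vec u v)) (Inr 2) ^ Poly_Mapping.lookup m (Inr 2))) =
     Poly_Mapping.lookup g m *
     (s ^ Poly_Mapping.lookup m (Inl 1) * t ^ (a - Poly_Mapping.lookup m (Inl 1))) *
     (u ^ Poly_Mapping.lookup m (Inr 1) * v ^ (b - Poly_Mapping.lookup m (Inr 1)))"
    by (simp add: mult.assoc)
qed

lemma bigraded_exponents:
  assumes "g \<in> bigraded_piece a b" "m \<in> Poly_Mapping.keys g"
  shows "Poly_Mapping.lookup m (Inl 1) + Poly_Mapping.lookup m (Inl 2) = a"
    "Poly_Mapping.lookup m (Inr 1) + Poly_Mapping.lookup m (Inr 2) = b"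
  using assms by (auto simp: bigraded_piece_def sum_2)

lemma biform_bi_fun:
  assumes "g \<in> bigraded_piece a b"
  shows "biform a b (bi_fun g)"
proof -
  have "biform a b (\<lambda>s t u v. \<Sum>m\<in>Poly_Mapping.keys g. Poly_Mapping.lookup g m *
     (s ^ Poly_Mapping.lookup m (Inl 1) * t ^ (a - Poly_Mapping.lookup m (Inl 1))) *
     (u ^ Poly_Mapping.lookup m (Inr 1) * v ^ (b - Poly_Mapping.lookup m (Inr 1))))"
    using bigraded_exponents[OF assms] by (intro biform_sum biform_monom) (metis le_add1)+
  then show ?thesis unfolding bi_fun_expansion[OF assms, symmetric] .
qed

text \<open>Within one bidegree, a monomial is determined by its exponents of \<open>s\<close> and \<open>u\<close>, hence still visible
  after setting \<open>t = v = 1\<close>.\<close>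

lemma bigraded_eq_0_if_bi_fun_eq_0:
  fixes g :: "'k::alg_closed_field bipoly"
  assumes g: "g \<in> bigraded_piece a b" and zero: "\<And>s t u v. bi_fun g s t u v = 0"
  shows "g = 0"
proof (rule ccontr)
  assume "g \<noteq> 0"
  then obtain m0 where m0: "m0 \<in> Poly_Mapping.keys g" using keys_eq_empty by blast
  let ?i = "\<lambda>m. Poly_Mapping.lookup m (Inl 1)" and ?j = "\<lambda>m. Poly_Mapping.lookup m (Inr 1)"
  define P where "P = (\<Sum>m\<in>Poly_Mapping.keys g. monom (monom (Poly_Mapping.lookup g m) (?j m)) (?i m))"
  have "P = 0"
  proof (rule poly_poly_eqI)
    fix X Y
    have "eval2 P X Y = bi_fun g X 1 Y 1"
      unfolding P_def bi_fun_expansion[OF g] by (simp add: mult.assoc)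
    then show "eval2 P X Y = eval2 0 X Y" by (simp add: zero)
  qed
  have inj: "m = m0" if m: "m \<in> Poly_Mapping.keys g" "?i m = ?i m0" "?j m = ?j m0" for m
  proof (rule poly_mapping_eqI)
    fix k :: "2 + 2"
    have eqs: "Poly_Mapping.lookup m (Inl 2) = Poly_Mapping.lookup m0 (Inl 2)"
      "Poly_Mapping.lookup m (Inr 2) = Poly_Mapping.lookup m0 (Inr 2)"
      using bigraded_exponents[OF g m(1)] bigraded_exponents[OF g m0] m(2,3) by linarith+
    show "Poly_Mapping.lookup m k = Poly_Mapping.lookup m0 k"
    proof (cases k)
      case (Inl i)
      then show ?thesis using exhaust_2[of i] m(2) eqs(1) by auto
    next
      case (Inr i)
      then show ?thesis using exhaust_2[of i] m(3) eqs(2) by auto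
    qed
  qed
  have "coeff (coeff P (?i m0)) (?j m0) =
      (\<Sum>m\<in>Poly_Mapping.keys g. if m = m0 then Poly_Mapping.lookup g m0 else 0)"
    unfolding P_def coeff_sum using inj by (intro sum.cong refl) (auto simp: coeff_monom)
  also have "\<dots> \<noteq> 0" using m0 by (simp add: in_keys_iff)
  finally show False using \<open>P = 0\<close> by simp
qed

lemma span_singleton_proj_point:
  fixes x :: "'k::field ^ 'n::finite"
  assumes "x \<noteq> 0"
  shows "vec.span {x} \<in> proj_space"
proof -
  have "vec.independent {x}" using assms by simp
  then have "vec.dim (vec.span {x}) = 1" by (simp only: vec.dim_span vec.dim_eq_card_independent) simp
  then show ?thesis by (simp add: proj_space_def)
qed

lemma proj_line_point:
  fixes P :: "('k::field ^ 2) set"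
  assumes "P \<in> proj_space"
  shows "\<exists>s t. (s, t) \<noteq> (0, 0) \<and> P = vec.span {pair_vec s t}"
proof -
  obtain x where "x \<noteq> 0" "P = vec.span {x}" using proj_point_span[OF assms] by blast
  then have "pair_vec (x $ 1) (x $ 2) \<noteq> 0" "P = vec.span {pair_vec (x $ 1) (x $ 2)}"
    unfolding pair_vec_eta by blast+
  then show ?thesis unfolding pair_vec_eq_0 by blast
qed

lemma bi_eval_scale:
  assumes "g \<in> bigraded_piece a b"
  shows "bi_eval g (c *s pair_vec s t) (d *s pair_vec u v) = c ^ a * d ^ b * bi_fun g s t u v"
proof -
  obtain P where "bi_fun g = hom_eval a b P" using biform_bi_fun[OF assms] by (auto simp: biform_def)
  then have "bi_fun g (c * s) (c * t) (d * u) (d * v) = c ^ a * d ^ b * bi_fun g s t u v"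
    by (simp add: hom_eval_scale)
  then show ?thesis by (simp only: pair_vec_scale bi_fun_def)
qed

text \<open>By bihomogeneity, the values at the other representatives are multiples of the value at the given
  ones.\<close>

lemma phi_map_span:
  fixes p :: "'k::field bipoly ^ 4"
  assumes p: "\<And>i. p $ i \<in> bigraded_piece a b"
  shows "phi_map p (vec.span {pair_vec s t}, vec.span {pair_vec u v}) =
     vec.span {\<chi> i. bi_fun (p $ i) s t u v}"
proof -
  let ?w = "\<chi> i. bi_fun (p $ i) s t u v"
  let ?S = "{(\<chi> i. bi_eval (p $ i) x y) |x y. x \<in> vec.span {pair_vec s t} \<and> y \<in> vec.span {pair_vec u v}}"
  have eq: "(\<chi> i. bi_eval (p $ i) (c *s pair_vec s t) (d *s pair_vec u v)) = (c ^ a * d ^ b) *s ?w" for c d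
    by (simp add: Finite_Cartesian_Product.vec_eq_iff bi_eval_scale[OF p])
  have "?w = (\<chi> i. bi_eval (p $ i) (pair_vec s t) (pair_vec u v))" by (simp add: bi_fun_def)
  then have "?w \<in> ?S" using vec.span_base by blast
  moreover have "?S \<subseteq> vec.span {?w}"
  proof
    fix z assume "z \<in> ?S"
    then obtain c d where "z = (\<chi> i. bi_eval (p $ i) (c *s pair_vec s t) (d *s pair_vec u v))"
      by (auto simp: vec.span_singleton)
    then show "z \<in> vec.span {?w}" unfolding eq vec.span_singleton by blast
  qed
  ultimately have "vec.span ?S = vec.span {?w}"
    by (meson empty_subsetI insert_subset subset_antisym vec.span_mono vec.span_minimal vec.subspace_span)
  then show ?thesis by (simp add: phi_map_def)
qed

lemma image_variety_eq:
  fixes p :: "'k::field bipoly ^ 4"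
  assumes p: "\<And>i. p $ i \<in> bigraded_piece a b"
  shows "image_variety p = {vec.span {\<chi> i. bi_fun (p $ i) s t u v} |s t u v. (s, t) \<noteq> (0, 0) \<and> (u, v) \<noteq> (0, 0)}"
    (is "_ = ?R")
proof
  show "image_variety p \<subseteq> ?R"
  proof
    fix Q assume "Q \<in> image_variety p"
    then obtain A B where AB: "A \<in> proj_space" "B \<in> proj_space" "Q = phi_map p (A, B)"
      by (auto simp: image_variety_def)
    obtain s t where st: "(s, t) \<noteq> (0, 0)" "A = vec.span {pair_vec s t}" using proj_line_point[OF AB(1)] by blast
    obtain u v where uv: "(u, v) \<noteq> (0, 0)" "B = vec.span {pair_vec u v}" using proj_line_point[OF AB(2)] by blast
    have "Q = vec.span {\<chi> i. bi_fun (p $ i) s t u v}" unfolding AB(3) st(2) uv(2) by (rule phi_map_span[OF p])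
    then show "Q \<in> ?R" using st(1) uv(1) by blast
  qed
  show "?R \<subseteq> image_variety p"
  proof
    fix Q assume "Q \<in> ?R"
    then obtain s t u v where *: "(s, t) \<noteq> (0, 0)" "(u, v) \<noteq> (0, 0)" "Q = vec.span {\<chi> i. bi_fun (p $ i) s t u v}"
      by blast
    then have "Q = phi_map p (vec.span {pair_vec s t}, vec.span {pair_vec u v})" by (simp only: phi_map_span[OF p])
    moreover have "vec.span {pair_vec s t} \<in> proj_space" "vec.span {pair_vec u v} \<in> proj_space"
      using *(1,2) by (intro span_singleton_proj_point; simp only: pair_vec_eq_0 not_False_eq_True)+
    ultimately show "Q \<in> image_variety p" unfolding image_variety_def by blast
  qed
qed

lemma basepoint_free_imp:
  fixes p :: "'k::field bipoly ^ 4"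
  assumes p: "\<And>i. p $ i \<in> bigraded_piece a b" and bp: "basepoint_free p"
  shows "\<forall>s t u v. (s, t) \<noteq> (0, 0) \<longrightarrow> (u, v) \<noteq> (0, 0) \<longrightarrow> (\<exists>i. bi_fun (p $ i) s t u v \<noteq> 0)"
proof (intro allI impI, rule ccontr)
  fix s t u v :: 'k
  assume st: "(s, t) \<noteq> (0, 0)" and uv: "(u, v) \<noteq> (0, 0)" and "\<not> (\<exists>i. bi_fun (p $ i) s t u v \<noteq> 0)"
  then have "bi_eval (p $ i) (c *s pair_vec s t) (d *s pair_vec u v) = 0" for i c d
    by (simp add: bi_eval_scale[OF p])
  then have "\<forall>i. \<forall>x\<in>vec.span {pair_vec s t}. \<forall>y\<in>vec.span {pair_vec u v}. bi_eval (p $ i) x y = 0"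
    by (auto simp: vec.span_singleton)
  moreover have "vec.span {pair_vec s t} \<in> proj_space" "vec.span {pair_vec u v} \<in> proj_space"
    using st uv by (intro span_singleton_proj_point; simp only: pair_vec_eq_0 not_False_eq_True)+
  ultimately show False using bp unfolding basepoint_free_def by blast
qed

lemma bi_fun_mult: "bi_fun (g * h) s t u v = bi_fun g s t u v * bi_fun h s t u v"
  and bi_fun_sum: "bi_fun (\<Sum>i\<in>I. g' i) s t u v = (\<Sum>i\<in>I. bi_fun (g' i) s t u v)"
  and bi_fun_scale: "bi_fun (mp_scale c g) s t u v = c * bi_fun g s t u v"
  by (simp_all add: bi_fun_def bi_eval_def mp_eval_mult mp_eval_sum mp_scale_def mp_eval_single)

lemma basis_linearly_independent:
  fixes p :: "'k::alg_closed_field bipoly ^ 4"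
  assumes basis: "is_basis_of p U" and U: "mp_subspace U" "U \<subseteq> bigraded_piece a b"
  shows "\<forall>c :: 'k ^ 4. (\<forall>s t u v. (\<Sum>i\<in>UNIV. c $ i * bi_fun (p $ i) s t u v) = 0) \<longrightarrow> c = 0"
proof (intro allI impI)
  fix c :: "'k ^ 4"
  assume zero: "\<forall>s t u v. (\<Sum>i\<in>UNIV. c $ i * bi_fun (p $ i) s t u v) = 0"
  have pU: "p $ i \<in> U" for i using basis mp.span_base[of "p $ i" "range (($) p)"]
    by (auto simp: is_basis_of_def)
  let ?g = "\<Sum>i\<in>UNIV. mp_scale (c $ i) (p $ i)"
  have "?g \<in> U" using U(1) pU by (intro mp.subspace_sum mp.subspace_scale)
  then have "?g \<in> bigraded_piece a b" using U(2) by blast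
  moreover have "bi_fun ?g s t u v = 0" for s t u v using zero by (simp add: bi_fun_sum bi_fun_scale)
  ultimately have g0: "?g = 0" by (rule bigraded_eq_0_if_bi_fun_eq_0)
  have inj: "inj (($) p)" and ind: "mp_independent (range (($) p))" using basis by (auto simp: is_basis_of_def)
  then have ind': "\<not> mp.dependent (range (($) p))" by (simp add: mp_independent_def)
  let ?c = "\<lambda>q. c $ (inv_into UNIV (($) p) q)"
  have sum0: "(\<Sum>q\<in>range (($) p). mp_scale (?c q) q) = 0"
    using g0 by (simp add: sum.reindex[OF inj] inv_f_f[OF inj])
  have fin: "finite (range (($) p))" by simp
  have "\<not> (\<exists>q\<in>range (($) p). ?c q \<noteq> 0)"
  proof
    assume "\<exists>q\<in>range (($) p). ?c q \<noteq> 0"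
    then have "mp.dependent (range (($) p))"
      unfolding mp.dependent_finite[OF fin] using sum0 by (intro exI[of _ ?c] conjI)
    then show False using ind' by contradiction
  qed
  then have c0: "?c (p $ i) = 0" for i by blast
  have "c $ i = 0" for i using c0[of i] unfolding inv_f_f[OF inj] .
  then show "c = 0" by (simp add: Finite_Cartesian_Product.vec_eq_iff)
qed

lemma linear_form_in_second_factor:
  fixes g :: "'k::alg_closed_field bipoly"
  assumes "g \<in> bigraded_piece 0 1"
  shows "\<exists>x y. (\<forall>s t u v. bi_fun g s t u v = x * u + y * v) \<and> (x = 0 \<longrightarrow> y = 0 \<longrightarrow> g = 0)"
proof -
  obtain P where P: "bi_fun g = hom_eval 0 1 P" using biform_bi_fun[OF assms] by (auto simp: biform_def)
  let ?x = "coeff (coeff P 0) 1" and ?y = "coeff (coeff P 0) 0"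
  have eq: "bi_fun g s t u v = ?x * u + ?y * v" for s t u v by (simp add: P hom_eval_def)
  have "g = 0" if "?x = 0" "?y = 0"
    by (rule bigraded_eq_0_if_bi_fun_eq_0[OF assms]) (simp only: eq that, simp)
  then show ?thesis using eq by blast
qed

lemma linear_form_in_first_factor:
  fixes g :: "'k::alg_closed_field bipoly"
  assumes "g \<in> bigraded_piece 1 0"
  shows "\<exists>x y. (\<forall>s t u v. bi_fun g s t u v = x * s + y * t) \<and> (x = 0 \<longrightarrow> y = 0 \<longrightarrow> g = 0)"
proof -
  obtain P where P: "bi_fun g = hom_eval 1 0 P" using biform_bi_fun[OF assms] by (auto simp: biform_def)
  let ?x = "coeff (coeff P 1) 0" and ?y = "coeff (coeff P 0) 0"
  have eq: "bi_fun g s t u v = ?x * s + ?y * t" for s t u v by (simp add: P hom_eval_def)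
  have "g = 0" if "?x = 0" "?y = 0"
    by (rule bigraded_eq_0_if_bi_fun_eq_0[OF assms]) (simp only: eq that, simp)
  then show ?thesis using eq by blast
qed

text \<open>Along the line spanned by \<open>x\<close> and \<open>y\<close> all derivatives of the forms vanishing on the image vanish,
  so the embedded tangent space has dimension \<open>4\<close>, while nonsingularity would require it to be at most
  \<open>3\<close>, one more than the dimension of the surface.\<close>

lemma line_in_singular_locus:
  fixes p :: "'k::alg_closed_field bipoly ^ 4"
  assumes p: "\<And>i. p $ i \<in> bigraded_piece a b" and ab: "a > 0" "b > 0"
    and bpfree: "\<forall>s t u v. (s, t) \<noteq> (0, 0) \<longrightarrow> (u, v) \<noteq> (0, 0) \<longrightarrow> (\<exists>i. bi_fun (p $ i) s t u v \<noteq> 0)"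
    and indep: "\<forall>c d. c *s x + d *s y = 0 \<longrightarrow> c = 0 \<and> d = 0"
    and on_line: "\<And>c d. (c, d) \<noteq> (0, 0) \<Longrightarrow> \<exists>s t u v \<rho>. (s, t) \<noteq> (0, 0) \<and> (u, v) \<noteq> (0, 0) \<and> \<rho> \<noteq> 0 \<and>
        (\<forall>i. bi_fun (p $ i) s t u v = \<rho> * (c * x $ i + d * y $ i))"
    and flat: "\<And>D F j c d. homogeneous D F \<Longrightarrow> (\<And>s t u v. mp_eval F (\<lambda>i. bi_fun (p $ i) s t u v) = 0) \<Longrightarrow>
        mp_eval (mp_deriv j F) (\<lambda>i. c * x $ i + d * y $ i) = 0"
  shows "\<exists>L. is_line L \<and> L \<subseteq> singular_locus (image_variety p)"
proof -
  let ?X = "image_variety p"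
  let ?f = "\<lambda>i. bi_fun (p $ i)"
  note bf = biform_bi_fun[OF p]
  note X = image_variety_eq[OF p]
  have "?X \<subseteq> proj_space"
  proof
    fix P assume "P \<in> ?X"
    then obtain s t u v where *: "(s, t) \<noteq> (0, 0)" "(u, v) \<noteq> (0, 0)" "P = vec.span {\<chi> i. ?f i s t u v}"
      unfolding X by blast
    then obtain i where "?f i s t u v \<noteq> 0" using bpfree by blast
    then have "(\<chi> i. ?f i s t u v) \<noteq> 0" by (auto simp: Finite_Cartesian_Product.vec_eq_iff)
    then show "P \<in> proj_space" unfolding *(3) by (rule span_singleton_proj_point)
  qed
  then have dim: "dim_at ?X P \<le> 2" for P
    by (rule dim_at_le_two[where f = ?f, OF bf ab]) (auto simp: X)
  have span: "z \<in> vec.span {x, y} \<longleftrightarrow> (\<exists>c d. z = c *s x + d *s y)" for z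
    by (auto simp: vec.span_insert vec.span_singleton algebra_simps)
  have "x \<noteq> y"
  proof
    assume "x = y"
    then have "1 *s x + (- 1) *s y = 0" by (simp add: Finite_Cartesian_Product.vec_eq_iff)
    from indep[rule_format, OF this] show False by simp
  qed
  have "vec.independent {x, y}"
  proof -
    have "y \<noteq> 0"
    proof
      assume "y = 0"
      then have "0 *s x + 1 *s y = 0" by simp
      from indep[rule_format, OF this] show False by simp
    qed
    moreover have "x \<notin> vec.span {y}"
    proof
      assume "x \<in> vec.span {y}"
      then obtain k where "x = k *s y" by (auto simp: vec.span_singleton)
      then have "1 *s x + (- k) *s y = 0" by (simp add: Finite_Cartesian_Product.vec_eq_iff)
      from indep[rule_format, OF this] show False by simp
    qed
    ultimately show ?thesis by (subst vec.independent_insert) auto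
  qed
  then have dim2: "vec.dim (vec.span {x, y}) = 2"
    using \<open>x \<noteq> y\<close> vec.dim_eq_card_independent[of "{x, y}"] by (simp add: vec.dim_span)
  define L where "L = {P \<in> proj_space. P \<subseteq> vec.span {x, y}}"
  have "is_line L"
    unfolding is_line_def L_def using dim2 by (intro exI[of _ "vec.span {x, y}"]) (simp add: vec.subspace_span)
  moreover have "L \<subseteq> singular_locus ?X"
  proof
    fix P assume "P \<in> L"
    then obtain z where z: "z \<noteq> 0" "P = vec.span {z}" and PW: "P \<subseteq> vec.span {x, y}"
      using proj_point_span by (auto simp: L_def)
    then have "z \<in> vec.span {x, y}" using vec.span_base by blast
    then obtain c d where cd: "z = c *s x + d *s y" using span by blast
    then have "(c, d) \<noteq> (0, 0)" using z(1) by auto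
    from on_line[OF this] obtain s t u v \<rho> where st: "(s, t) \<noteq> (0, 0)" "(u, v) \<noteq> (0, 0)" and "\<rho> \<noteq> 0"
      and "\<forall>i. ?f i s t u v = \<rho> * (c * x $ i + d * y $ i)" by (elim exE conjE)
    then have w: "(\<chi> i. ?f i s t u v) = \<rho> *s z" by (simp add: Finite_Cartesian_Product.vec_eq_iff cd)
    have "vec.span {\<rho> *s z} = vec.span {z}"
    proof
      show "vec.span {\<rho> *s z} \<subseteq> vec.span {z}"
        by (intro vec.span_minimal) (auto intro: vec.span_scale vec.span_base)
      have "(1 / \<rho>) *s (\<rho> *s z) \<in> vec.span {\<rho> *s z}" by (intro vec.span_scale vec.span_base) simp
      then have "z \<in> vec.span {\<rho> *s z}" using \<open>\<rho> \<noteq> 0\<close> by (simp add: vector_smult_assoc)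
      then show "vec.span {z} \<subseteq> vec.span {\<rho> *s z}" by (intro vec.span_minimal) auto
    qed
    then have "P = vec.span {\<chi> i. ?f i s t u v}" unfolding w z(2) by simp
    then have PX: "P \<in> ?X" unfolding X using st by blast
    have "embedded_tangent_space ?X P = UNIV"
    proof -
      have "mp_eval (mp_deriv j F) (($) x') = 0" if F: "F \<in> vanishing_forms ?X" and x': "x' \<in> P" for F x' j
      proof -
        obtain D where D: "homogeneous D F" using F by (auto simp: vanishing_forms_def)
        have "mp_eval F (\<lambda>i. ?f i S 1 V 1) = 0" for S V
        proof -
          have "(S, 1) \<noteq> (0, 0 :: 'k)" "(V, 1) \<noteq> (0, 0 :: 'k)" by simp_all
          then have "vec.span {\<chi> i. ?f i S 1 V 1} \<in> ?X" unfolding X by blast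
          then have "vanishes_at F (vec.span {\<chi> i. ?f i S 1 V 1})" using F by (simp add: vanishing_forms_def)
          then have "mp_eval F (($) (\<chi> i. ?f i S 1 V 1)) = 0" unfolding vanishes_at_span[OF D] .
          moreover have "($) (\<chi> i. ?f i S 1 V 1) = (\<lambda>i. ?f i S 1 V 1)" by auto
          ultimately show ?thesis by simp
        qed
        then have "(\<lambda>s t u v. mp_eval F (\<lambda>i. ?f i s t u v)) = (\<lambda>s t u v. 0)"
          by (intro biform_eqI[OF biform_mp_eval[OF D bf] biform_zero])
        then have F0: "mp_eval F (\<lambda>i. ?f i s t u v) = 0" for s t u v by (simp add: fun_eq_iff)
        obtain c' d' where "x' = c' *s x + d' *s y" using PW x' span by blast
        then have "($) x' = (\<lambda>i. c' * x $ i + d' * y $ i)" by auto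
        then show ?thesis using flat[OF D F0] by simp
      qed
      then show ?thesis by (auto simp: embedded_tangent_space_def)
    qed
    then have "vec.dim (embedded_tangent_space ?X P) = 4"
      by (simp only: vec.dim_UNIV card_cart_basis) simp
    moreover have "enat 4 \<noteq> dim_at ?X P + 1"
    proof
      assume "enat 4 = dim_at ?X P + 1"
      also have "\<dots> \<le> 2 + 1" by (intro add_right_mono dim)
      finally show False by (simp add: numeral_eq_enat one_enat_def)
    qed
    ultimately show "P \<in> singular_locus ?X" using PX by (simp add: singular_locus_def nonsingular_at_def)
  qed
  ultimately show ?thesis by blast
qed

theorem corollary2p4:
  fixes U :: "'k::alg_closed_field bipoly set"
    and p :: "'k bipoly ^ 4"
    and a b :: nat
  assumes "a \<ge> 2" and "b \<ge> 2"
    and "mp_subspace U" and "U \<subseteq> bigraded_piece a b" and "mp_dim U = 4"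
    and "is_basis_of p U"
    and "basepoint_free p"
    and "has_linear_first_syzygy p"
  shows "\<exists>L. is_line L \<and> L \<subseteq> singular_locus (image_variety p)"
proof -
  have p: "p $ i \<in> bigraded_piece a b" for i
    using assms(4,6) mp.span_base[of "p $ i" "range (($) p)"] by (auto simp: is_basis_of_def)
  have ab: "a > 0" "b > 0" "a > 1" "b > 1" using assms(1,2) by simp_all
  note bpfree = basepoint_free_imp[OF p assms(7)]
  note indep = basis_linearly_independent[OF assms(6,3,4)]
  note bf = biform_bi_fun[OF p]
  obtain g where g: "first_syzygy p g" "g \<noteq> 0" "has_bidegree g 0 1 \<or> has_bidegree g 1 0"
    using assms(8) by (auto simp: has_linear_first_syzygy_def)
  have syz: "(\<Sum>i\<in>UNIV. bi_fun (g $ i) s t u v * bi_fun (p $ i) s t u v) = 0" for s t u v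
  proof -
    have "bi_fun (\<Sum>i\<in>UNIV. g $ i * p $ i) s t u v = 0"
      using g(1) by (simp add: first_syzygy_def bi_fun_def bi_eval_def)
    then show ?thesis by (simp add: bi_fun_sum bi_fun_mult)
  qed
  from g(3) show ?thesis
  proof
    assume "has_bidegree g 0 1"
    then have "\<forall>i. \<exists>x y. (\<forall>s t u v. bi_fun (g $ i) s t u v = x * u + y * v) \<and> (x = 0 \<longrightarrow> y = 0 \<longrightarrow> g $ i = 0)"
      using linear_form_in_second_factor by (auto simp: has_bidegree_def)
    then obtain x y where xy: "\<And>i s t u v. bi_fun (g $ i) s t u v = x i * u + y i * v"
      "\<And>i. x i = 0 \<Longrightarrow> y i = 0 \<Longrightarrow> g $ i = 0" by metis
    define \<alpha> :: "'k ^ 4" where "\<alpha> = (\<chi> i. x i)"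
    define \<beta> :: "'k ^ 4" where "\<beta> = (\<chi> i. y i)"
    have nz: "\<alpha> \<noteq> 0 \<or> \<beta> \<noteq> 0"
      using g(2) xy(2) by (auto simp: \<alpha>_def \<beta>_def Finite_Cartesian_Product.vec_eq_iff)
    have rel: "(\<Sum>i\<in>UNIV. (\<alpha> $ i * u + \<beta> $ i * v) * bi_fun (p $ i) s t u v) = 0" for s t u v
      using syz[of s t u v] by (simp add: xy(1) \<alpha>_def \<beta>_def)
    from contact_along_line[OF bf ab(1,4) indep bpfree rel nz]
    obtain X Y where XY: "\<forall>c d. c *s X + d *s Y = 0 \<longrightarrow> c = 0 \<and> d = 0"
      "\<forall>c d. (c, d) \<noteq> (0, 0) \<longrightarrow> (\<exists>s t u v \<rho>. (s, t) \<noteq> (0, 0) \<and> (u, v) \<noteq> (0, 0) \<and> \<rho> \<noteq> 0 \<and>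
        (\<forall>i. bi_fun (p $ i) s t u v = \<rho> * (c * X $ i + d * Y $ i)))"
      "\<forall>D F. homogeneous D F \<longrightarrow> (\<forall>s t u v. mp_eval F (\<lambda>i. bi_fun (p $ i) s t u v) = 0) \<longrightarrow>
        (\<forall>j c d. mp_eval (mp_deriv j F) (\<lambda>i. c * X $ i + d * Y $ i) = 0)" by (elim exE conjE)
    show ?thesis
      by (rule line_in_singular_locus[OF p ab(1,2) bpfree XY(1) XY(2)[rule_format]])
         (assumption, rule XY(3)[rule_format], assumption+)
  next
    assume "has_bidegree g 1 0"
    then have "\<forall>i. \<exists>x y. (\<forall>s t u v. bi_fun (g $ i) s t u v = x * s + y * t) \<and> (x = 0 \<longrightarrow> y = 0 \<longrightarrow> g $ i = 0)"
      using linear_form_in_first_factor by (auto simp: has_bidegree_def)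
    then obtain x y where xy: "\<And>i s t u v. bi_fun (g $ i) s t u v = x i * s + y i * t"
      "\<And>i. x i = 0 \<Longrightarrow> y i = 0 \<Longrightarrow> g $ i = 0" by metis
    define \<alpha> :: "'k ^ 4" where "\<alpha> = (\<chi> i. x i)"
    define \<beta> :: "'k ^ 4" where "\<beta> = (\<chi> i. y i)"
    define f where "f i s t u v = bi_fun (p $ i) u v s t" for i s t u v
    have nz: "\<alpha> \<noteq> 0 \<or> \<beta> \<noteq> 0"
      using g(2) xy(2) by (auto simp: \<alpha>_def \<beta>_def Finite_Cartesian_Product.vec_eq_iff)
    have rel: "(\<Sum>i\<in>UNIV. (\<alpha> $ i * u + \<beta> $ i * v) * f i s t u v) = 0" for s t u v
      using syz[of u v s t] by (simp add: xy(1) \<alpha>_def \<beta>_def f_def)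
    have bff: "biform b a (f i)" for i
      using biform_swap_factors[OF bf[of i]] unfolding f_def .
    have indepf: "\<forall>c :: 'k ^ 4. (\<forall>s t u v. (\<Sum>i\<in>UNIV. c $ i * f i s t u v) = 0) \<longrightarrow> c = 0"
      using indep unfolding f_def by blast
    have bpf: "\<forall>s t u v. (s, t) \<noteq> (0, 0) \<longrightarrow> (u, v) \<noteq> (0, 0) \<longrightarrow> (\<exists>i. f i s t u v \<noteq> 0)"
      using bpfree unfolding f_def by blast
    from contact_along_line[OF bff ab(2,3) indepf bpf rel nz]
    obtain X Y where XY: "\<forall>c d. c *s X + d *s Y = 0 \<longrightarrow> c = 0 \<and> d = 0"
      "\<forall>c d. (c, d) \<noteq> (0, 0) \<longrightarrow> (\<exists>s t u v \<rho>. (s, t) \<noteq> (0, 0) \<and> (u, v) \<noteq> (0, 0) \<and> \<rho> \<noteq> 0 \<and>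
        (\<forall>i. f i s t u v = \<rho> * (c * X $ i + d * Y $ i)))"
      "\<forall>D F. homogeneous D F \<longrightarrow> (\<forall>s t u v. mp_eval F (\<lambda>i. f i s t u v) = 0) \<longrightarrow>
        (\<forall>j c d. mp_eval (mp_deriv j F) (\<lambda>i. c * X $ i + d * Y $ i) = 0)" by (elim exE conjE)
    have on_line: "\<exists>s t u v \<rho>. (s, t) \<noteq> (0, 0) \<and> (u, v) \<noteq> (0, 0) \<and> \<rho> \<noteq> 0 \<and>
        (\<forall>i. bi_fun (p $ i) s t u v = \<rho> * (c * X $ i + d * Y $ i))" if cd: "(c, d) \<noteq> (0, 0)" for c d
    proof -
      obtain s t u v \<rho> where "(s, t) \<noteq> (0, 0)" "(u, v) \<noteq> (0, 0)" "\<rho> \<noteq> 0"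
        "\<forall>i. f i s t u v = \<rho> * (c * X $ i + d * Y $ i)"
        using XY(2)[rule_format, OF cd] by (elim exE conjE)
      then show ?thesis unfolding f_def by (intro exI conjI)
    qed
    have flat: "mp_eval (mp_deriv j F) (\<lambda>i. c * X $ i + d * Y $ i) = 0"
      if "homogeneous D F" "\<And>s t u v. mp_eval F (\<lambda>i. bi_fun (p $ i) s t u v) = 0" for D F j c d
      by (rule XY(3)[rule_format, OF that(1)]) (use that(2) in \<open>simp add: f_def\<close>)
    show ?thesis by (rule line_in_singular_locus[OF p ab(1,2) bpfree XY(1) on_line flat])
  qed
qed

end
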